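(* For all weights $\lambda,\mu\in\Lambda$ there is an isomorphism in $\mathcal A$ $$M_\lambda\otimes M_\mu\cong\bigoplus_{\rho\in\Omega'_{\lambda,\mu}}M_{\omega(\rho)}.$$
   Context: Fix a field $k$. A weight is a finite (possibly empty) word in the letters $\bullet$ (black), $\circ$ (white); $\Lambda$ is the set of weights. $[n]=\{1,\dots,n\}$. Ruffles. Let $\lambda,\mu$ be weights of lengths $m,n$. An $(m,n)$-ruffle of length $\ell$ is a pair of injective order-preserving maps $\rho_1\colon[m]\to[\ell]$, $\rho_2\colon[n]\to[\ell]$ with $[\ell]=\mathrm{im}(\rho_1)\cup\mathrm{im}(\rho_2)$. There is a collision at $i\in[\ell]$ if $i\in\mathrm{im}(\rho_1)\cap\mathrm{im}(\rho_2)$; if $i=\rho_1(a)=\rho_2(b)$, the collision is white if $\lambda_a=\mu_b=\circ$, black if $\lambda_a=\mu_b=\bullet$, neutral otherwise. A marking is a function $\rho_3$ from the set of neutral collisions to $\{\bullet,\circ,\varnothing\}$. $\Omega_{\lambda,\mu}$ is the set of marked ruffles $\rho=(\rho_1,\rho_2,\rho_3)$. To $\rho$ is associated the weight $\omega(\rho)=\nu_1\nu_2\cdots\nu_\ell$ (concatenation of words of length $0$ or $1$), where: if $i$ is not a collision, $\nu_i=\lambda_a$ if $i=\rho_1(a)$ and $\nu_i=\mu_b$ if $i=\rho_2(b)$; if $i$ is a black (resp. white) collision, $\nu_i=\bullet$ (resp. $\circ$); if $i$ is a neutral collision, $\nu_i=\rho_3(i)$ ($\varnothing$ being the empty word). $\Omega'_{\lambda,\mu}\subset\Omega_{\lambda,\mu}$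 is the subset of those $\rho$ (of length $\ell$) such that if $\ell$ is a neutral collision then $\rho_3(\ell)\ne\varnothing$. The second Delannoy category $\mathcal A$. Let $\mathbb G=\mathrm{Aut}(\mathbf R,<)$ be the group of order-preserving bijections of $\mathbf R$, and for a totally ordered set $I$ let $I^{(n)}$ be the set of tuples $x_1<\cdots<x_n$ in $I$ ($I^{(0)}$ is a point). For finite $S\subset\mathbf R$ let $\mathbb G(S)$ be its pointwise stabilizer. A $\mathbb G$-set means a set with a $\mathbb G$-action having finitely many orbits and such that every point stabilizer contains some $\mathbb G(S)$; the transitive ones are, up to isomorphism, the $\mathbf R^{(n)}$. If $S=\{a_1<\dots<a_r\}$ and $I_0=(-\infty,a_1),I_1=(a_1,a_2),\dots,I_r=(a_r,\infty)$ (with $I_0=\mathbf R$ if $r=0$), every $\mathbb G(S)$-orbit $O$ on a $\mathbb G$-set is isomorphic, as a $\mathbb G(S)$-set, to $\prod_{j=0}^r I_j^{(n_j)}$ for some $n_j\ge 0$; put $\mu_2(O)=(-1)^{n_0+\cdots+n_r}$ if $n_r=0$ and $\mu_2(O)=0$ if $n_r>0$. If $\varphi\colon X\to k$ is invariant under some $\mathbb G(S)$, put $\int_X\varphi=\sum_O\varphi(O)\mu_2(O)$ over the finitely many $\mathbb G(S)$-orbits $O$ on $X$; this is independent of $S$. Consider the category with objects $\mathscr A(X)$ for $\mathbb G$-sets $X$, morphisms $\mathscr A(X)\to\mathscr A(Y)$ the $\mathbb G$-invariant functions $Y\times X\to k$, composition $(BA)(z,x)=\int_Y B(z,y)A(y,x)\,dy$,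 direct sum $\mathscr A(X)\oplus\mathscr A(Y)=\mathscr A(X\amalg Y)$ and tensor product $\mathscr A(X)\otimes\mathscr A(Y)=\mathscr A(X\times Y)$ (Kronecker product on morphisms). $\mathcal A$ is its Karoubi completion. For a weight $\lambda$ of length $n$ let $E_\lambda$ be the indicator function of the set of $(y,x)\in\mathbf R^{(n)}\times\mathbf R^{(n)}$ with $y_i\le x_i$ if $\lambda_i=\bullet$, $x_i\le y_i$ if $\lambda_i=\circ$, and $y_i<x_{i+1}$, $x_i<y_{i+1}$ for $1\le i<n$; it is an idempotent endomorphism of $\mathscr A(\mathbf R^{(n)})$, and $M_\lambda=E_\lambda\mathscr A(\mathbf R^{(n)})$ is the corresponding summand. *)

theory Defs
  imports Complex_Main "HOL-Algebra.Group_Action"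
begin

section \<open>Weights and ruffles\<close>

datatype letter = Black | White

type_synonym weight = "letter list"

text \<open>Words and ruffles are indexed from 0, so that \<open>{..<n}\<close> plays the role of
  \<open>{1, \<dots>, n}\<close>. In a marking, \<open>None\<close> is the mark denoting the empty word.\<close>

record ruffle =
  len :: nat
  left :: "nat \<Rightarrow> nat"
  right :: "nat \<Rightarrow> nat"
  marking :: "nat \<Rightarrow> letter option"

definition collision :: "weight \<Rightarrow> weight \<Rightarrow> ruffle \<Rightarrow> nat \<Rightarrow> bool" where
  "collision lam mu \<rho> i \<longleftrightarrow>
     i \<in> left \<rho> ` {..<length lam} \<inter> right \<rho> ` {..<length mu}"

definition left_letter :: "weight \<Rightarrow> ruffle \<Rightarrow> nat \<Rightarrow> letter" where
  "left_letter lam \<rho> i = lam ! inv_into {..<length lam} (left \<rho>) i"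

definition right_letter :: "weight \<Rightarrow> ruffle \<Rightarrow> nat \<Rightarrow> letter" where
  "right_letter mu \<rho> i = mu ! inv_into {..<length mu} (right \<rho>) i"

definition neutral_collision :: "weight \<Rightarrow> weight \<Rightarrow> ruffle \<Rightarrow> nat \<Rightarrow> bool" where
  "neutral_collision lam mu \<rho> i \<longleftrightarrow>
     collision lam mu \<rho> i \<and> left_letter lam \<rho> i \<noteq> right_letter mu \<rho> i"

text \<open>The maps of a ruffle are extensional (\<open>undefined\<close> off their domain), so that
  each marked ruffle is counted exactly once.\<close>

definition marked_ruffles :: "weight \<Rightarrow> weight \<Rightarrow> ruffle set" where
  "marked_ruffles lam mu = {\<rho>.
     left \<rho> \<in> {..<length lam} \<rightarrow>\<^sub>E {..<len \<rho>} \<and>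
     strict_mono_on {..<length lam} (left \<rho>) \<and>
     right \<rho> \<in> {..<length mu} \<rightarrow>\<^sub>E {..<len \<rho>} \<and>
     strict_mono_on {..<length mu} (right \<rho>) \<and>
     {..<len \<rho>} = left \<rho> ` {..<length lam} \<union> right \<rho> ` {..<length mu} \<and>
     marking \<rho> \<in> {i. neutral_collision lam mu \<rho> i} \<rightarrow>\<^sub>E UNIV}"

definition ruffle_letter :: "weight \<Rightarrow> weight \<Rightarrow> ruffle \<Rightarrow> nat \<Rightarrow> weight" where
  "ruffle_letter lam mu \<rho> i =
     (if neutral_collision lam mu \<rho> i
      then (case marking \<rho> i of None \<Rightarrow> [] | Some c \<Rightarrow> [c])
      else if i \<in> left \<rho> ` {..<length lam} then [left_letter lam \<rho> i]
      else [right_letter mu \<rho> i])"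

definition ruffle_weight :: "weight \<Rightarrow> weight \<Rightarrow> ruffle \<Rightarrow> weight" where
  "ruffle_weight lam mu \<rho> = concat (map (ruffle_letter lam mu \<rho>) [0..<len \<rho>])"

definition marked_ruffles' :: "weight \<Rightarrow> weight \<Rightarrow> ruffle set" where
  "marked_ruffles' lam mu = {\<rho> \<in> marked_ruffles lam mu.
     \<forall>i. Suc i = len \<rho> \<and> neutral_collision lam mu \<rho> i \<longrightarrow> marking \<rho> i \<noteq> None}"


section \<open>Sets with an action of the order automorphisms of the real line\<close>

definition AutR :: "(real \<Rightarrow> real) monoid" where
  "AutR = \<lparr>carrier = {g. bij g \<and> strict_mono g}, mult = (\<circ>), one = id\<rparr>"

definition fixing :: "real set \<Rightarrow> (real \<Rightarrow> real) monoid" where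
  "fixing S = AutR\<lparr>carrier := {g \<in> carrier AutR. \<forall>s\<in>S. g s = s}\<rparr>"

record 'a gset =
  points :: "'a set"
  act :: "(real \<Rightarrow> real) \<Rightarrow> 'a \<Rightarrow> 'a"

definition is_gset :: "'a gset \<Rightarrow> bool" where
  "is_gset X \<longleftrightarrow>
     group_action AutR (points X) (act X) \<and>
     finite (orbits AutR (points X) (act X)) \<and>
     (\<forall>x\<in>points X. \<exists>S. finite S \<and> carrier (fixing S) \<subseteq> stabilizer AutR (act X) x)"

definition increasing_tuples :: "real set \<Rightarrow> nat \<Rightarrow> real list set" where
  "increasing_tuples I n = {xs. length xs = n \<and> set xs \<subseteq> I \<and> sorted_wrt (<) xs}"

definition tuples_gset :: "nat \<Rightarrow> real list gset" where
  "tuples_gset n =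
     \<lparr>points = increasing_tuples UNIV n,
      act = (\<lambda>g. \<lambda>xs\<in>increasing_tuples UNIV n. map g xs)\<rparr>"

definition prod_gset :: "'a gset \<Rightarrow> 'b gset \<Rightarrow> ('a \<times> 'b) gset" where
  "prod_gset X Y =
     \<lparr>points = points X \<times> points Y,
      act = (\<lambda>g. \<lambda>(x, y)\<in>points X \<times> points Y. (act X g x, act Y g y))\<rparr>"

definition coprod_gset :: "'i set \<Rightarrow> ('i \<Rightarrow> 'a gset) \<Rightarrow> ('i \<times> 'a) gset" where
  "coprod_gset I X =
     \<lparr>points = Sigma I (\<lambda>i. points (X i)),
      act = (\<lambda>g. \<lambda>(i, x)\<in>Sigma I (\<lambda>i. points (X i)). (i, act (X i) g x))\<rparr>"


section \<open>The measure and the integral\<close>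

text \<open>The \<open>j\<close>-th open interval (\<open>0 \<le> j \<le> card S\<close>) cut out by the finite set \<open>S\<close>.\<close>

definition gap :: "real set \<Rightarrow> nat \<Rightarrow> real set" where
  "gap S j = (let a = sorted_list_of_set S in
     {x. (0 < j \<longrightarrow> a ! (j - 1) < x) \<and> (j < length a \<longrightarrow> x < a ! j)})"

definition standard_orbit :: "real set \<Rightarrow> nat list \<Rightarrow> real list list set" where
  "standard_orbit S ns =
     {xss. length xss = length ns \<and>
           (\<forall>j<length ns. xss ! j \<in> increasing_tuples (gap S j) (ns ! j))}"

definition has_orbit_type :: "'a gset \<Rightarrow> real set \<Rightarrow> 'a set \<Rightarrow> nat list \<Rightarrow> bool" where
  "has_orbit_type X S U ns \<longleftrightarrow>
     length ns = Suc (card S) \<and>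
     (\<exists>h. bij_betw h U (standard_orbit S ns) \<and>
          (\<forall>g\<in>carrier (fixing S). \<forall>x\<in>U. h (act X g x) = map (map g) (h x)))"

text \<open>Every orbit \<open>U\<close> of \<open>fixing S\<close> on a set satisfying \<open>is_gset\<close> has exactly one
  orbit type, so the choice below is harmless.\<close>

definition mu2 :: "'a gset \<Rightarrow> real set \<Rightarrow> 'a set \<Rightarrow> 'k::field" where
  "mu2 X S U = (let ns = (SOME ns. has_orbit_type X S U ns) in
     if last ns = 0 then (- 1) ^ sum_list ns else 0)"

definition invariant_under :: "'a gset \<Rightarrow> real set \<Rightarrow> ('a \<Rightarrow> 'k) \<Rightarrow> bool" where
  "invariant_under X S \<phi> \<longleftrightarrow>
     (\<forall>g\<in>carrier (fixing S). \<forall>x\<in>points X. \<phi> (act X g x) = \<phi> x)"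

text \<open>The integral does not depend on the finite set \<open>S\<close> under whose stabilizer \<open>\<phi>\<close> is
  invariant; \<open>\<phi>\<close> takes a single value on each orbit \<open>U\<close>.\<close>

definition gset_integral :: "'a gset \<Rightarrow> ('a \<Rightarrow> 'k::field) \<Rightarrow> 'k" where
  "gset_integral X \<phi> = (let S = (SOME S. finite S \<and> invariant_under X S \<phi>) in
     \<Sum>U\<in>orbits (fixing S) (points X) (act X). the_elem (\<phi> ` U) * mu2 X S U)"


section \<open>The second Delannoy category\<close>

text \<open>A morphism \<open>X \<rightarrow> Y\<close> is a \<open>Y \<times> X\<close> matrix, extensional on \<open>Y \<times> X\<close>.\<close>

definition mors :: "'a gset \<Rightarrow> 'b gset \<Rightarrow> ('b \<times> 'a \<Rightarrow> 'k::field) set" where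
  "mors X Y = {A \<in> points Y \<times> points X \<rightarrow>\<^sub>E UNIV.
     \<forall>g\<in>carrier AutR. \<forall>y\<in>points Y. \<forall>x\<in>points X. A (act Y g y, act X g x) = A (y, x)}"

definition comp_mor ::
  "'a gset \<Rightarrow> 'b gset \<Rightarrow> 'c gset \<Rightarrow> ('c \<times> 'b \<Rightarrow> 'k::field) \<Rightarrow> ('b \<times> 'a \<Rightarrow> 'k) \<Rightarrow> 'c \<times> 'a \<Rightarrow> 'k"
where
  "comp_mor X Y Z B A =
     (\<lambda>(z, x)\<in>points Z \<times> points X. gset_integral Y (\<lambda>y. B (z, y) * A (y, x)))"

text \<open>Objects of the Karoubi completion are pairs of an object and an idempotent
  endomorphism of it. The idempotent is also the identity morphism of the pair.\<close>

record ('a, 'k) kobj =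
  base :: "'a gset"
  idem :: "'a \<times> 'a \<Rightarrow> 'k"

definition is_kobj :: "('a, 'k::field) kobj \<Rightarrow> bool" where
  "is_kobj P \<longleftrightarrow> is_gset (base P) \<and> idem P \<in> mors (base P) (base P) \<and>
     comp_mor (base P) (base P) (base P) (idem P) (idem P) = idem P"

definition khom :: "('a, 'k::field) kobj \<Rightarrow> ('b, 'k) kobj \<Rightarrow> ('b \<times> 'a \<Rightarrow> 'k) set" where
  "khom P Q = {A \<in> mors (base P) (base Q).
     comp_mor (base P) (base P) (base Q) A (idem P) = A \<and>
     comp_mor (base P) (base Q) (base Q) (idem Q) A = A}"

definition kiso :: "('a, 'k::field) kobj \<Rightarrow> ('b, 'k) kobj \<Rightarrow> bool"  (infix "\<cong>\<^sub>K" 50) where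
  "P \<cong>\<^sub>K Q \<longleftrightarrow> is_kobj P \<and> is_kobj Q \<and>
     (\<exists>A\<in>khom P Q. \<exists>B\<in>khom Q P.
        comp_mor (base P) (base Q) (base P) B A = idem P \<and>
        comp_mor (base Q) (base P) (base Q) A B = idem Q)"

definition ktensor ::
  "('a, 'k::field) kobj \<Rightarrow> ('b, 'k) kobj \<Rightarrow> ('a \<times> 'b, 'k) kobj"  (infixr "\<otimes>\<^sub>K" 70) where
  "P \<otimes>\<^sub>K Q = (let X = prod_gset (base P) (base Q) in
     \<lparr>base = X,
      idem = (\<lambda>((y, y'), (x, x'))\<in>points X \<times> points X. idem P (y, x) * idem Q (y', x'))\<rparr>)"

definition kdirect_sum ::
  "'i set \<Rightarrow> ('i \<Rightarrow> ('a, 'k::field) kobj) \<Rightarrow> ('i \<times> 'a, 'k) kobj" where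
  "kdirect_sum I P = (let X = coprod_gset I (\<lambda>i. base (P i)) in
     \<lparr>base = X,
      idem = (\<lambda>((i, y), (j, x))\<in>points X \<times> points X. if i = j then idem (P i) (y, x) else 0)\<rparr>)"

definition E_rel :: "weight \<Rightarrow> real list \<Rightarrow> real list \<Rightarrow> bool" where
  "E_rel lam y x \<longleftrightarrow>
     (\<forall>i<length lam. case lam ! i of Black \<Rightarrow> y ! i \<le> x ! i | White \<Rightarrow> x ! i \<le> y ! i) \<and>
     (\<forall>i. Suc i < length lam \<longrightarrow> y ! i < x ! Suc i \<and> x ! i < y ! Suc i)"

definition M :: "weight \<Rightarrow> (real list, 'k::field) kobj" where
  "M lam = (let X = tuples_gset (length lam) in
     \<lparr>base = X,
      idem = (\<lambda>(y, x)\<in>points X \<times> points X. if E_rel lam y x then 1 else 0)\<rparr>)"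

end

theory Submission
  imports Defs
begin

text \<open>
  The integral of a step function on the line is the sum of its jumps from the left, and integrals
  over tuples are iterated integrals over the line. In terms of this integral, \<open>E_lam\<close> is the
  projection onto the functions on the configuration space which in the black coordinates are
  continuous from the right and vanish at minus infinity, and in the white coordinates are
  continuous from the left. For two parallel chains of coordinates starting with \<open>p\<close> and \<open>q\<close>, such
  functions split according to \<open>p < q\<close>, \<open>q < p\<close> and \<open>p = q\<close>. If \<open>p\<close> and \<open>q\<close> have different colours,
  the functions on the stratum \<open>p = q\<close> satisfy no condition in that coordinate; they split
  into a black part, a white part and, if some coordinate follows, a part in which the coordinate has
  been integrated out. (If none follows, the coordinate is unbounded above and there is no such
  part, whence \<open>marked_ruffles'\<close>.) Recursion on the two chains produces the ruffles.
\<close>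

section \<open>Order automorphisms of the real line\<close>

text \<open>All morphisms live in one ring without unit, the ring of invariant kernels on lists of
  reals. Composition is its multiplication, so a direct sum decomposition in the Karoubi completion
  becomes a system of ring identities, and orbits and \<open>mu2\<close> enter only through
  \<open>coded_gset.integral_eq\<close>. Kernels are handled by their rows: \<open>K * e = K\<close>
  holds exactly if every row of \<open>K\<close> is a section of the kind that \<open>e\<close>
  projects onto (\<open>times_conf_idem_iff\<close>), which turns ring identities into statements
  about functions of one tuple. The splitting along \<open>p = q\<close> follows the pattern of a
  closed stratum with open complement: restriction to the diagonal has a one-sided inverse, and a
  section vanishing on the diagonal is the sum of extensions by zero from the two open strata. A
  coordinate can be integrated out as a direct summand if the open interval in which it moves has
  invertible volume. The volume is -1 if the interval is bounded above, with or without a lower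
  bound, and 0 otherwise.\<close>

abbreviation ginv :: "(real \<Rightarrow> real) \<Rightarrow> real \<Rightarrow> real" where
  "ginv \<equiv> inv_into UNIV"

definition auts :: "real set \<Rightarrow> (real \<Rightarrow> real) set" where
  "auts S = {g. bij g \<and> strict_mono g \<and> (\<forall>s\<in>S. g s = s)}"

lemma carrier_fixing: "carrier (fixing S) = auts S"
  by (auto simp: fixing_def AutR_def auts_def)

lemma carrier_AutR: "carrier AutR = auts {}"
  by (auto simp: AutR_def auts_def)

lemma auts_mono: "S \<subseteq> T \<Longrightarrow> auts T \<subseteq> auts S"
  by (auto simp: auts_def)

lemma auts_less: "g \<in> auts S \<Longrightarrow> g x < g y \<longleftrightarrow> x < y"
  by (auto simp: auts_def strict_mono_less)

lemma auts_le: "g \<in> auts S \<Longrightarrow> g x \<le> g y \<longleftrightarrow> x \<le> y"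
  by (auto simp: auts_def strict_mono_less_eq)

lemma auts_eq: "g \<in> auts S \<Longrightarrow> g x = g y \<longleftrightarrow> x = y"
  by (auto simp: auts_def strict_mono_eq)

lemma auts_fix: "g \<in> auts S \<Longrightarrow> s \<in> S \<Longrightarrow> g s = s"
  by (auto simp: auts_def)

lemma auts_cmp_fix:
  assumes "g \<in> auts S" "c \<in> S"
  shows "g x < c \<longleftrightarrow> x < c" "c < g x \<longleftrightarrow> c < x" "g x \<le> c \<longleftrightarrow> x \<le> c" "c \<le> g x \<longleftrightarrow> c \<le> x"
    "g x = c \<longleftrightarrow> x = c"
  using auts_less[OF assms(1), of x c] auts_less[OF assms(1), of c x] auts_le[OF assms(1), of x c]
    auts_le[OF assms(1), of c x] auts_eq[OF assms(1), of x c] auts_fix[OF assms] by simp_all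

lemma auts_mem:
  assumes "g \<in> auts S"
  shows "g t \<in> S \<longleftrightarrow> t \<in> S"
proof
  assume "g t \<in> S"
  with auts_fix[OF assms this] show "t \<in> S" using auts_eq[OF assms, of "g t" t] by simp
qed (simp add: auts_fix[OF assms])

lemma auts_inj: "g \<in> auts S \<Longrightarrow> inj_on g A"
  by (meson auts_eq inj_onI)

lemma auts_id: "id \<in> auts S" "(\<lambda>x. x) \<in> auts S"
  by (auto simp: auts_def strict_mono_def bij_def)

lemma auts_comp: "g \<in> auts S \<Longrightarrow> h \<in> auts S \<Longrightarrow> g \<circ> h \<in> auts S"
  by (auto simp: auts_def strict_mono_def bij_comp)

lemma auts_inv:
  assumes "g \<in> auts S"
  shows "ginv g \<in> auts S" "g (ginv g x) = x" "ginv g (g x) = x"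
proof -
  have b: "bij g" and m: "strict_mono g" and f: "\<forall>s\<in>S. g s = s"
    using assms by (auto simp: auts_def)
  show 1: "g (ginv g x) = x" for x by (simp add: b bij_is_surj surj_f_inv_f)
  show 2: "ginv g (g x) = x" for x by (simp add: b bij_is_inj)
  show "ginv g \<in> auts S"
    unfolding auts_def
  proof (safe)
    show "bij (ginv g)" by (simp add: b bij_imp_bij_inv)
    show "strict_mono (ginv g)"
      by (rule strict_monoI) (metis 1 m strict_mono_less)
    show "ginv g s = s" if "s \<in> S" for s using f 2 that by metis
  qed
qed

lemma inv_comp_auts: "g \<in> auts S \<Longrightarrow> map (ginv g) (map g xs) = xs"
  by (simp add: map_idI auts_inv)

text \<open>Interpolation: the automorphism found so far is kept up to the largest point
  \<open>m\<close> already treated and continued beyond \<open>m\<close> along a ray of positive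
  slope through the next prescribed value.\<close>

lemma strict_mono_on_extends:
  fixes f :: "real \<Rightarrow> real"
  assumes "finite A" "\<And>x y. x \<in> A \<Longrightarrow> y \<in> A \<Longrightarrow> x < y \<Longrightarrow> f x < f y"
  shows "\<exists>g\<in>auts {}. \<forall>x\<in>A. g x = f x"
  using assms
proof (induction A rule: finite_linorder_max_induct)
  case empty
  then show ?case using auts_id by auto
next
  case (insert a A)
  then obtain g where g: "g \<in> auts {}" "\<forall>x\<in>A. g x = f x" by fastforce
  show ?case
  proof (cases "A = {}")
    case True
    have "surj (\<lambda>x. x + (f a - a))" by (rule surjI[of _ "\<lambda>y. y - (f a - a)"]) simp
    hence "(\<lambda>x. x + (f a - a)) \<in> auts {}"
      by (auto simp: auts_def strict_mono_def bij_def inj_on_def)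
    then show ?thesis using True by (intro bexI[of _ "\<lambda>x. x + (f a - a)"]) auto
  next
    case False
    define m where "m = Max A"
    have m: "m \<in> A" "\<forall>x\<in>A. x \<le> m" using False insert(1) by (auto simp: m_def)
    have ma: "m < a" and fma: "f m < f a" and gm: "g m = f m" using m insert g by auto
    define c where "c = (f a - f m) / (a - m)"
    have c: "c > 0" using ma fma by (simp add: c_def)
    define h where "h = (\<lambda>x. if x \<le> m then g x else f m + (x - m) * c)"
    have sm: "strict_mono h"
    proof (rule strict_monoI)
      fix x y :: real assume xy: "x < y"
      show "h x < h y"
      proof (cases "y \<le> m")
        case True then show ?thesis using xy g(1) by (simp add: h_def auts_less)
      next
        case y: False
        show ?thesis
        proof (cases "x \<le> m")
          case True
          hence "g x \<le> f m" using g(1) gm by (metis auts_le)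
          moreover have "(y - m) * c > 0" using y c by simp
          ultimately show ?thesis using True y by (simp add: h_def)
        next
          case False then show ?thesis using y xy c by (simp add: h_def)
        qed
      qed
    qed
    have "\<exists>x. y = h x" for y
    proof (cases "y \<le> f m")
      case True
      have "g (ginv g y) = y" using g(1) by (rule auts_inv)
      moreover from this have "ginv g y \<le> m" using True gm g(1) by (metis auts_le)
      ultimately show ?thesis by (intro exI[of _ "ginv g y"]) (simp add: h_def)
    next
      case False
      have "m + (y - f m) / c > m" using False c by simp
      then show ?thesis using c by (intro exI[of _ "m + (y - f m) / c"]) (simp add: h_def)
    qed
    hence "surj h" by (auto simp: surj_def)
    moreover have "inj h" using sm by (simp add: strict_mono_imp_inj_on)
    ultimately have "h \<in> auts {}" using sm by (auto simp: auts_def bij_def)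
    moreover have "h a = f a" using ma by (simp add: h_def c_def)
    moreover have "\<forall>x\<in>A. h x = f x" using g(2) m by (simp add: h_def)
    ultimately show ?thesis by (intro bexI[of _ h]) auto
  qed
qed

text \<open>Homogeneity of the line: sending \<open>x\<close> to \<open>y\<close> while fixing
  \<open>S\<close> is an increasing map on a finite set, hence extends. The orbits of
  \<open>auts S\<close> on the line are therefore the points and the gaps of
  \<open>S\<close>.\<close>

lemma auts_move:
  assumes "finite S" "\<forall>s\<in>S. (s < x \<longleftrightarrow> s < y) \<and> (x < s \<longleftrightarrow> y < s)"
  shows "\<exists>g\<in>auts S. g x = y"
proof -
  define f where "f = (\<lambda>t. if t = x then y else t)"
  have "f u < f v" if "u \<in> insert x S" "v \<in> insert x S" "u < v" for u v
    using that assms(2) by (auto simp: f_def)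
  then obtain g where g: "g \<in> auts {}" "\<forall>t\<in>insert x S. g t = f t"
    using strict_mono_on_extends[of "insert x S" f] assms(1) by auto
  have "f s = s" if "s \<in> S" for s
    using assms(2)[rule_format, OF that] by (auto simp: f_def)
  hence "g s = s" if "s \<in> S" for s using that g(2) by simp
  then show ?thesis using g by (intro bexI[of _ g]) (auto simp: auts_def f_def)
qed

section \<open>Integration of step functions on the line\<close>

text \<open>Invariance under a stabilizer replaces a list of breakpoints and values, because the
  functions to be integrated arise from invariant kernels by fixing all but one argument.\<close>

definition step_on :: "real set \<Rightarrow> (real \<Rightarrow> 'k) \<Rightarrow> bool" where
  "step_on S h \<longleftrightarrow> finite S \<and> (\<forall>g\<in>auts S. \<forall>t. h (g t) = h t)"

text \<open>No set of breakpoints enters, so that \<open>sint\<close> is independent of such a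
  choice by definition.\<close>

definition left_lim :: "(real \<Rightarrow> 'k) \<Rightarrow> real \<Rightarrow> 'k" where
  "left_lim h s = (THE c. \<forall>\<^sub>F t in at_left s. h t = c)"

text \<open>The measure \<open>mu2\<close> on the line amounts to summing the jumps from the left.\<close>

definition sint :: "(real \<Rightarrow> 'k::comm_ring_1) \<Rightarrow> 'k" where
  "sint h = (\<Sum>s | h s \<noteq> left_lim h s. h s - left_lim h s)"

lemma step_onD:
  assumes "step_on S h" "\<forall>s\<in>S. (s < x \<longleftrightarrow> s < y) \<and> (x < s \<longleftrightarrow> y < s)"
  shows "h x = h y"
  using assms auts_move[of S x y] by (auto simp: step_on_def)

lemma step_on_mono: "step_on S h \<Longrightarrow> finite T \<Longrightarrow> S \<subseteq> T \<Longrightarrow> step_on T h"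
  using auts_mono[of S T] by (auto simp: step_on_def)

lemma left_lim_unique:
  assumes "\<forall>\<^sub>F t in at_left s. h t = c"
  shows "left_lim h s = c"
  unfolding left_lim_def
proof (rule the_equality)
  show "\<forall>\<^sub>F t in at_left s. h t = c" by (rule assms)
  fix d assume "\<forall>\<^sub>F t in at_left s. h t = d"
  with assms have "\<forall>\<^sub>F t in at_left s. c = d" by eventually_elim auto
  then show "d = c" by (simp add: eventually_const_iff)
qed

lemma left_lim_eqI:
  assumes "t < s" "\<And>u. t < u \<Longrightarrow> u < s \<Longrightarrow> h u = c"
  shows "left_lim h s = c"
  by (rule left_lim_unique) (use assms eventually_at_left_field in blast)

text \<open>A sample immediately below \<open>s\<close>, with no point of \<open>S\<close> in
  between; the left limit at \<open>s\<close> is the value there (\<open>left_lim_step\<close>). If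
  no point of \<open>S\<close> lies below \<open>s\<close>, then \<open>s - 1\<close>
  serves.\<close>

definition pred_point :: "real set \<Rightarrow> real \<Rightarrow> real" where
  "pred_point S s = (if \<exists>u\<in>S. u < s then (Max {u\<in>S. u < s} + s) / 2 else s - 1)"

lemma pred_point:
  assumes "finite S"
  shows "pred_point S s < s" "u \<in> S \<Longrightarrow> u < s \<Longrightarrow> u < pred_point S s"
proof -
  have "Max {u\<in>S. u < s} \<in> {u\<in>S. u < s}" if "\<exists>u\<in>S. u < s"
    using that assms by (intro Max_in) auto
  then show "pred_point S s < s" by (auto simp: pred_point_def)
  show "u < pred_point S s" if "u \<in> S" "u < s"
  proof -
    have "u \<le> Max {u\<in>S. u < s}" using that assms by (intro Max_ge) auto
    then show ?thesis using that by (auto simp: pred_point_def)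
  qed
qed

lemma left_lim_step:
  assumes "step_on S h"
  shows "left_lim h s = h (pred_point S s)"
proof (rule left_lim_eqI[of "pred_point S s"])
  have f: "finite S" using assms by (simp add: step_on_def)
  show "pred_point S s < s" using pred_point[OF f] by auto
  fix u assume u: "pred_point S s < u" "u < s"
  show "h u = h (pred_point S s)"
  proof (rule step_onD[OF assms], intro ballI)
    fix v assume "v \<in> S"
    with pred_point(1)[OF f, of s] pred_point(2)[OF f, of v s] u
    show "(v < u) = (v < pred_point S s) \<and> (u < v) = (pred_point S s < v)"
      by (metis less_trans not_less_iff_gr_or_eq)
  qed
qed

lemma left_lim_notin:
  assumes "step_on S h" "s \<notin> S"
  shows "left_lim h s = h s"
proof -
  have f: "finite S" using assms by (simp add: step_on_def)
  have "h (pred_point S s) = h s"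
  proof (rule step_onD[OF assms(1)], intro ballI)
    fix v assume "v \<in> S"
    with pred_point(1)[OF f, of s] pred_point(2)[OF f, of v s] assms(2)
    show "(v < pred_point S s) = (v < s) \<and> (pred_point S s < v) = (s < v)"
      by (metis less_trans not_less_iff_gr_or_eq)
  qed
  then show ?thesis using left_lim_step[OF assms(1)] by simp
qed

text \<open>Away from \<open>S\<close> there is no jump, so any sufficient set of breakpoints
  computes the integral. The explicit evaluations below rest on this formula.\<close>

lemma sint_eq:
  assumes "step_on S h"
  shows "sint h = (\<Sum>s\<in>S. h s - h (pred_point S s))"
proof -
  have f: "finite S" using assms by (simp add: step_on_def)
  have "sint h = (\<Sum>s\<in>S. h s - left_lim h s)"
    unfolding sint_def using left_lim_notin[OF assms] f
    by (intro sum.mono_neutral_left) (auto, metis)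
  then show ?thesis by (simp add: left_lim_step[OF assms])
qed

definition step :: "(real \<Rightarrow> 'k) \<Rightarrow> bool" where
  "step h \<longleftrightarrow> (\<exists>S. step_on S h)"

lemma stepI: "finite S \<Longrightarrow> (\<And>g t. g \<in> auts S \<Longrightarrow> h (g t) = h t) \<Longrightarrow> step h"
  unfolding step_def step_on_def by blast

lemma step_map2:
  assumes "step h" "step k"
  shows "step (\<lambda>t. F (h t) (k t))"
proof -
  obtain S T where "step_on S h" "step_on T k" using assms by (auto simp: step_def)
  then show ?thesis
    using auts_mono[of S "S \<union> T"] auts_mono[of T "S \<union> T"]
    by (intro stepI[of "S \<union> T"]) (auto simp: step_on_def subset_iff)
qed

lemma step_const: "step (\<lambda>t. c)"
  by (rule stepI[of "{}"]) auto

lemma step_cmp: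
  "step (\<lambda>t. t \<le> (c::real))" "step (\<lambda>t. c \<le> t)" "step (\<lambda>t. t < c)" "step (\<lambda>t. c < t)"
  "step (\<lambda>t. t = c)"
  by (rule stepI[of "{c}"]; simp add: auts_cmp_fix)+

lemma step_map1: "step h \<Longrightarrow> step (\<lambda>t. F (h t))"
  using step_map2[of h h "\<lambda>a b. F a"] by simp

lemma step_times: "step h \<Longrightarrow> step k \<Longrightarrow> step (\<lambda>t. h t * k t)"
  by (rule step_map2)

lemma step_of_bool: "step P \<Longrightarrow> step (\<lambda>t. of_bool (P t))"
  by (rule step_map1)

lemma step_plus: "step h \<Longrightarrow> step k \<Longrightarrow> step (\<lambda>t. h t + k t)"
  by (rule step_map2)

lemma step_minus: "step h \<Longrightarrow> step k \<Longrightarrow> step (\<lambda>t. h t - k t)"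
  by (rule step_map2)

lemmas step_intros = step_const step_cmp step_times step_of_bool step_plus step_minus

lemma sint_add:
  assumes "step h" "step k"
  shows "sint (\<lambda>t. h t + k t) = sint h + sint k"
proof -
  obtain S T where S: "step_on S h" and T: "step_on T k" using assms by (auto simp: step_def)
  have f: "finite (S \<union> T)" using S T by (auto simp: step_on_def)
  have 1: "step_on (S \<union> T) h" and 2: "step_on (S \<union> T) k"
    using step_on_mono[OF S f] step_on_mono[OF T f] by auto
  have 3: "step_on (S \<union> T) (\<lambda>t. h t + k t)" using 1 2 by (simp add: step_on_def)
  show ?thesis
    unfolding sint_eq[OF 1] sint_eq[OF 2] sint_eq[OF 3] by (simp flip: sum.distrib add: algebra_simps)
qed

lemma sint_zero [simp]: "sint (\<lambda>t. 0) = 0"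
proof -
  have "step_on {} (\<lambda>t::real. 0::'a)" by (simp add: step_on_def)
  from sint_eq[OF this] show ?thesis by simp
qed

lemma sint_cmult:
  assumes "step h"
  shows "sint (\<lambda>t. c * h t) = c * sint h"
proof -
  obtain S where 1: "step_on S h" using assms by (auto simp: step_def)
  have 2: "step_on S (\<lambda>t. c * h t)" using 1 by (simp add: step_on_def)
  show ?thesis unfolding sint_eq[OF 1] sint_eq[OF 2] by (simp add: sum_distrib_left algebra_simps)
qed

lemma sint_multc: "step h \<Longrightarrow> sint (\<lambda>t. h t * c) = sint h * c"
  using sint_cmult[of h c] by (simp add: mult.commute)

lemma sint_uminus: "step h \<Longrightarrow> sint (\<lambda>t. - h t) = - sint h"
  using sint_cmult[of h "-1"] by simp

lemma sint_diff:
  assumes "step h" "step k"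
  shows "sint (\<lambda>t. h t - k t) = sint h - sint k"
  using sint_add[OF assms(1) step_map1[OF assms(2), of uminus]] sint_uminus[OF assms(2)] by simp

text \<open>The jump up to \<open>c\<close> is counted and the drop right after it is not, so a
  point has volume 1. Since only the value at \<open>c\<close> enters, \<open>F\<close> may be
  arbitrary.\<close>

lemma sint_point: "sint (\<lambda>t. F t * of_bool (t = c)) = F c"
proof -
  have 1: "step_on {c} (\<lambda>t. F t * of_bool (t = c))"
    by (auto simp: step_on_def auts_cmp_fix auts_fix)
  show ?thesis unfolding sint_eq[OF 1] using pred_point(1)[of "{c}" c] by simp
qed

text \<open>An increasing bijection carries left limits to left limits, so it merely relocates the
  jumps.\<close>

lemma sint_auts:
  assumes "step h" "g \<in> auts {}"
  shows "sint (\<lambda>t. h (g t)) = sint h"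
proof -
  obtain S where 1: "step_on S h" using assms by (auto simp: step_def)
  have f: "finite S" using 1 by (simp add: step_on_def)
  let ?T = "ginv g ` S"
  have 2: "step_on ?T (\<lambda>t. h (g t))"
    unfolding step_on_def
  proof (intro conjI ballI allI)
    fix k t assume k: "k \<in> auts ?T"
    \<comment> \<open>The stabilizers of \<open>S\<close> and of its preimage under \<open>g\<close>
      are conjugate by \<open>g\<close>.\<close>
    have "g \<circ> k \<circ> ginv g \<in> auts {}"
      using assms(2) k auts_inv(1)[OF assms(2)] auts_mono[of "{}" ?T] by (intro auts_comp) auto
    hence "g \<circ> k \<circ> ginv g \<in> auts S"
      using k auts_inv[OF assms(2)] by (auto simp: auts_def)
    from 1 this have "h ((g \<circ> k \<circ> ginv g) (g t)) = h (g t)" unfolding step_on_def by blast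
    then show "h (g (k t)) = h (g t)" by (simp add: auts_inv[OF assms(2)])
  qed (use f in auto)
  have "sint (\<lambda>t. h (g t)) = (\<Sum>s\<in>?T. h (g s) - left_lim (\<lambda>t. h (g t)) s)"
    using sint_eq[OF 2] left_lim_step[OF 2] by simp
  also have "\<dots> = (\<Sum>s\<in>?T. h (g s) - left_lim h (g s))"
  proof (rule sum.cong[OF refl])
    fix s assume "s \<in> ?T"
    have "left_lim (\<lambda>t. h (g t)) s = left_lim h (g s)"
    proof (rule left_lim_eqI[of "ginv g (pred_point S (g s))"])
      show "ginv g (pred_point S (g s)) < s"
        by (metis auts_inv assms(2) auts_less f pred_point(1))
      fix u assume u: "ginv g (pred_point S (g s)) < u" "u < s"
      have a: "pred_point S (g s) < g u" "g u < g s"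
        using u auts_inv[OF assms(2)] auts_less[OF assms(2)] by metis+
      have "h (g u) = h (pred_point S (g s))"
      proof (rule step_onD[OF 1], intro ballI)
        fix v assume "v \<in> S"
        with pred_point(1)[OF f, of "g s"] pred_point(2)[OF f, of v "g s"] a
        show "(v < g u) = (v < pred_point S (g s)) \<and> (g u < v) = (pred_point S (g s) < v)"
          by (metis less_trans not_less_iff_gr_or_eq)
      qed
      then show "h (g u) = left_lim h (g s)" by (simp add: left_lim_step[OF 1])
    qed
    then show "h (g s) - left_lim (\<lambda>t. h (g t)) s = h (g s) - left_lim h (g s)" by simp
  qed
  also have "\<dots> = (\<Sum>s\<in>S. h s - left_lim h s)"
    by (rule sum.reindex_bij_witness[of _ "ginv g" g]) (use auts_inv[OF assms(2)] in auto)
  also have "\<dots> = sint h" using sint_eq[OF 1] left_lim_step[OF 1] by simp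
  finally show ?thesis .
qed

text \<open>There is one jump, at the left end; the drop after the right end is invisible from the
  left.\<close>

lemma sint_Icc: "sint (\<lambda>t. of_bool (a \<le> t \<and> t \<le> b)) = of_bool (a \<le> b)"
proof -
  have 1: "step_on {a, b} (\<lambda>t. of_bool (a \<le> t \<and> t \<le> b) :: 'a)"
    by (simp add: step_on_def auts_cmp_fix)
  show ?thesis unfolding sint_eq[OF 1] 
    using pred_point(1)[of "{a,b}" a] pred_point(1)[of "{a,b}" b] pred_point(2)[of "{a,b}" a b]
      pred_point(2)[of "{a,b}" b a]
    by (cases "a = b") auto
qed

text \<open>The indicator is 1 from minus infinity on and has no jump from the left. Together with
  the value 1 of the opposite ray, this is the asymmetry that separates black from white.\<close>

lemma sint_atMost: "sint (\<lambda>t. of_bool (t \<le> b)) = 0"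
proof -
  have 1: "step_on {b} (\<lambda>t. of_bool (t \<le> b) :: 'a)"
    by (simp add: step_on_def auts_cmp_fix)
  show ?thesis unfolding sint_eq[OF 1] using pred_point(1)[of "{b}" b] by simp
qed

lemma sint_atLeast: "sint (\<lambda>t. of_bool (b \<le> t)) = 1"
proof -
  have 1: "step_on {b} (\<lambda>t. of_bool (b \<le> t) :: 'a)"
    by (simp add: step_on_def auts_cmp_fix)
  show ?thesis unfolding sint_eq[OF 1] using pred_point(1)[of "{b}" b] by simp
qed

section \<open>Iterated integration over lists\<close>

definition inv_on :: "real set \<Rightarrow> (real list \<Rightarrow> 'k) \<Rightarrow> bool" where
  "inv_on S f \<longleftrightarrow> (\<forall>g\<in>auts S. \<forall>x. f (map g x) = f x)"

text \<open>The head is integrated first, with the tail as parameter. The domain consists of all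
  lists of length \<open>n\<close>, ordered or not; smaller domains enter through the support of the
  integrand.\<close>

fun lint :: "nat \<Rightarrow> (real list \<Rightarrow> 'k::comm_ring_1) \<Rightarrow> 'k" where
  "lint 0 f = f []"
| "lint (Suc n) f = lint n (\<lambda>x. sint (\<lambda>t. f (t # x)))"

lemma lint_cong: "(\<And>x. length x = n \<Longrightarrow> f x = h x) \<Longrightarrow> lint n f = lint n h"
proof (induction n arbitrary: f h)
  case (Suc n)
  show ?case unfolding lint.simps by (rule Suc.IH) (simp add: Suc.prems)
qed simp

lemma inv_onD: "inv_on S f \<Longrightarrow> g \<in> auts S \<Longrightarrow> f (map g x) = f x"
  by (simp add: inv_on_def)

lemma inv_on_mono: "inv_on S f \<Longrightarrow> S \<subseteq> T \<Longrightarrow> inv_on T f"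
  using auts_mono[of S T] by (auto simp: inv_on_def)

text \<open>The entries of the parameter \<open>x\<close> act as further breakpoints.\<close>

lemma inv_on_step_on:
  assumes "inv_on S f" "finite S"
  shows "step_on (S \<union> set x) (\<lambda>t. f (t # x))"
  unfolding step_on_def
proof (intro conjI ballI allI)
  fix g t assume g: "g \<in> auts (S \<union> set x)"
  hence "map g x = x" by (intro map_idI) (simp add: auts_fix)
  moreover have "g \<in> auts S" using g auts_mono[of S "S \<union> set x"] by auto
  ultimately show "f (g t # x) = f (t # x)" using inv_onD[OF assms(1), of g "t # x"] by simp
qed (use assms in auto)

lemma inv_on_step: "inv_on S f \<Longrightarrow> finite S \<Longrightarrow> step (\<lambda>t. f (t # x))"
  using inv_on_step_on[of S f x] by (auto simp: step_def)

lemma inv_on_sint: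
  assumes "inv_on S f" "finite S"
  shows "inv_on S (\<lambda>x. sint (\<lambda>t. f (t # x)))"
  unfolding inv_on_def
proof (intro ballI allI)
  fix g x assume g: "g \<in> auts S"
  have g0: "g \<in> auts {}" using g auts_mono[of "{}" S] by auto
  have "sint (\<lambda>t. f (t # map g x)) = sint (\<lambda>t. f (g t # map g x))"
    using sint_auts[OF inv_on_step[OF assms] g0] by simp
  also have "\<dots> = sint (\<lambda>t. f (t # x))" using inv_onD[OF assms(1) g, of "_ # x"] by simp
  finally show "sint (\<lambda>t. f (t # map g x)) = sint (\<lambda>t. f (t # x))" .
qed

section \<open>Orbits of tuples under the stabilizer of a finite set\<close>

definition orb :: "real set \<Rightarrow> real list \<Rightarrow> real list set" where
  "orb S x = (\<lambda>g. map g x) ` auts S"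

lemma orb_refl: "x \<in> orb S x"
  unfolding orb_def by (rule image_eqI[of _ _ id]) (auto simp: auts_id)

lemma orb_eq: "y \<in> orb S x \<Longrightarrow> orb S y = orb S x"
proof -
  assume "y \<in> orb S x"
  then obtain g where g: "g \<in> auts S" "y = map g x" by (auto simp: orb_def)
  have sub: "orb S (map h u) \<subseteq> orb S u" if h: "h \<in> auts S" for h u
  proof
    fix z assume "z \<in> orb S (map h u)"
    then obtain k where k: "k \<in> auts S" "z = map k (map h u)" unfolding orb_def by blast
    have "z = map (k \<circ> h) u" using k by simp
    thus "z \<in> orb S u" using auts_comp[OF k(1) h] unfolding orb_def by blast
  qed
  have "x = map (ginv g) y" using inv_comp_auts[OF g(1), of x] g(2) by simp
  then show "orb S y = orb S x" using sub[OF g(1), of x] sub[OF auts_inv(1)[OF g(1)], of y] g(2) by simp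
qed

lemma orb_map: "g \<in> auts S \<Longrightarrow> orb S (map g x) = orb S x"
  by (rule orb_eq) (auto simp: orb_def)

definition orbs :: "real set \<Rightarrow> nat \<Rightarrow> real list set set" where
  "orbs S n = orb S ` {x. length x = n}"

definition repr :: "real list set \<Rightarrow> real list" where
  "repr U = (SOME x. x \<in> U)"

lemma repr_orb: "repr (orb S x) \<in> orb S x"
  unfolding repr_def by (rule someI) (rule orb_refl)

lemma repr_in: "U \<in> orbs S n \<Longrightarrow> repr U \<in> U \<and> length (repr U) = n \<and> orb S (repr U) = U"
proof -
  assume "U \<in> orbs S n"
  then obtain x where x: "length x = n" "U = orb S x" by (auto simp: orbs_def)
  have 1: "repr U \<in> U" using repr_orb x(2) by simp
  moreover have "length (repr U) = n" using 1 x by (auto simp: orb_def)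
  moreover have "orb S (repr U) = U" using orb_eq 1 x(2) by simp
  ultimately show ?thesis by simp
qed

text \<open>This is \<open>mu2\<close> of the orbit of \<open>x\<close>, read off from
  \<open>x\<close>: the dimension of the orbit is the number of distinct entries outside
  \<open>S\<close>, since repeated entries and entries in \<open>S\<close> leave no freedom, and an
  entry above all of \<open>S\<close> lies in the last gap. The connection is made in
  \<open>coded_gset.mu2_orbit\<close>.\<close>

definition orb_weight :: "real set \<Rightarrow> real list \<Rightarrow> 'k::comm_ring_1" where
  "orb_weight S x = (if \<exists>t\<in>set x. \<forall>s\<in>S. s < t then 0 else (- 1) ^ card (set x - S))"

definition orb_sum :: "real set \<Rightarrow> nat \<Rightarrow> (real list \<Rightarrow> 'k::comm_ring_1) \<Rightarrow> 'k" where
  "orb_sum S n f = (\<Sum>U\<in>orbs S n. f (repr U) * orb_weight S (repr U))"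

lemma orb_weight_map: "g \<in> auts S \<Longrightarrow> orb_weight S (map g x) = orb_weight S x"
proof -
  assume g: "g \<in> auts S"
  have "(\<exists>t\<in>set (map g x). \<forall>s\<in>S. s < t) \<longleftrightarrow> (\<exists>t\<in>set x. \<forall>s\<in>S. s < t)"
    by (auto simp: auts_cmp_fix[OF g])
  moreover have "set (map g x) - S = g ` (set x - S)"
    by (auto simp: auts_mem[OF g])
  moreover have "card (g ` (set x - S)) = card (set x - S)" by (rule card_image[OF auts_inj[OF g]])
  ultimately show ?thesis by (simp only: orb_weight_def)
qed

lemma orb_weight_orb: "y \<in> orb S x \<Longrightarrow> orb_weight S y = orb_weight S x"
  by (auto simp: orb_def orb_weight_map)

lemma inv_on_orb: "inv_on S f \<Longrightarrow> y \<in> orb S x \<Longrightarrow> f y = f x"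
  by (auto simp: orb_def inv_onD)

text \<open>One sample in each orbit of \<open>auts A\<close> on the line.\<close>

definition top_point :: "real set \<Rightarrow> real" where
  "top_point A = (if A = {} then 0 else Max A + 1)"

definition samples :: "real set \<Rightarrow> real set" where
  "samples A = insert (top_point A) (A \<union> pred_point A ` A)"

lemma top_point: "finite A \<Longrightarrow> a \<in> A \<Longrightarrow> a < top_point A"
proof -
  assume "finite A" "a \<in> A"
  then have "a \<le> Max A" "A \<noteq> {}" by auto
  then show ?thesis by (simp add: top_point_def)
qed

lemma pred_point_notin: "finite A \<Longrightarrow> pred_point A a \<notin> A"
  by (metis less_irrefl pred_point)

lemma pred_point_inj:
  assumes "finite A" "a \<in> A" "b \<in> A" "pred_point A a = pred_point A b"
  shows "a = b"
proof (rule ccontr)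
  assume "a \<noteq> b"
  then show False
    using assms pred_point(1)[OF assms(1), of a] pred_point(1)[OF assms(1), of b]
      pred_point(2)[OF assms(1), of a b] pred_point(2)[OF assms(1), of b a] by linarith
qed

text \<open>By \<open>auts_move\<close> only the position of \<open>t\<close> relative to
  \<open>A\<close> matters: it is a point of \<open>A\<close>, lies above all of \<open>A\<close>,
  or lies in the gap below some \<open>a\<close> in \<open>A\<close>, whose sample is
  \<open>pred_point A a\<close>.\<close>

lemma samples_orbit:
  assumes "finite A"
  shows "\<exists>c\<in>samples A. \<exists>g\<in>auts A. g c = t"
proof -
  consider "t \<in> A" | "t \<notin> A" "\<forall>a\<in>A. a < t" | "t \<notin> A" "\<exists>a\<in>A. t < a"
    by (metis linorder_neqE)
  then show ?thesis
  proof cases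
    case 1 then show ?thesis using auts_id by (intro bexI[of _ t] bexI[of _ id]) (auto simp: samples_def)
  next
    case 2
    have "\<exists>g\<in>auts A. g (top_point A) = t"
      by (rule auts_move[OF assms]) (meson 2 top_point[OF assms] less_asym)
    then show ?thesis by (auto simp: samples_def)
  next
    case 3
    define a where "a = Min {a\<in>A. t < a}"
    have "a \<in> {a\<in>A. t < a}" unfolding a_def by (rule Min_in) (use 3 assms in auto)
    hence a: "a \<in> A" "t < a" by auto
    have a2: "a \<le> b" if "b \<in> A" "t < b" for b using that assms by (auto simp: a_def)
    have "\<exists>g\<in>auts A. g (pred_point A a) = t"
    proof (rule auts_move[OF assms], intro ballI)
      fix s assume s: "s \<in> A"
      show "(s < pred_point A a \<longleftrightarrow> s < t) \<and> (pred_point A a < s \<longleftrightarrow> t < s)"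
        using pred_point(1)[OF assms, of a] pred_point(2)[OF assms s, of a] a a2[OF s] s 3
        by (smt (verit))
    qed
    then show ?thesis using a by (auto simp: samples_def)
  qed
qed

lemma samples_distinct:
  assumes "finite A" "c \<in> samples A" "d \<in> samples A" "g \<in> auts A" "g c = d"
  shows "c = d"
proof (rule ccontr)
  assume "c \<noteq> d"
  have f: "s < c \<longleftrightarrow> s < d" "c < s \<longleftrightarrow> d < s" "c = s \<longleftrightarrow> d = s" if "s \<in> A" for s
    using auts_cmp_fix[OF assms(4) that, of c] assms(5) by auto
  show False
    using assms(2,3) f \<open>c \<noteq> d\<close> pred_point[OF assms(1)] top_point[OF assms(1)] unfolding samples_def
    by (auto; smt (verit))
qed

lemma finite_samples: "finite A \<Longrightarrow> finite (samples A)"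
  by (simp add: samples_def)

text \<open>Relative to the weight of \<open>x\<close>, a point of \<open>S \<union> set x\<close>
  has weight 1, a sample in the gap below such a point has weight -1, and the top sample has weight
  0. Pairing each point with the gap below it turns the sum into the jumps from the left.\<close>

lemma sum_samples:
  assumes "finite S" "inv_on S f"
  shows "(\<Sum>c\<in>samples (S \<union> set x). f (c # x) * orb_weight S (c # x)) =
    sint (\<lambda>t. f (t # x)) * (orb_weight S x :: 'k::comm_ring_1)"
proof -
  let ?A = "S \<union> set x"
  have fA: "finite ?A" using assms by simp
  \<comment> \<open>A value already present adds no dimension.\<close>
  have A: "orb_weight S (a # x) = (orb_weight S x :: 'k)" if "a \<in> ?A" for a
  proof -
    have "(\<exists>t\<in>set (a # x). \<forall>s\<in>S. s < t) \<longleftrightarrow> (\<exists>t\<in>set x. \<forall>s\<in>S. s < t)" using that by auto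
    moreover have "set (a # x) - S = set x - S" using that by auto
    ultimately show ?thesis by (simp only: orb_weight_def)
  qed
  have B: "orb_weight S (pred_point ?A a # x) = - (orb_weight S x :: 'k)" if "a \<in> ?A" for a
  proof -
    let ?p = "pred_point ?A a"
    have p: "?p < a" "?p \<notin> ?A" using pred_point(1)[OF fA, of a] pred_point_notin[OF fA, of a] by auto
    \<comment> \<open>If the sample below \<open>a\<close> lies above all of \<open>S\<close>, then
      so does \<open>a\<close>, which is therefore an entry of \<open>x\<close>; hence the vanishing
      condition is the same as for \<open>x\<close>.\<close>
    have "(\<exists>t\<in>set (?p # x). \<forall>s\<in>S. s < t) \<longleftrightarrow> (\<exists>t\<in>set x. \<forall>s\<in>S. s < t)" 
      using that p by (auto; force)
    moreover have "set (?p # x) - S = insert ?p (set x - S)" using p by auto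
    moreover have "card (insert ?p (set x - S)) = Suc (card (set x - S))"
      using p by (subst card_insert_disjoint) auto
    ultimately have "orb_weight S (?p # x) =
        (if \<exists>t\<in>set x. \<forall>s\<in>S. s < t then 0 else (- 1) ^ Suc (card (set x - S)) :: 'k)"
      by (simp only: orb_weight_def)
    then show ?thesis unfolding orb_weight_def[of S x]
      by (cases "\<exists>t\<in>set x. \<forall>s\<in>S. s < t") (simp_all only: if_True if_False, simp_all)
  qed
  \<comment> \<open>The top sample lies above all of \<open>S\<close>, in the gap of measure
    zero.\<close>
  have C: "orb_weight S (top_point ?A # x) = (0 :: 'k)"
    using top_point[OF fA] by (auto simp: orb_weight_def)
  have D: "top_point ?A \<notin> ?A \<union> pred_point ?A ` ?A"
  proof
    assume "top_point ?A \<in> ?A \<union> pred_point ?A ` ?A"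
    then consider "top_point ?A \<in> ?A" | a where "a \<in> ?A" "top_point ?A = pred_point ?A a" by auto
    then show False
    proof cases
      case 1 then show False using top_point[OF fA] by blast
    next
      case 2 then show False using top_point[OF fA, of a] pred_point(1)[OF fA, of a] by linarith
    qed
  qed
  have "(\<Sum>c\<in>samples ?A. f (c # x) * orb_weight S (c # x)) =
     (\<Sum>c\<in>?A \<union> pred_point ?A ` ?A. f (c # x) * orb_weight S (c # x))"
    unfolding samples_def using D fA C by (subst sum.insert) auto
  also have "\<dots> = (\<Sum>c\<in>?A. f (c # x) * orb_weight S (c # x)) +
       (\<Sum>c\<in>pred_point ?A ` ?A. f (c # x) * orb_weight S (c # x))"
    using fA pred_point_notin[OF fA] by (subst sum.union_disjoint) auto
  also have "(\<Sum>c\<in>pred_point ?A ` ?A. f (c # x) * orb_weight S (c # x)) =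
      (\<Sum>a\<in>?A. f (pred_point ?A a # x) * orb_weight S (pred_point ?A a # x))"
    using pred_point_inj[OF fA] by (subst sum.reindex) (auto simp: inj_on_def)
  also have "(\<Sum>c\<in>?A. f (c # x) * orb_weight S (c # x)) = (\<Sum>c\<in>?A. f (c # x) * orb_weight S x)"
    using A by (intro sum.cong) auto
  also have "(\<Sum>a\<in>?A. f (pred_point ?A a # x) * orb_weight S (pred_point ?A a # x)) = 
     (\<Sum>a\<in>?A. f (pred_point ?A a # x) * - orb_weight S x)"
    using B by (intro sum.cong) auto
  also have "(\<Sum>c\<in>?A. f (c # x) * orb_weight S x) + (\<Sum>a\<in>?A. f (pred_point ?A a # x) * - orb_weight S x)
     = (\<Sum>a\<in>?A. f (a # x) - f (pred_point ?A a # x)) * orb_weight S x"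
    by (simp add: sum_distrib_right left_diff_distrib sum_subtractf sum_negf)
  also have "(\<Sum>a\<in>?A. f (a # x) - f (pred_point ?A a # x)) = sint (\<lambda>t. f (t # x))"
    by (rule sint_eq[OF inv_on_step_on[OF assms(2,1)], symmetric])
  finally show ?thesis .
qed

text \<open>Orbits of tuples \<open>t # x\<close> lying over the orbit of a fixed \<open>x\<close>
  correspond to orbits of the stabilizer of \<open>x\<close> on the line, and each of these contains
  exactly one sample.\<close>

lemma orbs_Suc:
  assumes "finite S"
  shows "bij_betw (\<lambda>(U, c). orb S (c # repr U)) (SIGMA U:orbs S n. samples (S \<union> set (repr U)))
    (orbs S (Suc n))"
  unfolding bij_betw_def
proof
  show "inj_on (\<lambda>(U, c). orb S (c # repr U)) (SIGMA U:orbs S n. samples (S \<union> set (repr U)))"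
  proof (rule inj_onI, clarify)
    fix U c V d
    assume U: "U \<in> orbs S n" "c \<in> samples (S \<union> set (repr U))"
      and V: "V \<in> orbs S n" "d \<in> samples (S \<union> set (repr V))"
      and eq: "orb S (c # repr U) = orb S (d # repr V)"
    have "d # repr V \<in> orb S (c # repr U)" using orb_refl[of "d # repr V" S] eq by simp
    then obtain g where g: "g \<in> auts S" "map g (c # repr U) = d # repr V"
      by (auto simp: orb_def)
    have "repr V = map g (repr U)" using g(2) by simp
    hence "repr V \<in> orb S (repr U)" using g(1) unfolding orb_def by blast
    hence UV: "U = V" using repr_in[OF U(1)] repr_in[OF V(1)] orb_eq by metis
    have "map g (repr U) = repr U" using g(2) UV by simp
    hence "g t = t" if "t \<in> set (repr U)" for t using that by (metis map_eq_conv list.map_ident)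
    \<comment> \<open>As \<open>g\<close> fixes the representative, it belongs to the smaller
      stabilizer, whose orbits the samples tell apart.\<close>
    hence "g \<in> auts (S \<union> set (repr U))" using g(1) by (auto simp: auts_def)
    from samples_distinct[OF _ U(2) _ this, of d] V(2) UV g(2) assms
    show "U = V \<and> c = d" by auto
  qed
  show "(\<lambda>(U, c). orb S (c # repr U)) ` (SIGMA U:orbs S n. samples (S \<union> set (repr U))) = orbs S (Suc n)"
  proof (intro equalityI subsetI)
    fix W assume "W \<in> (\<lambda>(U, c). orb S (c # repr U)) ` (SIGMA U:orbs S n. samples (S \<union> set (repr U)))"
    then obtain U c where "U \<in> orbs S n" "W = orb S (c # repr U)" by auto
    then show "W \<in> orbs S (Suc n)" using repr_in[of U S n] by (auto simp: orbs_def)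
  next
    fix W assume "W \<in> orbs S (Suc n)"
    then obtain t x where W: "W = orb S (t # x)" "length x = n"
      by (auto simp: orbs_def length_Suc_conv)
    define U where "U = orb S x"
    have U: "U \<in> orbs S n" using W by (auto simp: U_def orbs_def)
    from repr_in[OF U] have "x \<in> orb S (repr U)" using orb_refl[of x S] U_def by simp
    then obtain g where g: "g \<in> auts S" "x = map g (repr U)" by (auto simp: orb_def)
    \<comment> \<open>After transport to the chosen representative, the new coordinate is exchanged
      for a sample by an automorphism that fixes the representative.\<close>
    obtain c h where c: "c \<in> samples (S \<union> set (repr U))" "h \<in> auts (S \<union> set (repr U))" "h c = ginv g t"
      using samples_orbit[of "S \<union> set (repr U)"] assms by (metis finite_UnI List.finite_set)
    have "map h (repr U) = repr U" using c(2) by (intro map_idI) (simp add: auts_fix)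
    hence "map (g \<circ> h) (c # repr U) = t # x"
      using g c auts_inv[OF g(1)] by (simp flip: map_map)
    moreover have "g \<circ> h \<in> auts S" using g c auts_mono[of S "S \<union> set (repr U)"] by (intro auts_comp) auto
    ultimately have "W = orb S (c # repr U)" using W orb_map by metis
    then show "W \<in> (\<lambda>(U, c). orb S (c # repr U)) ` (SIGMA U:orbs S n. samples (S \<union> set (repr U)))"
      using U c by auto
  qed
qed

lemma finite_orbs: "finite S \<Longrightarrow> finite (orbs S n)"
proof (induction n)
  case 0 then show ?case by (simp add: orbs_def)
next
  case (Suc n)
  have "finite (SIGMA U:orbs S n. samples (S \<union> set (repr U)))"
    using Suc by (intro finite_SigmaI finite_samples) auto
  then show ?case using bij_betw_finite[OF orbs_Suc[OF Suc.prems]] by blast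
qed

text \<open>Fibring the orbits by \<open>orbs_Suc\<close> and summing along the fibres by
  \<open>sum_samples\<close> integrates one coordinate. In particular the orbit sum does not depend
  on \<open>S\<close>, which the iterated integral does not mention.\<close>

lemma orb_sum_eq_lint:
  assumes "finite S" "inv_on S f"
  shows "orb_sum S n f = lint n f"
  using assms(2)
proof (induction n arbitrary: f)
  case 0
  have "orbs S 0 = {{[]}}" using auts_id by (auto simp: orbs_def orb_def)
  moreover have "repr {[]} = []" by (simp add: repr_def)
  ultimately show ?case by (simp add: orb_sum_def orb_weight_def)
next
  case (Suc n)
  have "orb_sum S (Suc n) f = (\<Sum>p\<in>(SIGMA U:orbs S n. samples (S \<union> set (repr U))).
      f (snd p # repr (fst p)) * orb_weight S (snd p # repr (fst p)))"
    unfolding orb_sum_def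
    by (subst sum.reindex_bij_betw[OF orbs_Suc[OF assms(1)], symmetric])
       (intro sum.cong refl, clarsimp,
         metis inv_on_orb[OF Suc.prems repr_orb] orb_weight_orb[OF repr_orb])
  also have "\<dots> = (\<Sum>U\<in>orbs S n. \<Sum>c\<in>samples (S \<union> set (repr U)). f (c # repr U) * orb_weight S (c # repr U))"
    using finite_orbs[OF assms(1)] assms(1) by (subst sum.Sigma) (auto simp: finite_samples split_def)
  also have "\<dots> = orb_sum S n (\<lambda>x. sint (\<lambda>t. f (t # x)))"
    unfolding orb_sum_def sum_samples[OF assms(1) Suc.prems] ..
  finally show ?case using Suc.IH[OF inv_on_sint[OF Suc.prems assms(1)]] by simp
qed

text \<open>The weight of an orbit depends only on the set of entries, so reversal permutes the
  orbits and keeps their weights. This symmetry is the origin of Fubini's theorem below.\<close>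

lemma orb_sum_rev: "orb_sum S n (\<lambda>x. f (rev x)) = orb_sum S n f" if "inv_on S f"
proof -
  have ro: "rev ` orb S x = orb S (rev x)" for x by (auto simp: orb_def image_iff rev_map)
  have img: "rev ` U \<in> orbs S n" if "U \<in> orbs S n" for U
    using that by (auto simp: orbs_def ro)
  have rr: "rev ` rev ` U = U" for U :: "real list set" by (simp add: image_image)
  have "repr (rev ` U) \<in> orb S (rev (repr U))" if "U \<in> orbs S n" for U
    using repr_in[OF that] repr_in[OF img[OF that]] ro[of "repr U"] by simp
  hence "f (repr (rev ` U)) * orb_weight S (repr (rev ` U)) = f (rev (repr U)) * orb_weight S (rev (repr U))"
    if "U \<in> orbs S n" for U
    using inv_on_orb[OF \<open>inv_on S f\<close>] orb_weight_orb that by metis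
  moreover have w: "orb_weight S (rev x) = orb_weight S x" for x unfolding orb_weight_def set_rev ..
  ultimately have eq: "f (rev (repr U)) * orb_weight S (repr U) = f (repr (rev ` U)) * orb_weight S (repr (rev ` U))"
    if "U \<in> orbs S n" for U
    unfolding w using that by metis
  show ?thesis
    unfolding orb_sum_def
  proof (rule sum.reindex_bij_witness[of _ "image rev" "image rev"])
    fix U assume "U \<in> orbs S n"
    then show "f (repr (rev ` U)) * orb_weight S (repr (rev ` U)) = f (rev (repr U)) * orb_weight S (repr U)"
      by (rule eq[symmetric])
  qed (rule rr img; assumption)+
qed

text \<open>Both iterated integrals equal orbit sums over pairs, and these do not see the order of
  the two coordinates.\<close>

lemma fubini2:
  assumes "finite S" "\<And>g s t. g \<in> auts S \<Longrightarrow> h (g s) (g t) = h s t"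
  shows "sint (\<lambda>s. sint (\<lambda>t. h s t)) = sint (\<lambda>t. sint (\<lambda>s. h s t))"
proof -
  \<comment> \<open>The inner variable \<open>t\<close> is entry 0, because \<open>lint\<close>
    integrates the head first.\<close>
  define f where "f x = (if length x = 2 then h (x ! 1) (x ! 0) else 0)" for x
  have f: "inv_on S f" using assms(2) by (auto simp: inv_on_def f_def)
  have fr: "inv_on S (\<lambda>x. f (rev x))" using f by (simp add: inv_on_def rev_map)
  have "lint 2 f = lint 2 (\<lambda>x. f (rev x))"
    using orb_sum_rev[OF f, of 2] orb_sum_eq_lint[OF assms(1) f, of 2] orb_sum_eq_lint[OF assms(1) fr, of 2]
    by simp
  then show ?thesis by (simp add: numeral_2_eq_2 f_def)
qed

text \<open>The variable \<open>t\<close> passes the others one at a time by \<open>fubini2\<close>;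
  the variables held fixed meanwhile enlarge \<open>S\<close>.\<close>

lemma fubini_sint_lint:
  assumes "finite S" "\<And>g t x. g \<in> auts S \<Longrightarrow> f (g t) (map g x) = f t x"
  shows "sint (\<lambda>t. lint n (f t)) = lint n (\<lambda>x. sint (\<lambda>t. f t x))"
  using assms(2)
proof (induction n arbitrary: f)
  case 0 then show ?case by simp
next
  case (Suc n)
  have st: "step (\<lambda>u. f t (u # x))" for t x
  proof (rule stepI[of "S \<union> insert t (set x)"])
    fix g u assume g: "g \<in> auts (S \<union> insert t (set x))"
    hence "map g x = x" "g t = t" by (auto simp: auts_fix intro: map_idI)
    then show "f t (g u # x) = f t (u # x)"
      using Suc.prems[of g t "u # x"] g auts_mono[of S "S \<union> insert t (set x)"] by auto
  qed (use assms in auto)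
  have "sint (\<lambda>t. lint (Suc n) (f t)) = lint n (\<lambda>x. sint (\<lambda>t. sint (\<lambda>u. f t (u # x))))"
    unfolding lint.simps
  proof (rule Suc.IH)
    fix g t x assume g: "g \<in> auts S"
    have g0: "g \<in> auts {}" using g auts_mono[of "{}" S] by auto
    show "sint (\<lambda>u. f (g t) (u # map g x)) = sint (\<lambda>u. f t (u # x))"
      using sint_auts[OF st g0, of "g t" "map g x"] Suc.prems[OF g, of t "_ # x"] by simp
  qed
  also have "\<dots> = lint n (\<lambda>x. sint (\<lambda>u. sint (\<lambda>t. f t (u # x))))"
  proof (rule lint_cong)
    fix x
    show "sint (\<lambda>t. sint (\<lambda>u. f t (u # x))) = sint (\<lambda>u. sint (\<lambda>t. f t (u # x)))"
    proof (rule fubini2[of "S \<union> set x"])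
      fix g s t assume g: "g \<in> auts (S \<union> set x)"
      hence "map g x = x" by (auto simp: auts_fix intro: map_idI)
      then show "f (g s) (g t # x) = f s (t # x)"
        using Suc.prems[of g s "t # x"] g auts_mono[of S "S \<union> set x"] by auto
    qed (use assms in auto)
  qed
  finally show ?case by simp
qed

definition inv2_on :: "real set \<Rightarrow> (real list \<Rightarrow> real list \<Rightarrow> 'k) \<Rightarrow> bool" where
  "inv2_on S f \<longleftrightarrow> (\<forall>g\<in>auts S. \<forall>x y. f (map g x) (map g y) = f x y)"

lemma inv2_on_flip: "inv2_on S f \<Longrightarrow> inv2_on S (\<lambda>y x. f x y)"
  by (simp add: inv2_on_def)

lemma inv2_on_right: "inv2_on S f \<Longrightarrow> inv_on (S \<union> set x) (f x)"
proof -
  assume f: "inv2_on S f"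
  show ?thesis
    unfolding inv_on_def
  proof (intro ballI allI)
    fix g y assume g: "g \<in> auts (S \<union> set x)"
    hence "map g x = x" by (auto simp: auts_fix intro: map_idI)
    then show "f x (map g y) = f x y" using f g auts_mono[of S "S \<union> set x"] unfolding inv2_on_def
      by (metis Un_upper1 subsetD)
  qed
qed

lemma inv2_on_left: "inv2_on S f \<Longrightarrow> inv_on (S \<union> set y) (\<lambda>x. f x y)"
  using inv2_on_right[OF inv2_on_flip] .

lemma inv_on_lint:
  assumes "finite S" "inv2_on S f"
  shows "inv_on S (\<lambda>x. lint n (f x))"
  using assms(2)
proof (induction n arbitrary: f)
  case 0
  then show ?case by (auto simp: inv_on_def inv2_on_def) (metis list.map_disc_iff)
next
  case (Suc n)
  have "inv2_on S (\<lambda>x y. sint (\<lambda>t. f x (t # y)))"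
    unfolding inv2_on_def
  proof (intro ballI allI)
    fix g x y assume g: "g \<in> auts S"
    have g0: "g \<in> auts {}" using g auts_mono[of "{}" S] by auto
    have st: "step (\<lambda>t. f x (t # y))" for x y
      using inv_on_step[OF inv2_on_right[OF Suc.prems]] assms(1) by simp
    have "f (map g x) (g t # map g y) = f x (t # y)" for t
      using Suc.prems g unfolding inv2_on_def by (metis list.simps(9))
    then show "sint (\<lambda>t. f (map g x) (t # map g y)) = sint (\<lambda>t. f x (t # y))"
      using sint_auts[OF st g0, of "map g x" "map g y"] by simp
  qed
  then show ?case using Suc.IH by simp
qed

text \<open>Each coordinate of \<open>x\<close> in turn is moved past all of
  \<open>y\<close>.\<close>

lemma fubini:
  assumes "finite S" "inv2_on S f"
  shows "lint n (\<lambda>x. lint m (f x)) = lint m (\<lambda>y. lint n (\<lambda>x. f x y))"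
  using assms(2)
proof (induction n arbitrary: f)
  case 0 then show ?case by simp
next
  case (Suc n)
  have st: "step (\<lambda>t. f (t # x) y)" for x y
    using inv_on_step[OF inv2_on_left[OF Suc.prems]] assms(1) by simp
  have "lint (Suc n) (\<lambda>x. lint m (f x)) = lint n (\<lambda>x. lint m (\<lambda>y. sint (\<lambda>t. f (t # x) y)))"
    unfolding lint.simps
  proof (rule lint_cong)
    fix x
    show "sint (\<lambda>t. lint m (f (t # x))) = lint m (\<lambda>y. sint (\<lambda>t. f (t # x) y))"
    proof (rule fubini_sint_lint[of "S \<union> set x"])
      fix g t y assume g: "g \<in> auts (S \<union> set x)"
      hence "map g x = x" by (auto simp: auts_fix intro: map_idI)
      then show "f (g t # x) (map g y) = f (t # x) y"
        using Suc.prems g auts_mono[of S "S \<union> set x"] unfolding inv2_on_def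
        by (metis Un_upper1 list.simps(9) subsetD)
    qed (use assms in auto)
  qed
  also have "\<dots> = lint m (\<lambda>y. lint n (\<lambda>x. sint (\<lambda>t. f (t # x) y)))"
  proof (rule Suc.IH, unfold inv2_on_def, intro ballI allI)
    fix g x y assume g: "g \<in> auts S"
    have g0: "g \<in> auts {}" using g auts_mono[of "{}" S] by auto
    have "f (g t # map g x) (map g y) = f (t # x) y" for t
      using Suc.prems g unfolding inv2_on_def by (metis list.simps(9))
    then show "sint (\<lambda>t. f (t # map g x) (map g y)) = sint (\<lambda>t. f (t # x) y)"
      using sint_auts[OF st g0, of "map g x" "map g y"] by simp
  qed
  finally show ?case by simp
qed

section \<open>Linearity, point masses and fibres of the iterated integral\<close>

lemma lint_add:
  assumes "finite S" "inv_on S f" "inv_on S h"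
  shows "lint n (\<lambda>x. f x + h x) = lint n f + lint n h"
  using assms(2,3)
proof (induction n arbitrary: f h)
  case (Suc n)
  show ?case
    using Suc.IH[OF inv_on_sint[OF Suc.prems(1) assms(1)] inv_on_sint[OF Suc.prems(2) assms(1)]]
    by (simp add: sint_add inv_on_step[OF Suc.prems(1) assms(1)] inv_on_step[OF Suc.prems(2) assms(1)])
qed simp

lemma lint_cmult:
  assumes "finite S" "inv_on S f"
  shows "lint n (\<lambda>x. c * f x) = c * lint n f"
  using assms(2)
proof (induction n arbitrary: f)
  case (Suc n)
  show ?case
    using Suc.IH[OF inv_on_sint[OF Suc.prems(1) assms(1)]]
    by (simp add: sint_cmult inv_on_step[OF Suc.prems(1) assms(1)])
qed simp

lemma lint_zero [simp]: "lint n (\<lambda>x. 0) = 0"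
  by (induction n) auto

lemma lint_sum:
  assumes "finite S" "finite I" "\<And>i. i \<in> I \<Longrightarrow> inv_on S (f i)"
  shows "lint n (\<lambda>x. \<Sum>i\<in>I. f i x) = (\<Sum>i\<in>I. lint n (f i))"
  using assms(2,3)
proof (induction I rule: finite_induct)
  case (insert i I)
  have "inv_on S (\<lambda>x. \<Sum>i\<in>I. f i x)" using insert by (simp add: inv_on_def)
  then show ?case using insert by (simp add: lint_add[OF assms(1)])
qed simp

lemma lint_point: "lint n (\<lambda>x. F x * of_bool (x = a)) = (if length a = n then F a else 0)"
proof (induction n arbitrary: F a)
  case 0 then show ?case by (cases a) auto
next
  case (Suc n)
  show ?case
  proof (cases a)
    case Nil then show ?thesis by simp
  next
    case (Cons b a')
    have "sint (\<lambda>t. F (t # x) * of_bool (t # x = b # a')) = F (b # x) * of_bool (x = a')" for x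
      using sint_point[of "\<lambda>t. F (t # x)" b] by (cases "x = a'") auto
    then show ?thesis using Suc[of "\<lambda>x. F (b # x)" a'] Cons by simp
  qed
qed

definition insert_nth :: "nat \<Rightarrow> real \<Rightarrow> real list \<Rightarrow> real list" where
  "insert_nth k t x = take k x @ t # drop k x"

definition remove_nth :: "nat \<Rightarrow> real list \<Rightarrow> real list" where
  "remove_nth k x = take k x @ drop (Suc k) x"

text \<open>The condition pins every coordinate except number \<open>k\<close>, so one integral
  along the fibre of \<open>remove_nth k\<close> survives. The induction evaluates the pinned
  coordinates before \<open>k\<close> as point masses.\<close>

lemma lint_fibre:
  assumes "k \<le> n" "length x = n"
  shows "lint (Suc n) (\<lambda>y. F y * of_bool (remove_nth k y = x)) = sint (\<lambda>t. F (insert_nth k t x))"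
  using assms
proof (induction k arbitrary: n x F)
  case 0
  have "lint (Suc n) (\<lambda>y. F y * of_bool (remove_nth 0 y = x)) = lint n (\<lambda>y. sint (\<lambda>t. F (t # y)) * of_bool (y = x))"
    unfolding lint.simps by (rule lint_cong) (auto simp: remove_nth_def)
  then show ?case using 0 by (simp add: lint_point insert_nth_def)
next
  case (Suc k)
  then obtain m b x' where n: "n = Suc m" and x: "x = b # x'" "length x' = m"
    by (cases n; cases x) auto
  have "lint (Suc n) (\<lambda>y. F y * of_bool (remove_nth (Suc k) y = x)) =
    lint (Suc m) (\<lambda>y. F (b # y) * of_bool (remove_nth k y = x'))"
    unfolding n lint.simps(2)[of "Suc m"]
  proof (rule lint_cong)
    fix y
    have "sint (\<lambda>t. F (t # y) * of_bool (remove_nth (Suc k) (t # y) = x)) =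
      sint (\<lambda>t. (F (t # y) * of_bool (remove_nth k y = x')) * of_bool (t = b))"
      by (rule arg_cong[of _ _ sint]) (auto simp: remove_nth_def x)
    then show "sint (\<lambda>t. F (t # y) * of_bool (remove_nth (Suc k) (t # y) = x)) =
       F (b # y) * of_bool (remove_nth k y = x')"
      by (simp add: sint_point)
  qed
  also have "\<dots> = sint (\<lambda>t. F (b # insert_nth k t x'))"
    using Suc.IH[of m x' "\<lambda>y. F (b # y)"] Suc.prems n x by simp
  finally show ?case using x by (simp add: insert_nth_def)
qed

section \<open>The ring of invariant kernels\<close>

text \<open>Summing over the lengths at which \<open>f\<close> does not vanish gives a finite sum
  whenever the support has bounded length, without naming a bound.\<close>

definition full_int :: "(real list \<Rightarrow> 'k::comm_ring_1) \<Rightarrow> 'k" where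
  "full_int f = (\<Sum>n | \<exists>x. length x = n \<and> f x \<noteq> 0. lint n f)"

lemma lint_eq_0: "(\<And>x. length x = n \<Longrightarrow> f x = 0) \<Longrightarrow> lint n f = 0"
  using lint_cong[of n f "\<lambda>x. 0"] by simp

lemma full_int_bound:
  assumes "\<And>x. f x \<noteq> 0 \<Longrightarrow> length x \<le> N"
  shows "full_int f = (\<Sum>n\<le>N. lint n f)"
  unfolding full_int_def
proof (rule sum.mono_neutral_left)
  show "\<forall>i\<in>{..N} - {n. \<exists>x. length x = n \<and> f x \<noteq> 0}. lint i f = 0"
    by (auto intro!: lint_eq_0)
qed (use assms in auto)

lemma full_int_length:
  assumes "\<And>x. f x \<noteq> 0 \<Longrightarrow> length x = n"
  shows "full_int f = lint n f"
proof -
  have "full_int f = (\<Sum>m\<le>n. lint m f)" by (rule full_int_bound) (use assms in auto)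
  also have "\<dots> = (\<Sum>m\<in>{n}. lint m f)"
    by (rule sum.mono_neutral_right) (use assms in \<open>auto intro!: lint_eq_0\<close>)
  finally show ?thesis by simp
qed

lemma full_int_point: "full_int (\<lambda>y. F y * of_bool (y = a)) = F a"
proof -
  have "full_int (\<lambda>y. F y * of_bool (y = a)) = lint (length a) (\<lambda>y. F y * of_bool (y = a))"
    by (rule full_int_length) (auto simp: of_bool_def split: if_splits)
  then show ?thesis by (simp add: lint_point)
qed

lemma full_int_fibre:
  assumes "k < n" "Suc (length x) = n"
  shows "full_int (\<lambda>y. F y * of_bool (length y = n \<and> remove_nth k y = x)) = sint (\<lambda>t. F (insert_nth k t x))"
proof -
  obtain m where n: "n = Suc m" using assms by (cases n) auto
  have "full_int (\<lambda>y. F y * of_bool (length y = n \<and> remove_nth k y = x)) =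
    lint n (\<lambda>y. F y * of_bool (length y = n \<and> remove_nth k y = x))"
    by (rule full_int_length) (auto simp: of_bool_def split: if_splits)
  also have "\<dots> = lint n (\<lambda>y. F y * of_bool (remove_nth k y = x))"
    by (rule lint_cong) simp
  finally show ?thesis using assms n by (simp only:) (rule lint_fibre, auto)
qed

text \<open>Tuples of all lengths share one type so that morphisms between different objects can be
  added and multiplied in a single ring. The bound on the lengths makes the product a finite sum of
  integrals; it also excludes an identity, so the ring has no unit.\<close>

definition invariant_kernel :: "(real list \<Rightarrow> real list \<Rightarrow> 'k::comm_ring_1) \<Rightarrow> bool" where
  "invariant_kernel K \<longleftrightarrow> inv2_on {} K \<and> (\<exists>N. \<forall>y x. K y x \<noteq> 0 \<longrightarrow> length y \<le> N \<and> length x \<le> N)"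

typedef (overloaded) 'k kern = "{K :: real list \<Rightarrow> real list \<Rightarrow> 'k::comm_ring_1. invariant_kernel K}"
  morphisms entry Kern
  by (rule exI[of _ "\<lambda>y x. 0"]) (simp add: invariant_kernel_def inv2_on_def)

setup_lifting type_definition_kern

lemma entry_inv2: "inv2_on {} (entry K)"
  using entry[of K] by (simp add: invariant_kernel_def)

lemma entry_map: "g \<in> auts {} \<Longrightarrow> entry K (map g y) (map g x) = entry K y x"
  using entry_inv2[of K] by (simp add: inv2_on_def)

lemma entry_bound: "\<exists>N. \<forall>y x. entry K y x \<noteq> 0 \<longrightarrow> length y \<le> N \<and> length x \<le> N"
  using entry[of K] by (simp add: invariant_kernel_def)

lemma entry_inv_right: "inv_on (set y) (entry K y)"
  using inv2_on_right[OF entry_inv2, of y K] by simp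

lemma entry_inv_left: "inv_on (set x) (\<lambda>y. entry K y x)"
  using inv2_on_left[OF entry_inv2, of x K] by simp

lemma inv_on_times: "inv_on S f \<Longrightarrow> inv_on T h \<Longrightarrow> inv_on (S \<union> T) (\<lambda>x. f x * h x)"
  using inv_on_mono[of S f "S \<union> T"] inv_on_mono[of T h "S \<union> T"] by (simp add: inv_on_def)

instantiation kern :: (comm_ring_1) ring
begin

lift_definition zero_kern :: "'a kern" is "\<lambda>y x. 0"
  by (simp add: invariant_kernel_def inv2_on_def)

lift_definition plus_kern :: "'a kern \<Rightarrow> 'a kern \<Rightarrow> 'a kern" is "\<lambda>K L y x. K y x + L y x"
proof -
  fix K L :: "real list \<Rightarrow> real list \<Rightarrow> 'a"
  assume K: "invariant_kernel K" and L: "invariant_kernel L"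
  obtain N where N: "\<forall>y x. K y x \<noteq> 0 \<longrightarrow> length y \<le> N \<and> length x \<le> N" using K unfolding invariant_kernel_def by blast
  obtain M where M: "\<forall>y x. L y x \<noteq> 0 \<longrightarrow> length y \<le> M \<and> length x \<le> M" using L unfolding invariant_kernel_def by blast
  have "length y \<le> max N M \<and> length x \<le> max N M" if "K y x + L y x \<noteq> 0" for y x
    using N M that by (cases "K y x = 0") (auto simp: le_max_iff_disj)
  then show "invariant_kernel (\<lambda>y x. K y x + L y x)"
    using K L unfolding invariant_kernel_def inv2_on_def by auto
qed

lift_definition uminus_kern :: "'a kern \<Rightarrow> 'a kern" is "\<lambda>K y x. - K y x"
  by (simp add: invariant_kernel_def inv2_on_def)

definition minus_kern :: "'a kern \<Rightarrow> 'a kern \<Rightarrow> 'a kern" where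
  "minus_kern K L = K + - L"

lift_definition times_kern :: "'a kern \<Rightarrow> 'a kern \<Rightarrow> 'a kern" is
  "\<lambda>K L z x. full_int (\<lambda>y. K z y * L y x)"
proof -
  fix K L :: "real list \<Rightarrow> real list \<Rightarrow> 'a"
  assume K: "invariant_kernel K" and L: "invariant_kernel L"
  obtain N where N: "\<forall>y x. K y x \<noteq> 0 \<longrightarrow> length y \<le> N \<and> length x \<le> N" using K unfolding invariant_kernel_def by blast
  obtain M where M: "\<forall>y x. L y x \<noteq> 0 \<longrightarrow> length y \<le> M \<and> length x \<le> M" using L unfolding invariant_kernel_def by blast
  have tot: "full_int (\<lambda>y. K z y * L y x) = (\<Sum>n\<le>N. lint n (\<lambda>y. K z y * L y x))" for z x
    by (rule full_int_bound) (metis N mult_zero_left)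
  have "length z \<le> max N M \<and> length x \<le> max N M" if "full_int (\<lambda>y. K z y * L y x) \<noteq> 0" for z x
  proof -
    have "\<exists>y. K z y * L y x \<noteq> 0"
    proof (rule ccontr)
      assume "\<not> ?thesis"
      then have "(\<lambda>y. K z y * L y x) = (\<lambda>y. 0)" by auto
      then show False using that by (simp add: full_int_def)
    qed
    then show ?thesis using N M by (metis le_max_iff_disj mult_zero_left mult_zero_right)
  qed
  moreover have "inv2_on {} (\<lambda>z x. full_int (\<lambda>y. K z y * L y x))"
    unfolding inv2_on_def
  proof (intro ballI allI)
    fix g :: "real \<Rightarrow> real" and z x :: "real list" assume g: "g \<in> auts {}"
    have K2: "inv2_on {} K" and L2: "inv2_on {} L" using K L by (auto simp: invariant_kernel_def)
    \<comment> \<open>The two parameters \<open>z\<close> and \<open>x\<close> are joined into one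
      list, since \<open>inv_on_lint\<close> treats a single parameter; as \<open>z\<close> has
      fixed length, \<open>take\<close> and \<open>drop\<close> separate them again.\<close>
    define G where "G = (\<lambda>w y. K (take (length z) w) y * L y (drop (length z) w))"
    have G: "inv2_on {} G"
      using K2 L2 by (simp add: inv2_on_def G_def take_map drop_map)
    have "lint n (G (map g (z @ x))) = lint n (G (z @ x))" for n
      using inv_on_lint[OF _ G, of n] g by (auto simp: inv_on_def simp del: map_append)
    then show "full_int (\<lambda>y. K (map g z) y * L y (map g x)) = full_int (\<lambda>y. K z y * L y x)"
      unfolding tot by (simp add: G_def)
  qed
  ultimately show "invariant_kernel (\<lambda>z x. full_int (\<lambda>y. K z y * L y x))"
    unfolding invariant_kernel_def by blast
qed

lemma entry_times_sum:
  assumes "\<forall>y x. entry K y x \<noteq> 0 \<longrightarrow> length x \<le> N"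
  shows "entry (K * L) z x = (\<Sum>n\<le>N. lint n (\<lambda>y. entry K z y * entry L y x))"
  unfolding times_kern.rep_eq by (rule full_int_bound) (metis assms mult_zero_left)

instance
proof
  fix K L M :: "'a kern"
  show "K + L + M = K + (L + M)" by transfer (simp add: add.assoc)
  show "K + L = L + K" by transfer (simp add: add.commute)
  show "0 + K = K" by transfer simp
  show "- K + K = 0" by transfer simp
  show "K - L = K + - L" by (rule minus_kern_def)
  obtain NK where NK: "\<And>y x. entry K y x \<noteq> 0 \<Longrightarrow> length y \<le> NK \<and> length x \<le> NK" using entry_bound[of K] by blast
  obtain NL where NL: "\<And>y x. entry L y x \<noteq> 0 \<Longrightarrow> length y \<le> NL \<and> length x \<le> NL" using entry_bound[of L] by blast
  obtain NM where NM: "\<And>y x. entry M y x \<noteq> 0 \<Longrightarrow> length y \<le> NM \<and> length x \<le> NM" using entry_bound[of M] by blast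
  define N where "N = max NK (max NL NM)"
  have bK: "\<forall>y x. entry K y x \<noteq> 0 \<longrightarrow> length x \<le> N" using NK by (auto simp: N_def le_max_iff_disj)
  have bL: "\<forall>y x. entry L y x \<noteq> 0 \<longrightarrow> length x \<le> N" using NL by (auto simp: N_def le_max_iff_disj)
  have bM: "\<forall>y x. entry M y x \<noteq> 0 \<longrightarrow> length x \<le> N" using NM by (auto simp: N_def le_max_iff_disj)
  have bKL: "\<forall>y x. entry (K * L) y x \<noteq> 0 \<longrightarrow> length x \<le> N"
  proof (intro allI impI, rule ccontr)
    fix y x assume that: "entry (K * L) y x \<noteq> 0" "\<not> length x \<le> N"
    then have z: "entry L z x = 0" for z using bL by blast
    have "entry (K * L) y x = 0" unfolding entry_times_sum[OF bK] by (simp add: z)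
    then show False using that(1) by simp
  qed
  have invs: "inv_on (set z \<union> set x) (\<lambda>y. entry A z y * entry B y x)" for A B :: "'a kern" and z x
    by (rule inv_on_times[OF entry_inv_right entry_inv_left])
  \<comment> \<open>Both sides are the double integral of \<open>?f\<close> over \<open>y\<close>
    and \<open>z\<close>, so associativity is Fubini's theorem. The common bound \<open>N\<close> on
    the lengths turns each product into a finite sum of integrals.\<close>
  show "K * L * M = K * (L * M)"
  proof (rule iffD1[OF entry_inject], intro ext)
    fix w x
    let ?f = "\<lambda>y z. entry K w y * entry L y z * entry M z x"
    have f2: "inv2_on (set w \<union> set x) ?f"
      unfolding inv2_on_def
    proof (intro ballI allI)
      fix g y z assume g: "g \<in> auts (set w \<union> set x)"
      have g0: "g \<in> auts {}" using g auts_mono[of "{}" "set w \<union> set x"] by auto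
      have "map g w = w" "map g x = x" using g by (auto simp: auts_fix intro: map_idI)
      then show "?f (map g y) (map g z) = ?f y z"
        using entry_map[OF g0, of K w y] entry_map[OF g0, of L y z] entry_map[OF g0, of M z x] by simp
    qed
    have fin: "finite (set w \<union> set x)" by simp
    have "entry (K * L * M) w x = (\<Sum>n\<le>N. lint n (\<lambda>z. (\<Sum>m\<le>N. lint m (\<lambda>y. entry K w y * entry L y z)) * entry M z x))"
      unfolding entry_times_sum[OF bKL] entry_times_sum[OF bK] ..
    also have "\<dots> = (\<Sum>n\<le>N. lint n (\<lambda>z. \<Sum>m\<le>N. lint m (\<lambda>y. ?f y z)))"
    proof (intro sum.cong refl lint_cong)
      fix z
      have "lint m (\<lambda>y. entry M z x * (entry K w y * entry L y z)) = entry M z x * lint m (\<lambda>y. entry K w y * entry L y z)" for m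
        by (rule lint_cmult[OF _ invs]) simp
      then show "(\<Sum>m\<le>N. lint m (\<lambda>y. entry K w y * entry L y z)) * entry M z x = (\<Sum>m\<le>N. lint m (\<lambda>y. ?f y z))"
        by (simp add: sum_distrib_right sum_distrib_left mult.commute mult.left_commute)
    qed
    also have "\<dots> = (\<Sum>n\<le>N. \<Sum>m\<le>N. lint n (\<lambda>z. lint m (\<lambda>y. ?f y z)))"
      by (intro sum.cong refl lint_sum[OF fin] inv_on_lint[OF fin inv2_on_flip[OF f2]]) auto
    also have "\<dots> = (\<Sum>n\<le>N. \<Sum>m\<le>N. lint m (\<lambda>y. lint n (\<lambda>z. ?f y z)))"
      by (intro sum.cong refl fubini[OF fin inv2_on_flip[OF f2]])
    also have "\<dots> = (\<Sum>m\<le>N. \<Sum>n\<le>N. lint m (\<lambda>y. lint n (\<lambda>z. ?f y z)))"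
      by (rule sum.swap)
    also have "\<dots> = (\<Sum>m\<le>N. lint m (\<lambda>y. \<Sum>n\<le>N. lint n (\<lambda>z. ?f y z)))"
      by (intro sum.cong refl lint_sum[OF fin, symmetric] inv_on_lint[OF fin f2]) auto
    also have "\<dots> = (\<Sum>m\<le>N. lint m (\<lambda>y. entry K w y * (\<Sum>n\<le>N. lint n (\<lambda>z. entry L y z * entry M z x))))"
    proof (intro sum.cong refl lint_cong)
      fix y
      have "lint n (\<lambda>z. entry K w y * (entry L y z * entry M z x)) = entry K w y * lint n (\<lambda>z. entry L y z * entry M z x)" for n
        by (rule lint_cmult[OF _ invs]) simp
      then show "(\<Sum>n\<le>N. lint n (\<lambda>z. ?f y z)) = entry K w y * (\<Sum>n\<le>N. lint n (\<lambda>z. entry L y z * entry M z x))"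
        by (simp add: sum_distrib_left mult.assoc)
    qed
    also have "\<dots> = entry (K * (L * M)) w x"
      unfolding entry_times_sum[OF bK] entry_times_sum[OF bL] ..
    finally show "entry (K * L * M) w x = entry (K * (L * M)) w x" .
  qed
  have bKL': "\<forall>y x. entry (K + L) y x \<noteq> 0 \<longrightarrow> length x \<le> N"
    using bK bL unfolding plus_kern.rep_eq by (metis add_0)
  show "(K + L) * M = K * M + L * M"
  proof (rule iffD1[OF entry_inject], intro ext)
    fix z x
    have "entry ((K + L) * M) z x = (\<Sum>n\<le>N. lint n (\<lambda>y. entry K z y * entry M y x + entry L z y * entry M y x))"
      unfolding entry_times_sum[OF bKL'] by (simp add: plus_kern.rep_eq distrib_right)
    also have "\<dots> = entry (K * M + L * M) z x"
      unfolding plus_kern.rep_eq entry_times_sum[OF bK] entry_times_sum[OF bL]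
      by (subst lint_add[OF _ invs invs]) (auto simp: sum.distrib)
    finally show "entry ((K + L) * M) z x = entry (K * M + L * M) z x" .
  qed
  show "K * (L + M) = K * L + K * M"
  proof (rule iffD1[OF entry_inject], intro ext)
    fix z x
    have "entry (K * (L + M)) z x = (\<Sum>n\<le>N. lint n (\<lambda>y. entry K z y * entry L y x + entry K z y * entry M y x))"
      unfolding entry_times_sum[OF bK] by (simp add: plus_kern.rep_eq distrib_left)
    also have "\<dots> = entry (K * L + K * M) z x"
      unfolding plus_kern.rep_eq entry_times_sum[OF bK]
      by (subst lint_add[OF _ invs invs]) (auto simp: sum.distrib)
    finally show "entry (K * (L + M)) z x = entry (K * L + K * M) z x" .
  qed
qed

end

lemma kern_eqI: "(\<And>y x. entry K y x = entry L y x) \<Longrightarrow> K = L"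
  by (rule iffD1[OF entry_inject]) (intro ext)

lemma entry_times: "entry (K * L) z x = full_int (\<lambda>y. entry K z y * entry L y x)"
  by (simp add: times_kern.rep_eq)

lemma entry_minus: "entry (K - L) y x = entry K y x - entry L y x"
  by (simp only: minus_kern_def plus_kern.rep_eq uminus_kern.rep_eq) simp

lemma entry_step: "i < length x \<Longrightarrow> step (\<lambda>t. entry K y (x[i := t]))"
proof (rule stepI[of "set y \<union> set x"])
  fix g t assume g: "g \<in> auts (set y \<union> set x)"
  have "g \<in> auts {}" using g auts_mono[of "{}" "set y \<union> set x"] by auto
  moreover have "map g y = y" "map g x = x"
    using g by (auto simp: auts_fix intro!: map_idI)
  ultimately show "entry K y (x[i := g t]) = entry K y (x[i := t])"
    using entry_map[of g K y "x[i := t]"] by (simp add: map_update)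
qed auto

definition admissible :: "(real list \<Rightarrow> real list \<Rightarrow> bool) \<Rightarrow> bool" where
  "admissible R \<longleftrightarrow> (\<forall>g\<in>auts {}. \<forall>y x. R (map g y) (map g x) = R y x) \<and>
    (\<exists>N. \<forall>y x. R y x \<longrightarrow> length y \<le> N \<and> length x \<le> N)"

definition ind :: "(real list \<Rightarrow> real list \<Rightarrow> bool) \<Rightarrow> 'k::comm_ring_1 kern" where
  "ind R = Kern (\<lambda>y x. of_bool (R y x))"

lemma entry_ind: "admissible R \<Longrightarrow> entry (ind R) y x = of_bool (R y x)"
  unfolding ind_def by (subst Kern_inverse) (auto simp: admissible_def invariant_kernel_def inv2_on_def)

lemma admissibleI:
  assumes "\<And>g y x. g \<in> auts {} \<Longrightarrow> R (map g y) (map g x) = R y x"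
    and "\<And>y x. R y x \<Longrightarrow> length y \<le> N \<and> length x \<le> N"
  shows "admissible R"
  using assms unfolding admissible_def by blast

section \<open>Idempotents of coloured configuration spaces\<close>

text \<open>A configuration space is given by a relation \<open>R\<close> on positions; the colour \<open>None\<close> of a
  position imposes no semicontinuity condition in that coordinate.\<close>

definition conf :: "nat \<Rightarrow> (nat \<Rightarrow> nat \<Rightarrow> bool) \<Rightarrow> real list set" where
  "conf N R = {x. length x = N \<and> (\<forall>i<N. \<forall>j<N. R i j \<longrightarrow> x ! i < x ! j)}"

fun colour_le :: "letter option \<Rightarrow> real \<Rightarrow> real \<Rightarrow> bool" where
  "colour_le (Some Black) y x \<longleftrightarrow> y \<le> x"
| "colour_le (Some White) y x \<longleftrightarrow> x \<le> y"
| "colour_le None y x \<longleftrightarrow> y = x"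

text \<open>The cross conditions are imposed on all related positions, not only on neighbouring ones
  as in \<open>E_rel\<close>; for a single chain the two agree
  (\<open>conf_rel_chain\<close>).\<close>

definition conf_rel :: "nat \<Rightarrow> (nat \<Rightarrow> letter option) \<Rightarrow> (nat \<Rightarrow> nat \<Rightarrow> bool) \<Rightarrow> real list \<Rightarrow> real list \<Rightarrow> bool" where
  "conf_rel N c R y x \<longleftrightarrow> y \<in> conf N R \<and> x \<in> conf N R \<and> (\<forall>i<N. colour_le (c i) (y ! i) (x ! i)) \<and>
     (\<forall>i<N. \<forall>j<N. R i j \<longrightarrow> y ! i < x ! j \<and> x ! i < y ! j)"

abbreviation conf_idem :: "nat \<Rightarrow> (nat \<Rightarrow> letter option) \<Rightarrow> (nat \<Rightarrow> nat \<Rightarrow> bool) \<Rightarrow> 'k::comm_ring_1 kern" where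
  "conf_idem N c R \<equiv> ind (conf_rel N c R)"

text \<open>Continuity is expressed as a reproducing property. For a step function, the integral
  over \<open>t \<le> a\<close> adds up the left jumps up to \<open>a\<close>; it returns the value
  at every \<open>a\<close> exactly if the function is continuous from the right and vanishes at
  minus infinity. Over \<open>t \<ge> a\<close>, the left jumps after every \<open>a\<close> must
  cancel, which excludes them. As an integral equation the property passes through other
  integrations by Fubini.\<close>

definition semicont :: "nat \<Rightarrow> nat \<Rightarrow> letter option \<Rightarrow> (real list \<Rightarrow> 'k::comm_ring_1) \<Rightarrow> bool" where
  "semicont N i d f \<longleftrightarrow> d = None \<or>
    (\<forall>x. length x = N \<longrightarrow> sint (\<lambda>t. f (x[i := t]) * of_bool (colour_le d t (x ! i))) = f x)"

text \<open>Functions supported on \<open>X\<close> which are continuous from the right and vanish at minus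
  infinity in the black coordinates, and are continuous from the left in the white ones.\<close>

definition sections :: "nat \<Rightarrow> (nat \<Rightarrow> letter option) \<Rightarrow> real list set \<Rightarrow> (real list \<Rightarrow> 'k::comm_ring_1) \<Rightarrow> bool" where
  "sections N c X f \<longleftrightarrow> (\<forall>x. f x \<noteq> 0 \<longrightarrow> x \<in> X) \<and> (\<forall>i<N. semicont N i (c i) f)"

lemma colour_le_refl [simp]: "colour_le d x x"
  by (cases "(d, x, x)" rule: colour_le.cases) auto

lemma colour_le_auts: "g \<in> auts S \<Longrightarrow> colour_le d (g y) (g x) = colour_le d y x"
  by (cases "(d, y, x)" rule: colour_le.cases) (auto simp: auts_le auts_eq)

lemma conf_length: "x \<in> conf N R \<Longrightarrow> length x = N"
  by (simp add: conf_def)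

lemma conf_map: "g \<in> auts {} \<Longrightarrow> map g x \<in> conf N R \<longleftrightarrow> x \<in> conf N R"
  by (auto simp: conf_def auts_less)

definition invariant_set :: "real list set \<Rightarrow> bool" where
  "invariant_set X \<longleftrightarrow> (\<forall>g\<in>auts {}. \<forall>x. map g x \<in> X \<longleftrightarrow> x \<in> X)"

lemma invariant_conf: "invariant_set (conf N R)"
  by (simp add: invariant_set_def conf_map)

lemma conf_rel_map: "g \<in> auts {} \<Longrightarrow> conf_rel N c R (map g y) (map g x) = conf_rel N c R y x"
  by (auto simp: conf_rel_def conf_map conf_length auts_less colour_le_auts)

lemma admissible_conf_rel: "admissible (conf_rel N c R)"
  by (rule admissibleI[of _ N]) (auto simp: conf_rel_map, auto simp: conf_rel_def conf_def)

lemma entry_conf_idem: "entry (conf_idem N c R) y x = of_bool (conf_rel N c R y x)"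
  by (rule entry_ind[OF admissible_conf_rel])

lemma conf_rel_cong: "(\<And>i. i < N \<Longrightarrow> c i = c' i) \<Longrightarrow> (\<And>i j. i < N \<Longrightarrow> j < N \<Longrightarrow> R i j = R' i j) \<Longrightarrow>
   conf_rel N c R = conf_rel N c' R'"
  by (auto simp: conf_rel_def conf_def fun_eq_iff)

text \<open>If all upper bounds in \<open>A\<close> exceed \<open>b\<close>, the set is the closed
  interval from \<open>a\<close> to \<open>b\<close>. Otherwise it is \<open>[a, m)\<close> with
  \<open>m\<close> the least bound, and this has volume 0: if it is not empty, it is
  \<open>[a, m]\<close> without a point, both of volume 1.\<close>

lemma sint_Icc_open:
  assumes "finite A"
  shows "sint (\<lambda>t. of_bool (a \<le> t \<and> (\<forall>u\<in>A. t < u)) * of_bool (t \<le> b)) = (of_bool (a \<le> b \<and> (\<forall>u\<in>A. b < u)) :: 'k::comm_ring_1)"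
proof (cases "\<forall>u\<in>A. b < u")
  case True
  have "(\<lambda>t. of_bool (a \<le> t \<and> (\<forall>u\<in>A. t < u)) * of_bool (t \<le> b)) = (\<lambda>t. of_bool (a \<le> t \<and> t \<le> b) :: 'k)"
    using True by (auto simp: fun_eq_iff)
  then show ?thesis using True by (simp only: sint_Icc) simp
next
  case False
  define m where "m = Min A"
  have m: "m \<in> A" "m \<le> b" "t < m \<longleftrightarrow> (\<forall>u\<in>A. t < u)" for t
  proof -
    have ne: "A \<noteq> {}" using False by auto
    show "m \<in> A" unfolding m_def by (rule Min_in[OF assms ne])
    show "t < m \<longleftrightarrow> (\<forall>u\<in>A. t < u)" unfolding m_def by (rule Min_gr_iff[OF assms ne])
    obtain u where "u \<in> A" "u \<le> b" using False by (meson not_less)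
    then show "m \<le> b" using Min_le[OF assms] m_def by fastforce
  qed
  have eq: "(\<lambda>t. of_bool (a \<le> t \<and> (\<forall>u\<in>A. t < u)) * of_bool (t \<le> b)) =
    (\<lambda>t. of_bool (a \<le> t \<and> t \<le> m) - of_bool (a \<le> m) * of_bool (t = m) :: 'k)"
    using m(1,2) unfolding m(3)[symmetric] by (auto simp: fun_eq_iff of_bool_def)
  have "sint (\<lambda>t. of_bool (a \<le> t \<and> t \<le> m) - of_bool (a \<le> m) * of_bool (t = m)) = (0 :: 'k)"
    by (subst sint_diff) (auto simp: sint_Icc sint_point[of "\<lambda>t. of_bool (a \<le> m)"] sint_Icc[unfolded of_bool_conj] of_bool_conj intro!: step_intros)
  then show ?thesis using False unfolding eq by auto
qed

lemma sint_Icc_open_left: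
  assumes "finite A"
  shows "sint (\<lambda>t. of_bool (t \<le> b \<and> (\<forall>u\<in>A. u < t)) * of_bool (a \<le> t)) = (of_bool (a \<le> b \<and> (\<forall>u\<in>A. u < a)) :: 'k::comm_ring_1)"
proof (cases "\<forall>u\<in>A. u < a")
  case True
  have "(\<lambda>t. of_bool (t \<le> b \<and> (\<forall>u\<in>A. u < t)) * of_bool (a \<le> t)) = (\<lambda>t. of_bool (a \<le> t \<and> t \<le> b) :: 'k)"
    using True by (auto simp: fun_eq_iff)
  then show ?thesis using True by (simp only: sint_Icc) simp
next
  case False
  define m where "m = Max A"
  have m: "m \<in> A" "a \<le> m" "m < t \<longleftrightarrow> (\<forall>u\<in>A. u < t)" for t
  proof -
    have ne: "A \<noteq> {}" using False by auto
    show "m \<in> A" unfolding m_def by (rule Max_in[OF assms ne])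
    show "m < t \<longleftrightarrow> (\<forall>u\<in>A. u < t)" unfolding m_def by (rule Max_less_iff[OF assms ne])
    obtain u where "u \<in> A" "a \<le> u" using False by (meson not_less)
    then show "a \<le> m" using Max_ge[OF assms] m_def by fastforce
  qed
  have eq: "(\<lambda>t. of_bool (t \<le> b \<and> (\<forall>u\<in>A. u < t)) * of_bool (a \<le> t)) =
    (\<lambda>t. of_bool (m \<le> t \<and> t \<le> b) - of_bool (m \<le> b) * of_bool (t = m) :: 'k)"
    using m(1,2) unfolding m(3)[symmetric] by (auto simp: fun_eq_iff of_bool_def)
  have "sint (\<lambda>t. of_bool (m \<le> t \<and> t \<le> b) - of_bool (m \<le> b) * of_bool (t = m)) = (0 :: 'k)"
    by (subst sint_diff) (auto simp: sint_Icc sint_point[of "\<lambda>t. of_bool (m \<le> b)"] sint_Icc[unfolded of_bool_conj] of_bool_conj intro!: step_intros)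
  then show ?thesis using False unfolding eq by auto
qed

text \<open>For irreflexive \<open>R\<close>, this is what
  \<open>conf_rel N c R y (x[i := t])\<close> demands apart from the conditions on \<open>t\<close>;
  the coordinate \<open>x ! i\<close> does not enter.\<close>

definition conf_rest :: "nat \<Rightarrow> (nat \<Rightarrow> letter option) \<Rightarrow> (nat \<Rightarrow> nat \<Rightarrow> bool) \<Rightarrow> nat \<Rightarrow> real list \<Rightarrow> real list \<Rightarrow> bool" where
  "conf_rest N c R i y x \<longleftrightarrow> y \<in> conf N R \<and> length x = N \<and>
     (\<forall>j<N. j \<noteq> i \<longrightarrow> colour_le (c j) (y ! j) (x ! j)) \<and>
     (\<forall>j<N. \<forall>k<N. j \<noteq> i \<longrightarrow> k \<noteq> i \<longrightarrow> R j k \<longrightarrow> x ! j < x ! k \<and> y ! j < x ! k \<and> x ! j < y ! k) \<and>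
     (\<forall>q<N. R i q \<longrightarrow> y ! i < x ! q) \<and> (\<forall>r<N. R r i \<longrightarrow> x ! r < y ! i)"

lemma conf_rel_update:
  assumes "i < N" "length x = N" and irr: "\<And>j. \<not> R j j"
  shows "conf_rel N c R y (x[i := t]) \<longleftrightarrow> conf_rest N c R i y x \<and> colour_le (c i) (y ! i) t \<and>
    (\<forall>q<N. R i q \<longrightarrow> t < x ! q \<and> t < y ! q) \<and> (\<forall>r<N. R r i \<longrightarrow> x ! r < t \<and> y ! r < t)"
    (is "?L \<longleftrightarrow> ?R")
proof
  assume L: ?L
  have n: "x[i := t] ! j = (if j = i then t else x ! j)" if "j < N" for j using assms that by simp
  have c: "\<And>j. j < N \<Longrightarrow> colour_le (c j) (y ! j) (x[i := t] ! j)"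
    and o: "\<And>j k. j < N \<Longrightarrow> k < N \<Longrightarrow> R j k \<Longrightarrow> y ! j < x[i := t] ! k \<and> x[i := t] ! j < y ! k \<and> x[i := t] ! j < x[i := t] ! k"
    and y: "y \<in> conf N R"
    using L by (auto simp: conf_rel_def conf_def)
  have o1: "y ! i < x ! q \<and> t < y ! q \<and> t < x ! q" if "q < N" "R i q" for q
    using o[OF assms(1) that] n[OF that(1)] n[OF assms(1)] irr that by (cases "q = i") auto
  have o2: "y ! r < t \<and> x ! r < y ! i \<and> x ! r < t" if "r < N" "R r i" for r
    using o[OF that(1) assms(1) that(2)] n[OF that(1)] n[OF assms(1)] irr that by (cases "r = i") auto
  have o3: "x ! j < x ! k \<and> y ! j < x ! k \<and> x ! j < y ! k" if "j < N" "k < N" "j \<noteq> i" "k \<noteq> i" "R j k" for j k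
    using o[OF that(1,2,5)] n[OF that(1)] n[OF that(2)] that by auto
  have "colour_le (c j) (y ! j) (x ! j)" if "j < N" "j \<noteq> i" for j using c[OF that(1)] n[OF that(1)] that by simp
  moreover have "colour_le (c i) (y ! i) t" using c[OF assms(1)] n[OF assms(1)] by simp
  ultimately show ?R using o1 o2 o3 y assms(2) unfolding conf_rest_def by blast
next
  assume R: ?R
  have n: "x[i := t] ! j = (if j = i then t else x ! j)" if "j < N" for j using assms that by simp
  have y: "y \<in> conf N R" using R by (simp add: conf_rest_def)
  have o: "x[i := t] ! j < x[i := t] ! k \<and> y ! j < x[i := t] ! k \<and> x[i := t] ! j < y ! k" if "j < N" "k < N" "R j k" for j k
    using R that irr[of i] n[OF that(1)] n[OF that(2)] unfolding conf_rest_def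
    by (cases "j = i"; cases "k = i") (simp_all add: y)
  have "colour_le (c j) (y ! j) (x[i := t] ! j)" if "j < N" for j
    using R that n[OF that] unfolding conf_rest_def by (cases "j = i") simp_all
  then show ?L using o y assms(2) unfolding conf_rel_def conf_def by simp
qed

lemma conf_less: "y \<in> conf N R \<Longrightarrow> i < N \<Longrightarrow> j < N \<Longrightarrow> R i j \<Longrightarrow> y ! i < y ! j"
  by (simp add: conf_def)

lemma semicont_conf_rel:
  assumes "i < N" and irr: "\<And>j. \<not> R j j"
  shows "semicont N i (c i) (\<lambda>x. of_bool (conf_rel N c R y x) :: 'k::comm_ring_1)"
proof (cases "c i")
  case None then show ?thesis by (simp add: semicont_def)
next
  case (Some d)
  show ?thesis
    unfolding semicont_def
  proof (intro disjI2 allI impI)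
    fix x :: "real list" assume x: "length x = N"
    note upd = conf_rel_update[where R = R and c = c and y = y, OF assms(1) x irr]
    have xx: "x[i := x ! i] = x" by simp
    show "sint (\<lambda>t. of_bool (conf_rel N c R y (x[i := t])) * of_bool (colour_le (c i) t (x ! i))) =
      (of_bool (conf_rel N c R y x) :: 'k)"
    proof (cases d)
      case Black
      define A where "A = (!) x ` {q. q < N \<and> R i q} \<union> (!) y ` {q. q < N \<and> R i q}"
      have fA: "finite A" by (simp add: A_def)
      have rel: "conf_rel N c R y (x[i := t]) \<longleftrightarrow> conf_rest N c R i y x \<and> y ! i \<le> t \<and> (\<forall>u\<in>A. t < u)" for t
      proof -
        have "x ! r < t \<and> y ! r < t" if "conf_rest N c R i y x" "y ! i \<le> t" "r < N" "R r i" for r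
          using that assms(1) conf_less[of y N R r i] unfolding conf_rest_def
          by (meson le_less_trans less_le_trans)
        then show ?thesis unfolding upd using Some Black by (auto simp: A_def)
      qed
      have "conf_rel N c R y x \<longleftrightarrow> conf_rest N c R i y x \<and> y ! i \<le> x ! i \<and> (\<forall>u\<in>A. x ! i < u)"
        using rel[of "x ! i"] by simp
      then show ?thesis using sint_Icc_open[OF fA, of "y ! i" "x ! i", where 'k = 'k] Some Black
        unfolding rel by (cases "conf_rest N c R i y x") auto
    next
      case White
      define A where "A = (!) x ` {r. r < N \<and> R r i} \<union> (!) y ` {r. r < N \<and> R r i}"
      have fA: "finite A" by (simp add: A_def)
      have rel: "conf_rel N c R y (x[i := t]) \<longleftrightarrow> conf_rest N c R i y x \<and> t \<le> y ! i \<and> (\<forall>u\<in>A. u < t)" for t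
      proof -
        have "t < x ! q \<and> t < y ! q" if "conf_rest N c R i y x" "t \<le> y ! i" "q < N" "R i q" for q
          using that assms(1) conf_less[of y N R i q] unfolding conf_rest_def
          by (meson le_less_trans less_le_trans)
        then show ?thesis unfolding upd using Some White by (auto simp: A_def)
      qed
      have "conf_rel N c R y x \<longleftrightarrow> conf_rest N c R i y x \<and> x ! i \<le> y ! i \<and> (\<forall>u\<in>A. u < x ! i)"
        using rel[of "x ! i"] by simp
      then show ?thesis using sint_Icc_open_left[OF fA, of "y ! i" "x ! i", where 'k = 'k] Some White
        unfolding rel by (cases "conf_rest N c R i y x") auto
    qed
  qed
qed

lemma sections_conf_idem:
  assumes "\<And>j. \<not> R j j"
  shows "sections N c (conf N R) (entry (conf_idem N c R) y)"
proof -
  have e: "entry (conf_idem N c R) y = (\<lambda>x. of_bool (conf_rel N c R y x))"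
    by (simp add: entry_conf_idem fun_eq_iff)
  show ?thesis
    unfolding sections_def e
  proof (intro conjI allI impI)
    show "x \<in> conf N R" if "of_bool (conf_rel N c R y x) \<noteq> (0::'a)" for x
      using that by (auto simp: conf_rel_def)
  qed (intro semicont_conf_rel assms)
qed

lemma entry_times_length:
  assumes "\<forall>y x. entry L y x \<noteq> 0 \<longrightarrow> length y = N"
  shows "entry (K * L) z x = lint N (\<lambda>y. entry K z y * entry L y x)"
  unfolding entry_times by (rule full_int_length) (metis assms mult_zero_right)

text \<open>Being a section is a system of integral equations in \<open>x\<close> with
  \<open>y\<close> as a parameter, so by Fubini it is inherited from the rows of \<open>L\<close>
  when these are integrated against \<open>K\<close>.\<close>

lemma sections_times:
  assumes L: "\<And>y. sections N c X (entry L y)" and len: "\<forall>y x. entry L y x \<noteq> 0 \<longrightarrow> length y = q"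
  shows "sections N c X (entry (K * L) z)"
  unfolding sections_def
proof (intro conjI allI impI)
  fix x assume nz: "entry (K * L) z x \<noteq> 0"
  have "\<exists>y. entry L y x \<noteq> 0"
  proof (rule ccontr)
    assume "\<not> ?thesis"
    then show False using nz by (simp add: entry_times_length[OF len])
  qed
  then show "x \<in> X" using L by (auto simp: sections_def)
next
  fix i assume i: "i < N"
  have "c i \<noteq> None \<longrightarrow> (\<forall>x. length x = N \<longrightarrow> sint (\<lambda>t. entry (K * L) z (x[i := t]) * of_bool (colour_le (c i) t (x ! i))) = entry (K * L) z x)"
  proof (intro allI impI)
    fix x :: "real list" assume ci: "c i \<noteq> None" and x: "length x = N"
    let ?b = "\<lambda>t. of_bool (colour_le (c i) t (x ! i)) :: 'a"
    let ?S = "set z \<union> set x"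
    have inv: "(case g of g \<Rightarrow> map g z = z \<and> map g x = x \<and> g \<in> auts {} \<and> g (x ! i) = x ! i)" if "g \<in> auts ?S" for g
      using that auts_mono[of "{}" ?S] i x by (auto simp: auts_fix intro!: map_idI)
    have stb: "step ?b" by (cases "c i"; cases "the (c i)") (auto intro!: step_intros)
    have "sint (\<lambda>t. entry (K * L) z (x[i := t]) * ?b t) = sint (\<lambda>t. lint q (\<lambda>y. entry K z y * entry L y (x[i := t]) * ?b t))"
    proof (rule arg_cong[of _ _ sint], rule ext)
      fix t
      have "lint q (\<lambda>y. ?b t * (entry K z y * entry L y (x[i := t]))) = ?b t * lint q (\<lambda>y. entry K z y * entry L y (x[i := t]))"
        by (rule lint_cmult[OF _ inv_on_times[OF entry_inv_right entry_inv_left]]) auto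
      then show "entry (K * L) z (x[i := t]) * ?b t = lint q (\<lambda>y. entry K z y * entry L y (x[i := t]) * ?b t)"
        unfolding entry_times_length[OF len] by (simp add: mult.commute)
    qed
    also have "\<dots> = lint q (\<lambda>y. sint (\<lambda>t. entry K z y * entry L y (x[i := t]) * ?b t))"
    proof (rule fubini_sint_lint[of ?S])
      fix g t y assume g: "g \<in> auts ?S"
      note I = inv[OF g, simplified]
      have "map g (x[i := t]) = x[i := g t]" using I by (simp add: map_update)
      then have "entry K z (map g y) = entry K z y" "entry L (map g y) (x[i := g t]) = entry L y (x[i := t])"
        using entry_map[of g K z y] entry_map[of g L y "x[i := t]"] I by auto
      moreover have "?b (g t) = ?b t" using colour_le_auts[of g "{}" "c i" t "x ! i"] I by simp
      ultimately show "entry K z (map g y) * entry L (map g y) (x[i := g t]) * ?b (g t) = entry K z y * entry L y (x[i := t]) * ?b t"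
        by simp
    qed auto
    also have "\<dots> = lint q (\<lambda>y. entry K z y * entry L y x)"
    proof (rule lint_cong)
      fix y
      have "sint (\<lambda>t. entry K z y * (entry L y (x[i := t]) * ?b t)) = entry K z y * sint (\<lambda>t. entry L y (x[i := t]) * ?b t)"
        using i x by (intro sint_cmult step_times entry_step stb) auto
      also have "sint (\<lambda>t. entry L y (x[i := t]) * ?b t) = entry L y x"
        using L[of y] i ci x by (auto simp: sections_def semicont_def)
      finally show "sint (\<lambda>t. entry K z y * entry L y (x[i := t]) * ?b t) = entry K z y * entry L y x" by (simp add: mult.assoc)
    qed
    finally show "sint (\<lambda>t. entry (K * L) z (x[i := t]) * ?b t) = entry (K * L) z x"
      by (simp add: entry_times_length[OF len])
  qed
  then show "semicont N i (c i) (entry (K * L) z)" unfolding semicont_def by blast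
qed

lemma insert_remove_nth: "i < length x \<Longrightarrow> insert_nth i t (remove_nth i x) = x[i := t]"
  by (simp add: insert_nth_def remove_nth_def upd_conv_take_nth_drop min_def)

lemma length_remove_nth: "i < length x \<Longrightarrow> Suc (length (remove_nth i x)) = length x"
  by (simp add: remove_nth_def)

lemma remove_nth_map: "remove_nth i (map g x) = map g (remove_nth i x)"
  by (simp add: remove_nth_def take_map drop_map)

text \<open>Right multiplication by this kernel applies the colour \<open>d\<close> to the
  coordinate \<open>i\<close> alone, within the domain \<open>X\<close>
  (\<open>entry_times_coord\<close>).\<close>

definition coord_rel :: "nat \<Rightarrow> nat \<Rightarrow> letter option \<Rightarrow> real list set \<Rightarrow> real list \<Rightarrow> real list \<Rightarrow> bool" where
  "coord_rel N i d X y x \<longleftrightarrow> y \<in> X \<and> x \<in> X \<and> length y = N \<and> length x = N \<and>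
     remove_nth i y = remove_nth i x \<and> colour_le d (y ! i) (x ! i)"

lemma admissible_coord_rel:
  assumes "i < N" "invariant_set X"
  shows "admissible (coord_rel N i d X)"
proof (rule admissibleI[of _ N])
  fix g y x assume g: "g \<in> auts {}"
  have "map g a = map g b \<longleftrightarrow> a = b" for a b
    using auts_inj[OF g, of UNIV] by (simp add: inj_map_eq_map)
  then show "coord_rel N i d X (map g y) (map g x) = coord_rel N i d X y x"
    using assms colour_le_auts[OF g] g by (auto simp: coord_rel_def remove_nth_map invariant_set_def)
qed (auto simp: coord_rel_def)

lemma entry_times_coord:
  assumes "i < N" "invariant_set X" "length x = N"
  shows "entry (K * ind (coord_rel N i d X)) z x =
    sint (\<lambda>t. entry K z (x[i := t]) * of_bool (x[i := t] \<in> X) * of_bool (colour_le d t (x ! i))) * of_bool (x \<in> X)"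
proof -
  have "entry (K * ind (coord_rel N i d X)) z x =
    full_int (\<lambda>y. (entry K z y * of_bool (y \<in> X) * of_bool (colour_le d (y ! i) (x ! i)) * of_bool (x \<in> X)) *
      of_bool (length y = N \<and> remove_nth i y = remove_nth i x))"
    unfolding entry_times entry_ind[OF admissible_coord_rel[OF assms(1,2)]] using assms(3)
    by (intro arg_cong[of _ _ full_int]) (auto simp: coord_rel_def fun_eq_iff of_bool_def)
  also have "\<dots> = sint (\<lambda>t. entry K z (x[i := t]) * of_bool (x[i := t] \<in> X) * of_bool (colour_le d t (x ! i)) * of_bool (x \<in> X))"
    using assms by (subst full_int_fibre) (auto simp: length_remove_nth insert_remove_nth)
  finally show ?thesis by (cases "x \<in> X") auto
qed

lemma entry_times_support:
  assumes "\<And>y. entry L y x = 0"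
  shows "entry (K * L) z x = 0"
  by (simp add: entry_times assms full_int_def)

lemma sections_times_coord:
  assumes i: "i < N" and R: "X = conf N R" and f: "\<And>z. sections N c X (entry K z)" and ci: "c i = Some d"
  shows "K * ind (coord_rel N i (Some d) X) = K"
proof (rule kern_eqI)
  fix z x
  have XX: "invariant_set X" by (simp add: R invariant_conf)
  have supp: "entry K z x = 0" if "x \<notin> X" for x using f[of z] that by (auto simp: sections_def)
  show "entry (K * ind (coord_rel N i (Some d) X)) z x = entry K z x"
  proof (cases "x \<in> X")
    case False
    have "entry (ind (coord_rel N i (Some d) X)) y x = (0::'a)" for y
      using False by (simp add: entry_ind[OF admissible_coord_rel[OF i XX]] coord_rel_def)
    then show ?thesis using entry_times_support supp[OF False] by metis
  next
    case True
    then have len: "length x = N" by (simp add: R conf_length)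
    have "entry (K * ind (coord_rel N i (Some d) X)) z x = 
      sint (\<lambda>t. entry K z (x[i := t]) * of_bool (x[i := t] \<in> X) * of_bool (colour_le (Some d) t (x ! i)))"
      unfolding entry_times_coord[OF i XX len] using True by simp
    also have "(\<lambda>t. entry K z (x[i := t]) * of_bool (x[i := t] \<in> X)) = (\<lambda>t. entry K z (x[i := t]))"
      using supp by (auto simp: fun_eq_iff of_bool_def)
    also have "sint (\<lambda>t. entry K z (x[i := t]) * of_bool (colour_le (Some d) t (x ! i))) = entry K z x"
      using f[of z] i ci len by (auto simp: sections_def semicont_def)
    finally show ?thesis .
  qed
qed

text \<open>The colours can be introduced one coordinate at a time, the black ones from left to
  right and the white ones from right to left.\<close>

lemma conf_idem_add_colour:
  assumes i: "i < N" and irr: "\<And>j. \<not> R j j" and ci: "c i = None"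
    and B: "d = Black \<longrightarrow> (\<forall>j<N. R i j \<longrightarrow> c j \<noteq> Some Black)"
    and W: "d = White \<longrightarrow> (\<forall>j<N. R j i \<longrightarrow> c j \<noteq> Some White)"
  shows "conf_idem N (c(i := Some d)) R = conf_idem N c R * (ind (coord_rel N i (Some d) (conf N R)) :: 'k::comm_ring_1 kern)"
proof (rule kern_eqI)
  fix y x
  let ?X = "conf N R" and ?c = "c(i := Some d)"
  have XX: "invariant_set ?X" by (rule invariant_conf)
  show "entry (conf_idem N ?c R) y x = (entry (conf_idem N c R * ind (coord_rel N i (Some d) ?X)) y x :: 'k)"
  proof (cases "x \<in> ?X")
    case False
    have "entry (ind (coord_rel N i (Some d) ?X)) y x = (0::'k)" for y
      using False by (simp add: entry_ind[OF admissible_coord_rel[OF i XX]] coord_rel_def)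
    then have "entry (conf_idem N c R * ind (coord_rel N i (Some d) ?X)) y x = (0::'k)"
      using entry_times_support by metis
    moreover have "entry (conf_idem N ?c R) y x = (0::'k)" using False by (simp add: entry_conf_idem conf_rel_def)
    ultimately show ?thesis by simp
  next
    case True
    then have len: "length x = N" by (simp add: conf_length)
    let ?P = "\<lambda>t. conf_rel N c R y (x[i := t]) \<and> colour_le (Some d) t (x ! i)"
    \<comment> \<open>As \<open>c i = None\<close>, the coordinate is forced to agree with that of
      \<open>y\<close>, and the integral reduces to a point mass.\<close>
    have yi: "t = y ! i" if "conf_rel N c R y (x[i := t])" for t
      using that i ci len by (auto simp: conf_rel_def)
    have "entry (conf_idem N c R * ind (coord_rel N i (Some d) ?X)) y x =
      (sint (\<lambda>t. of_bool (conf_rel N c R y (x[i := t])) * of_bool (x[i := t] \<in> ?X) * of_bool (colour_le (Some d) t (x ! i))) :: 'k)"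
      unfolding entry_times_coord[OF i XX len] entry_conf_idem using True by simp
    also have "\<dots> = sint (\<lambda>t. of_bool (?P t) * of_bool (t = y ! i))"
    proof (rule arg_cong[of _ _ sint], rule ext)
      fix t
      have "x[i := t] \<in> ?X" if "conf_rel N c R y (x[i := t])" using that by (simp add: conf_rel_def)
      then show "of_bool (conf_rel N c R y (x[i := t])) * of_bool (x[i := t] \<in> ?X) * of_bool (colour_le (Some d) t (x ! i)) =
        (of_bool (?P t) * of_bool (t = y ! i) :: 'k)"
        using yi[of t] by (cases "conf_rel N c R y (x[i := t])") simp_all
    qed
    also have "\<dots> = of_bool (?P (y ! i))" by (rule sint_point)
    also have "?P (y ! i) \<longleftrightarrow> conf_rel N ?c R y x"
    proof -
      have rest: "conf_rest N ?c R i y x \<longleftrightarrow> conf_rest N c R i y x" by (auto simp: conf_rest_def)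
      note U = conf_rel_update[where R = R and y = y, OF i len irr]
      have e1: "conf_rel N c R y (x[i := y ! i]) \<longleftrightarrow> conf_rest N c R i y x"
        unfolding U using i by (auto simp: conf_rest_def dest: conf_less)
      have e2: "conf_rel N ?c R y x \<longleftrightarrow> conf_rest N c R i y x \<and> colour_le (Some d) (y ! i) (x ! i) \<and>
        (\<forall>q<N. R i q \<longrightarrow> x ! i < y ! q) \<and> (\<forall>r<N. R r i \<longrightarrow> y ! r < x ! i)"
        using U[where c = ?c and t = "x ! i"] rest True i by (auto dest: conf_less)
      \<comment> \<open>These cross conditions are absent from the product and have to be deduced.
        For black, \<open>x ! i < x ! q \<le> y ! q\<close> for every later \<open>q\<close>,
        because no later position is black yet; for white dually. This dictates the order in which
        the colours are introduced.\<close>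
      have "(\<forall>q<N. R i q \<longrightarrow> x ! i < y ! q) \<and> (\<forall>r<N. R r i \<longrightarrow> y ! r < x ! i)"
        if C: "conf_rest N c R i y x" and D: "colour_le (Some d) (y ! i) (x ! i)"
      proof (cases d)
        case Black
        have "x ! i < y ! q" if q: "q < N" "R i q" for q
        proof -
          have "q \<noteq> i" using q irr by auto
          then have "colour_le (c q) (y ! q) (x ! q)" using C q by (simp add: conf_rest_def)
          moreover have "x ! i < x ! q" using conf_less[OF True i q(1) q(2)] .
          ultimately show ?thesis using B Black q
            by (cases "(c q, y ! q, x ! q)" rule: colour_le.cases) auto
        qed
        moreover have "y ! r < x ! i" if r: "r < N" "R r i" for r
          using C D Black conf_less[of y N R r i] r i by (auto simp: conf_rest_def)
        ultimately show ?thesis by blast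
      next
        case White
        have "y ! r < x ! i" if r: "r < N" "R r i" for r
        proof -
          have "r \<noteq> i" using r irr by auto
          then have "colour_le (c r) (y ! r) (x ! r)" using C r by (simp add: conf_rest_def)
          moreover have "x ! r < x ! i" using conf_less[OF True r(1) i r(2)] .
          ultimately show ?thesis using W White r
            by (cases "(c r, y ! r, x ! r)" rule: colour_le.cases) auto
        qed
        moreover have "x ! i < y ! q" if q: "q < N" "R i q" for q
          using C D White conf_less[of y N R i q] q i by (auto simp: conf_rest_def)
        ultimately show ?thesis by blast
      qed
      then show ?thesis using e1 e2 by blast
    qed
    finally show ?thesis by (simp add: entry_conf_idem)
  qed
qed

text \<open>The relation without colours is the identity on the configuration space. By
  \<open>conf_idem_add_colour\<close> each further colour contributes a factor acting on one
  coordinate, and rows that are semicontinuous there are unchanged by it.\<close>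

lemma sections_times_conf_idem:
  fixes K :: "'k::comm_ring_1 kern"
  assumes R: "\<forall>i j. R i j \<longrightarrow> i < j" and f: "\<And>z. sections N c (conf N R) (entry K z)"
  shows "K * conf_idem N c R = K"
proof -
  have irr: "\<And>j. \<not> R j j" using R by blast
  \<comment> \<open>\<open>b n\<close> retains the black colours of positions below
    \<open>n\<close>; \<open>w n\<close> retains all black colours and the white ones of positions
    from \<open>n\<close> on. So \<open>b\<close> is followed upwards from 0 to \<open>N\<close>,
    then \<open>w\<close> downwards from \<open>N\<close> to 0.\<close>
  define b where "b n = (\<lambda>i. if c i = Some Black \<and> i < n then c i else None)" for n :: nat
  define w where "w n = (\<lambda>i. if c i = Some White \<and> i < n then None else c i)" for n :: nat
  have add: "K * conf_idem N (c'(i := Some d)) R = K"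
    if "K * conf_idem N c' R = K" "i < N" "c' i = None" "c i = Some d"
      "d = Black \<longrightarrow> (\<forall>j<N. R i j \<longrightarrow> c' j \<noteq> Some Black)"
      "d = White \<longrightarrow> (\<forall>j<N. R j i \<longrightarrow> c' j \<noteq> Some White)" for c' i d
    unfolding conf_idem_add_colour[where R = R, OF that(2) irr that(3) that(5,6)] mult.assoc[symmetric] that(1)
    by (rule sections_times_coord[OF that(2) refl f that(4)])
  have "K * conf_idem N (b n) R = K" if "n \<le> N" for n
    using that
  proof (induction n)
    case 0
    have "conf_rel N (b 0) R y x \<longleftrightarrow> x \<in> conf N R \<and> y = x" for y x
      by (auto simp: conf_rel_def b_def list_eq_iff_nth_eq conf_def)
    then have "entry (K * conf_idem N (b 0) R) z x = full_int (\<lambda>y. (entry K z y * of_bool (x \<in> conf N R)) * of_bool (y = x))" for z x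
      unfolding entry_times entry_conf_idem by (intro arg_cong[of _ _ full_int]) auto
    also have "\<dots> z x = entry K z x" for z x
      unfolding full_int_point using f[of z] by (auto simp: sections_def of_bool_def)
    finally show ?case by (intro kern_eqI)
  next
    case (Suc n)
    show ?case
    proof (cases "c n = Some Black")
      case True
      have "b (Suc n) = (b n)(n := Some Black)" using True by (auto simp: b_def fun_eq_iff)
      moreover have "K * conf_idem N ((b n)(n := Some Black)) R = K"
        by (rule add) (use Suc True in \<open>auto simp: b_def dest!: R[rule_format]\<close>)
      ultimately show ?thesis by (simp only:)
    next
      case False
      have "b (Suc n) = b n" using False by (auto simp: b_def fun_eq_iff less_Suc_eq)
      then show ?thesis using Suc by simp
    qed
  qed
  from this[of N] have bN: "K * conf_idem N (b N) R = K" by simp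
  have "K * conf_idem N (w (N - n)) R = K" for n
  proof (induction n)
    case 0
    have "conf_rel N (w N) R = conf_rel N (b N) R"
      by (rule conf_rel_cong) (auto simp: w_def b_def, metis letter.exhaust not_None_eq)
    then show ?case using bN by simp
  next
    case (Suc n)
    define m where "m = N - Suc n"
    consider "N - Suc n = N - n" | "N - n = Suc m" by (cases "n < N") (auto simp: m_def)
    then show ?case
    proof cases
      case 1 then show ?thesis using Suc by simp
    next
      case 2
      then have m: "m < N" "N - Suc n = m" by (auto simp: m_def)
      show ?thesis
      proof (cases "c m = Some White")
        case True
        have "w m = (w (Suc m))(m := Some White)" using True by (auto simp: w_def fun_eq_iff)
        moreover have "K * conf_idem N ((w (Suc m))(m := Some White)) R = K"
          by (rule add) (use Suc True m 2 in \<open>auto simp: w_def dest!: R[rule_format]\<close>)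
        ultimately show ?thesis unfolding m(2) by (simp only:)
      next
        case False
        have "w m = w (Suc m)" using False by (auto simp: w_def fun_eq_iff less_Suc_eq)
        then show ?thesis using Suc m 2 by simp
      qed
    qed
  qed
  from this[of N] show ?thesis by (simp add: w_def)
qed

text \<open>Identities \<open>K * e = K\<close> are verified and exploited row by row through this
  equivalence. Conversely to \<open>sections_times_conf_idem\<close>, the rows of a product with the
  idempotent are sections because the rows of the idempotent are.\<close>

lemma times_conf_idem_iff:
  assumes R: "\<forall>i j. R i j \<longrightarrow> i < j"
  shows "K * conf_idem N c R = K \<longleftrightarrow> (\<forall>z. sections N c (conf N R) (entry K z))"
proof
  assume K: "K * conf_idem N c R = K"
  have "sections N c (conf N R) (entry (K * conf_idem N c R) z)" for z
  proof (rule sections_times)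
    show "sections N c (conf N R) (entry (conf_idem N c R) y)" for y
      by (rule sections_conf_idem) (use R in blast)
    show "\<forall>y x. entry (conf_idem N c R) y x \<noteq> 0 \<longrightarrow> length y = N"
      by (auto simp: entry_conf_idem conf_rel_def conf_length of_bool_def split: if_splits)
  qed
  then show "\<forall>z. sections N c (conf N R) (entry K z)" using K by simp
qed (use sections_times_conf_idem[OF R] in blast)

lemma conf_idem_idem:
  assumes R: "\<forall>i j. R i j \<longrightarrow> i < j"
  shows "conf_idem N c R * conf_idem N c R = conf_idem N c R"
  by (rule sections_times_conf_idem[OF R sections_conf_idem]) (use R in blast)+

section \<open>Decompositions of idempotents\<close>

text \<open>The ring form of an isomorphism from the image of \<open>e\<close> to the direct sum of
  the images of the \<open>E i\<close>: the \<open>u i\<close> and \<open>v i\<close> are the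
  components of two mutually inverse maps. In the absence of a unit they are tied to their source
  and target by absorbing the idempotents.\<close>

definition decomposes :: "'r::ring \<Rightarrow> 'i set \<Rightarrow> ('i \<Rightarrow> 'r) \<Rightarrow> bool" where
  "decomposes e I E \<longleftrightarrow> finite I \<and> (\<exists>u v.
     (\<forall>i\<in>I. e * u i = u i \<and> u i * E i = u i \<and> E i * v i = v i \<and> v i * e = v i) \<and>
     (\<forall>i\<in>I. \<forall>j\<in>I. v i * u j = (if i = j then E i else 0)) \<and>
     (\<Sum>i\<in>I. u i * v i) = e)"

lemma decomposesI:
  assumes "finite I"
    and "\<And>i. i \<in> I \<Longrightarrow> e * u i = u i" "\<And>i. i \<in> I \<Longrightarrow> u i * E i = u i"
    and "\<And>i. i \<in> I \<Longrightarrow> E i * v i = v i" "\<And>i. i \<in> I \<Longrightarrow> v i * e = v i"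
    and "\<And>i j. i \<in> I \<Longrightarrow> j \<in> I \<Longrightarrow> v i * u j = (if i = j then E i else 0)"
    and "(\<Sum>i\<in>I. u i * v i) = e"
  shows "decomposes e I E"
  unfolding decomposes_def using assms by (intro conjI exI[of _ u] exI[of _ v]) auto

lemma decomposesE:
  assumes "decomposes e I E"
  obtains u v where "finite I"
    and "\<forall>i\<in>I. e * u i = u i" "\<forall>i\<in>I. u i * E i = u i"
    and "\<forall>i\<in>I. E i * v i = v i" "\<forall>i\<in>I. v i * e = v i"
    and "\<forall>i\<in>I. \<forall>j\<in>I. v i * u j = (if i = j then E i else 0)"
    and "(\<Sum>i\<in>I. u i * v i) = e"
  using assms unfolding decomposes_def by blast

lemma decomposes_refl: "e * e = e \<Longrightarrow> decomposes e {i} (\<lambda>_. e)"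
  by (rule decomposesI[of _ _ "\<lambda>_. e" _ "\<lambda>_. e"]) auto

lemma decomposes_reindex:
  assumes "decomposes e I E" "bij_betw h J I" "\<And>j. j \<in> J \<Longrightarrow> E' j = E (h j)"
  shows "decomposes e J E'"
proof -
  obtain u v where D: "finite I"
    "\<forall>i\<in>I. e * u i = u i" "\<forall>i\<in>I. u i * E i = u i"
    "\<forall>i\<in>I. E i * v i = v i" "\<forall>i\<in>I. v i * e = v i"
    "\<forall>i\<in>I. \<forall>j\<in>I. v i * u j = (if i = j then E i else 0)"
    "(\<Sum>i\<in>I. u i * v i) = e" using assms(1) by (rule decomposesE)
  have h: "h j \<in> I" if "j \<in> J" for j using assms(2) that by (auto simp: bij_betw_def)
  have inj: "h i = h j \<longleftrightarrow> i = j" if "i \<in> J" "j \<in> J" for i j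
    using assms(2) that by (auto simp: bij_betw_def inj_on_def)
  show ?thesis
  proof (rule decomposesI[of _ _ "u \<circ> h" _ "v \<circ> h"])
    show "finite J" using D(1) bij_betw_finite[OF assms(2)] by simp
    show "(\<Sum>i\<in>J. (u \<circ> h) i * (v \<circ> h) i) = e"
      using sum.reindex_bij_betw[OF assms(2), of "\<lambda>i. u i * v i"] D(7) by simp
  qed (use D h inj assms(3) in simp_all)
qed

lemma decomposes_cong:
  "decomposes e I E \<Longrightarrow> (\<And>i. i \<in> I \<Longrightarrow> E i = E' i) \<Longrightarrow> decomposes e I E'"
  by (rule decomposes_reindex[of e I E id]) (auto simp: bij_betw_def)

text \<open>The components are composed. The index \<open>i # c\<close> lets an iterated
  decomposition be indexed by words, which will be the codes of ruffles.\<close>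

lemma decomposes_trans:
  assumes e: "decomposes e I E" and E: "\<And>i. i \<in> I \<Longrightarrow> decomposes (E i) (J i) (\<lambda>c. F (i # c))"
  shows "decomposes e {i # c | i c. i \<in> I \<and> c \<in> J i} F"
proof -
  obtain u v where D: "finite I"
    "\<forall>i\<in>I. e * u i = u i" "\<forall>i\<in>I. u i * E i = u i"
    "\<forall>i\<in>I. E i * v i = v i" "\<forall>i\<in>I. v i * e = v i"
    "\<forall>i\<in>I. \<forall>j\<in>I. v i * u j = (if i = j then E i else 0)"
    "(\<Sum>i\<in>I. u i * v i) = e" using e by (rule decomposesE)
  have "\<forall>i\<in>I. \<exists>p. finite (J i) \<and>
     (\<forall>c\<in>J i. E i * fst p c = fst p c \<and> fst p c * F (i # c) = fst p c \<and> F (i # c) * snd p c = snd p c \<and> snd p c * E i = snd p c) \<and>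
     (\<forall>c\<in>J i. \<forall>d\<in>J i. snd p c * fst p d = (if c = d then F (i # c) else 0)) \<and>
     (\<Sum>c\<in>J i. fst p c * snd p c) = E i"
    using E unfolding decomposes_def split_paired_Ex fst_conv snd_conv by blast
  from bchoice[OF this] obtain p where p: "\<forall>i\<in>I. finite (J i) \<and>
     (\<forall>c\<in>J i. E i * fst (p i) c = fst (p i) c \<and> fst (p i) c * F (i # c) = fst (p i) c \<and> F (i # c) * snd (p i) c = snd (p i) c \<and> snd (p i) c * E i = snd (p i) c) \<and>
     (\<forall>c\<in>J i. \<forall>d\<in>J i. snd (p i) c * fst (p i) d = (if c = d then F (i # c) else 0)) \<and>
     (\<Sum>c\<in>J i. fst (p i) c * snd (p i) c) = E i" ..
  define uu where "uu i = fst (p i)" for i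
  define vv where "vv i = snd (p i)" for i
  have DD: "\<And>i. i \<in> I \<Longrightarrow> finite (J i)"
     "\<And>i c. i \<in> I \<Longrightarrow> c \<in> J i \<Longrightarrow> E i * uu i c = uu i c"
     "\<And>i c. i \<in> I \<Longrightarrow> c \<in> J i \<Longrightarrow> uu i c * F (i # c) = uu i c"
     "\<And>i c. i \<in> I \<Longrightarrow> c \<in> J i \<Longrightarrow> F (i # c) * vv i c = vv i c"
     "\<And>i c. i \<in> I \<Longrightarrow> c \<in> J i \<Longrightarrow> vv i c * E i = vv i c"
     "\<And>i c d. i \<in> I \<Longrightarrow> c \<in> J i \<Longrightarrow> d \<in> J i \<Longrightarrow> vv i c * uu i d = (if c = d then F (i # c) else 0)"
     "\<And>i. i \<in> I \<Longrightarrow> (\<Sum>c\<in>J i. uu i c * vv i c) = E i"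
    using p by (simp_all add: uu_def vv_def)
  let ?K = "{i # c | i c. i \<in> I \<and> c \<in> J i}"
  have K: "?K = (\<lambda>(i, c). i # c) ` (SIGMA i:I. J i)" by auto
  show ?thesis
  proof (rule decomposesI[of _ _ "\<lambda>l. u (hd l) * uu (hd l) (tl l)" _ "\<lambda>l. vv (hd l) (tl l) * v (hd l)"])
    show "finite ?K" unfolding K using D(1) DD(1) by (intro finite_imageI finite_SigmaI)
    have "(\<Sum>l\<in>?K. u (hd l) * uu (hd l) (tl l) * (vv (hd l) (tl l) * v (hd l))) =
      (\<Sum>p\<in>(SIGMA i:I. J i). u (fst p) * uu (fst p) (snd p) * (vv (fst p) (snd p) * v (fst p)))"
      unfolding K by (subst sum.reindex) (auto simp: inj_on_def split_def)
    also have "\<dots> = (\<Sum>i\<in>I. \<Sum>c\<in>J i. u i * uu i c * (vv i c * v i))"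
      using D(1) DD(1) by (subst sum.Sigma) (auto simp: split_def)
    also have "\<dots> = (\<Sum>i\<in>I. u i * (\<Sum>c\<in>J i. uu i c * vv i c) * v i)"
      by (simp add: sum_distrib_left sum_distrib_right mult.assoc)
    also have "\<dots> = (\<Sum>i\<in>I. u i * v i)" using DD(7) D(3) by (intro sum.cong) auto
    finally show "(\<Sum>l\<in>?K. u (hd l) * uu (hd l) (tl l) * (vv (hd l) (tl l) * v (hd l))) = e" using D(7) by simp
    fix l assume "l \<in> ?K"
    then obtain i c where l: "l = i # c" "i \<in> I" "c \<in> J i" by auto
    show "e * (u (hd l) * uu (hd l) (tl l)) = u (hd l) * uu (hd l) (tl l)"
      using l D(2) by (simp add: mult.assoc[symmetric])
    show "u (hd l) * uu (hd l) (tl l) * F l = u (hd l) * uu (hd l) (tl l)"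
      using l DD(3) by (simp add: mult.assoc)
    show "F l * (vv (hd l) (tl l) * v (hd l)) = vv (hd l) (tl l) * v (hd l)"
      using l DD(4) by (simp add: mult.assoc[symmetric])
    show "vv (hd l) (tl l) * v (hd l) * e = vv (hd l) (tl l) * v (hd l)"
      using l D(5) by (simp add: mult.assoc)
    fix l' assume "l' \<in> ?K"
    then obtain j d where l': "l' = j # d" "j \<in> I" "d \<in> J j" by auto
    have "vv i c * v i * (u j * uu j d) = vv i c * (v i * u j) * uu j d" by (simp add: mult.assoc)
    also have "\<dots> = (if i = j then vv i c * E i * uu j d else 0)" using D(6) l l' by simp
    also have "\<dots> = (if l = l' then F l else 0)" using l l' DD(5,6) by auto
    finally show "vv (hd l) (tl l) * v (hd l) * (u (hd l') * uu (hd l') (tl l')) = (if l = l' then F l else 0)"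
      using l l' by simp
  qed
qed

text \<open>The retraction \<open>s * r = e0\<close> splits the idempotent \<open>r * s\<close> off
  \<open>e\<close>. Its complement \<open>t\<close> satisfies \<open>s * t = 0\<close> and
  \<open>t * r = 0\<close>, so the pair \<open>r\<close>, \<open>s\<close> and the components for
  \<open>t\<close> do not interact.\<close>

lemma decomposes_insert:
  assumes I: "decomposes t I E" and i: "i \<notin> I" "E i = e0" and e: "r * s + t = e" "e * e = e"
    and r: "e * r = r" "r * e0 = r" and s: "e0 * s = s" "s * e = s" "s * r = e0"
  shows "decomposes e (insert i I) E"
proof -
  obtain u v where D: "finite I"
    "\<forall>i\<in>I. t * u i = u i" "\<forall>i\<in>I. u i * E i = u i"
    "\<forall>i\<in>I. E i * v i = v i" "\<forall>i\<in>I. v i * t = v i"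
    "\<forall>i\<in>I. \<forall>j\<in>I. v i * u j = (if i = j then E i else 0)"
    "(\<Sum>i\<in>I. u i * v i) = t" using I by (rule decomposesE)
  have t: "t = e - r * s" using e by (simp add: algebra_simps)
  have st: "s * t = 0" unfolding t by (simp add: algebra_simps s mult.assoc[symmetric])
  have tr: "t * r = 0" unfolding t by (simp add: algebra_simps s r mult.assoc)
  have et: "e * t = t" unfolding t by (simp add: algebra_simps e r mult.assoc[symmetric])
  have te: "t * e = t" unfolding t by (simp add: algebra_simps e s mult.assoc)
  have 1: "s * u j = 0" "e * u j = u j" if "j \<in> I" for j
    using D(2) that st et by (metis mult.assoc mult_zero_left)+
  have 2: "v j * r = 0" "v j * e = v j" if "j \<in> I" for j
    using D(5) that tr te by (metis mult.assoc mult_zero_right)+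
  have ne: "j \<noteq> i" if "j \<in> I" for j using i that by auto
  show ?thesis
    by (rule decomposesI[of _ _ "u(i := r)" _ "v(i := s)"])
       (use D 1 2 r s i e ne in \<open>auto simp: sum.insert[OF D(1) i(1)] cong: sum.cong\<close>)
qed

text \<open>\<open>j\<close>, \<open>ja\<close>, \<open>jb\<close> restrict rows to the closed and
  the two open strata, while \<open>j'\<close>, \<open>ja'\<close>, \<open>jb'\<close> extend by
  zero. The complement \<open>t\<close> of the lifted closed part satisfies
  \<open>t * j = 0\<close>, so its rows vanish on the closed stratum. For such rows the restrictions
  to the open strata are sections, and \<open>d\<close> reassembles the rows from them.\<close>

lemma decomposes_restriction:
  fixes e e0 e1 e2 :: "'r::ring"
  assumes idem: "e * e = e" "e0 * e0 = e0"
    and j: "e * j * e0 = e * j" "j' * (e * j) = e0"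
    and a: "e1 * ja' * e = e1 * ja'" "e2 * jb' * e = e2 * jb'"
    and b: "\<And>K. K * e = K \<Longrightarrow> K * j = 0 \<Longrightarrow> K * ja * e1 = K * ja"
      "\<And>K. K * e = K \<Longrightarrow> K * j = 0 \<Longrightarrow> K * jb * e2 = K * jb"
    and c: "e1 * ja' * ja = e1" "e2 * jb' * jb = e2" "e1 * ja' * jb = 0" "e2 * jb' * ja = 0"
      "e1 * ja' * j = 0" "e2 * jb' * j = 0"
    and d: "e * j * j' + e * ja * ja' + e * jb * jb' = e"
    and idem': "e1 * e1 = e1" "e2 * e2 = e2"
    and E: "E i0 = e0" "E i1 = e1" "E i2 = e2" "i0 \<noteq> i1" "i0 \<noteq> i2" "i1 \<noteq> i2"
  shows "decomposes e {i0, i1, i2} E"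
proof -
  define r where "r = e * j"
  \<comment> \<open>A section on the closed stratum is lifted by extending it by zero and projecting
    with \<open>e\<close>; by \<open>j' * (e * j) = e0\<close>, restriction undoes this.\<close>
  define s where "s = e0 * j' * e"
  define t where "t = e - r * s"
  have sr: "s * r = e0"
  proof -
    have "s * r = e0 * (j' * (e * e * j))" by (simp add: s_def r_def mult.assoc)
    then show ?thesis by (simp add: idem j)
  qed
  have r: "e * r = r" "r * e0 = r" by (simp_all add: r_def idem j flip: mult.assoc)
  have s: "e0 * s = s" "s * e = s" by (simp_all add: s_def idem mult.assoc) (simp_all add: idem flip: mult.assoc)
  have te: "t * e = t" unfolding t_def by (simp add: algebra_simps idem s mult.assoc)
  have et: "e * t = t" unfolding t_def by (simp add: algebra_simps idem r flip: mult.assoc)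
  have tr: "t * r = 0" unfolding t_def by (simp add: algebra_simps sr r mult.assoc)
  have tt: "t * t = t" 
  proof -
    have "t * t = t * e - t * r * s" unfolding t_def by (simp add: algebra_simps)
    then show ?thesis using te tr by simp
  qed
  have tj: "t * j = 0"
  proof -
    have "t * j = t * e * j" by (simp add: te)
    also have "\<dots> = t * r" by (simp add: r_def mult.assoc)
    finally show ?thesis by (simp add: tr)
  qed
  have f: "e1 * ja' * t = e1 * ja'" "e2 * jb' * t = e2 * jb'"
  proof -
    have "e1 * ja' * t = e1 * ja' * e - e1 * ja' * e * j * s" by (simp add: t_def r_def algebra_simps)
    then show "e1 * ja' * t = e1 * ja'" by (simp add: a c)
    have "e2 * jb' * t = e2 * jb' * e - e2 * jb' * e * j * s" by (simp add: t_def r_def algebra_simps)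
    then show "e2 * jb' * t = e2 * jb'" by (simp add: a c)
  qed
  have b1: "t * ja * e1 = t * ja" by (rule b(1)[OF te tj])
  have b2: "t * jb * e2 = t * jb" by (rule b(2)[OF te tj])
  have sum: "t * ja * ja' + t * jb * jb' = t"
  proof -
    have "t * e = t * (e * j * j' + e * ja * ja' + e * jb * jb')" by (simp add: d)
    also have "\<dots> = t * e * j * j' + t * e * ja * ja' + t * e * jb * jb'"
      by (simp add: distrib_left mult.assoc)
    finally show ?thesis by (simp add: te tj)
  qed
  have "decomposes t {i1, i2} E"
  proof (rule decomposesI[of _ _ "(\<lambda>_. 0)(i1 := t * ja, i2 := t * jb)" _ "(\<lambda>_. 0)(i1 := e1 * ja', i2 := e2 * jb')"])
    show "(\<Sum>i\<in>{i1, i2}. ((\<lambda>_. 0)(i1 := t * ja, i2 := t * jb)) i * ((\<lambda>_. 0)(i1 := e1 * ja', i2 := e2 * jb')) i) = t"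
      using E sum b1 b2 by (simp flip: mult.assoc)
    show "((\<lambda>_. 0)(i1 := e1 * ja', i2 := e2 * jb')) i * ((\<lambda>_. 0)(i1 := t * ja, i2 := t * jb)) j = (if i = j then E i else 0)"
      if "i \<in> {i1, i2}" "j \<in> {i1, i2}" for i j
      using that E f c by (auto simp flip: mult.assoc)
  qed (use E tt b1 b2 f idem' in \<open>auto simp flip: mult.assoc\<close>)
  then show ?thesis
    by (rule decomposes_insert[of t "{i1, i2}" E i0 e0 r s e])
       (use E idem r s sr in \<open>auto simp: t_def\<close>)
qed

text \<open>\<open>t * b\<close> and \<open>eB\<close> absorb each other,
  \<open>t * b * eB = t * b\<close> and \<open>eB * (t * b) = eB\<close>, so they serve as the two
  mutually inverse maps between their images; the same holds for \<open>t - t * b\<close> and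
  \<open>eW\<close>.\<close>

lemma decomposes_projection:
  fixes t eB eW b :: "'r::ring"
  assumes "t * t = t" "eB * t = eB" "eW * t = eW" "t * b * eB = t * b" "(t - t * b) * eW = t - t * b"
    "eB * b = eB" "eW * b = 0" "eB * eB = eB" "eW * eW = eW"
    and E: "E iB = eB" "E iW = eW" "iB \<noteq> iW"
  shows "decomposes t {iB, iW} E"
proof (rule decomposesI[of _ _ "(\<lambda>_. 0)(iB := t * b, iW := t - t * b)" _ "(\<lambda>_. 0)(iB := eB, iW := eW)"])
  have 1: "eB * (t * b) = eB" "eW * (t * b) = 0" using assms by (simp_all flip: mult.assoc)
  show "((\<lambda>_. 0)(iB := eB, iW := eW)) i * ((\<lambda>_. 0)(iB := t * b, iW := t - t * b)) j = (if i = j then E i else 0)"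
    if "i \<in> {iB, iW}" "j \<in> {iB, iW}" for i j
    using that E 1 assms by (auto simp: right_diff_distrib)
qed (use assms in \<open>auto simp: right_diff_distrib simp flip: mult.assoc\<close>)

section \<open>Operations on sections\<close>

lemma step_colour_le: "step (\<lambda>t. colour_le d t a)" "step (\<lambda>t. colour_le d a t)"
proof -
  show "step (\<lambda>t. colour_le d t a)" by (cases d; cases "the d") (auto intro: step_cmp)
  have "(\<lambda>t. a = t) = (\<lambda>t. t = a)" by auto
  then show "step (\<lambda>t. colour_le d a t)" by (cases d; cases "the d") (auto intro: step_cmp simp: step_cmp(5))
qed

lemma step_fubini:
  assumes "step h" "step k" "\<And>g s t. g \<in> auts {} \<Longrightarrow> P (g s) (g t) = P s t"
  shows "sint (\<lambda>s. sint (\<lambda>t. h t * of_bool (P s t) * k s)) = sint (\<lambda>t. h t * sint (\<lambda>s. of_bool (P s t) * k s))"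
proof -
  obtain S T where S: "step_on S h" and T: "step_on T k" using assms by (auto simp: step_def)
  have st: "step (\<lambda>s. of_bool (P s t) * k s)" for t
  proof (rule stepI[of "insert t T"])
    fix g s assume g: "g \<in> auts (insert t T)"
    have "g \<in> auts {}" "g \<in> auts T" using g auts_mono[of "{}" "insert t T"] auts_mono[of T "insert t T"] by auto
    then show "of_bool (P (g s) t) * k (g s) = of_bool (P s t) * k s"
      using assms(3)[of g s t] auts_fix[OF g, of t] T by (auto simp: step_on_def)
  qed (use T in \<open>auto simp: step_on_def\<close>)
  have "sint (\<lambda>s. sint (\<lambda>t. h t * of_bool (P s t) * k s)) = sint (\<lambda>t. sint (\<lambda>s. h t * of_bool (P s t) * k s))"
  proof (rule fubini2[of "S \<union> T"])
    fix g s t assume g: "g \<in> auts (S \<union> T)"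
    have "g \<in> auts {}" "g \<in> auts T" "g \<in> auts S"
      using g auts_mono[of "{}" "S \<union> T"] auts_mono[of T "S \<union> T"] auts_mono[of S "S \<union> T"] by auto
    then show "h (g t) * of_bool (P (g s) (g t)) * k (g s) = h t * of_bool (P s t) * k s"
      using assms(3)[of g s t] S T by (auto simp: step_on_def)
  qed (use S T in \<open>auto simp: step_on_def\<close>)
  then show ?thesis using sint_cmult[OF st] by (simp add: mult.assoc)
qed

lemma sint_atMost_min: "sint (\<lambda>s. of_bool (s \<le> a) * of_bool (s \<le> b)) = 0"
proof -
  have "(\<lambda>s. of_bool (s \<le> a) * of_bool (s \<le> b)) = (\<lambda>s. of_bool (s \<le> min a b) :: 'a)" by (auto simp: fun_eq_iff)
  then show ?thesis by (simp only: sint_atMost)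
qed

lemma sint_atLeast_max: "sint (\<lambda>s. of_bool (a \<le> s) * of_bool (b \<le> s)) = 1"
proof -
  have "(\<lambda>s. of_bool (a \<le> s) * of_bool (b \<le> s)) = (\<lambda>s. of_bool (max a b \<le> s) :: 'a)" by (auto simp: fun_eq_iff)
  then show ?thesis by (simp only: sint_atLeast)
qed

text \<open>After exchanging the integrals, the inner one is the volume of the closed interval from
  \<open>t\<close> to \<open>a\<close>, which is 1 or 0. Hence black integration is
  idempotent.\<close>

lemma sint_black_black:
  assumes "step h"
  shows "sint (\<lambda>s. sint (\<lambda>t. h t * of_bool (t \<le> s)) * of_bool (s \<le> a)) = sint (\<lambda>t. h t * of_bool (t \<le> a))"
proof -
  have "sint (\<lambda>s. sint (\<lambda>t. h t * of_bool (t \<le> s)) * of_bool (s \<le> a)) =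
    sint (\<lambda>s. sint (\<lambda>t. h t * of_bool (t \<le> s) * of_bool (s \<le> a)))"
    using sint_multc[OF step_times[OF assms step_of_bool[OF step_cmp(1)]]] by simp
  also have "\<dots> = sint (\<lambda>t. h t * sint (\<lambda>s. of_bool (t \<le> s) * of_bool (s \<le> a)))"
    by (rule step_fubini[OF assms step_of_bool[OF step_cmp(1)], where P = "\<lambda>s t. t \<le> s"]) (simp add: auts_le)
  finally show ?thesis by (simp add: sint_Icc[unfolded of_bool_conj])
qed

text \<open>The inner integral becomes the volume of a closed ray to plus infinity. This is 1
  wherever the ray begins, so only the total integral of \<open>h\<close> remains.\<close>

lemma sint_black_white:
  assumes "step h"
  shows "sint (\<lambda>s. sint (\<lambda>t. h t * of_bool (t \<le> s)) * of_bool (a \<le> s)) = sint h"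
proof -
  have "sint (\<lambda>s. sint (\<lambda>t. h t * of_bool (t \<le> s)) * of_bool (a \<le> s)) =
    sint (\<lambda>s. sint (\<lambda>t. h t * of_bool (t \<le> s) * of_bool (a \<le> s)))"
    using sint_multc[OF step_times[OF assms step_of_bool[OF step_cmp(1)]]] by simp
  also have "\<dots> = sint (\<lambda>t. h t * sint (\<lambda>s. of_bool (t \<le> s) * of_bool (a \<le> s)))"
    by (rule step_fubini[OF assms step_of_bool[OF step_cmp(2)], where P = "\<lambda>s t. t \<le> s"]) (simp add: auts_le)
  finally show ?thesis by (simp add: sint_atLeast_max)
qed

text \<open>The inner integral becomes the volume of a closed ray to minus infinity, which is
  0.\<close>

lemma sint_white_black:
  assumes "step h"
  shows "sint (\<lambda>s. sint (\<lambda>t. h t * of_bool (s \<le> t)) * of_bool (s \<le> a)) = 0"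
proof -
  have "sint (\<lambda>s. sint (\<lambda>t. h t * of_bool (s \<le> t)) * of_bool (s \<le> a)) =
    sint (\<lambda>s. sint (\<lambda>t. h t * of_bool (s \<le> t) * of_bool (s \<le> a)))"
    using sint_multc[OF step_times[OF assms step_of_bool[OF step_cmp(2)]]] by simp
  also have "\<dots> = sint (\<lambda>t. h t * sint (\<lambda>s. of_bool (s \<le> t) * of_bool (s \<le> a)))"
    by (rule step_fubini[OF assms step_of_bool[OF step_cmp(1)], where P = "\<lambda>s t. s \<le> t"]) (simp add: auts_le)
  finally show ?thesis by (simp add: sint_atMost_min)
qed

lemma sint_white:
  assumes "step h"
  shows "sint (\<lambda>s. sint (\<lambda>t. h t * of_bool (s \<le> t))) = 0"
proof -
  have "sint (\<lambda>s. sint (\<lambda>t. h t * of_bool (s \<le> t) * 1)) = sint (\<lambda>t. h t * sint (\<lambda>s. of_bool (s \<le> t) * 1))"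
    by (rule step_fubini[OF assms step_const, where P = "\<lambda>s t. s \<le> t"]) (simp add: auts_le)
  then show ?thesis by (simp add: sint_atMost)
qed

text \<open>For black and \<open>a \<ge> c\<close> the integral effectively stops at
  \<open>c\<close>, with value \<open>h c = 0\<close>; for white and \<open>a < c\<close> the part
  from \<open>c\<close> on, which is subtracted, integrates to \<open>h c = 0\<close>. So a section
  may be cut wherever it vanishes.\<close>

lemma sint_split_lt:
  assumes h: "step h" and H: "\<And>a. sint (\<lambda>t. h t * of_bool (colour_le (Some d) t a)) = h a" and c: "h c = 0"
  shows "sint (\<lambda>t. h t * of_bool (t < c) * of_bool (colour_le (Some d) t a)) = h a * of_bool (a < c)"
proof (cases d)
  case Black
  have H': "sint (\<lambda>t. h t * of_bool (t \<le> a)) = h a" for a using H[of a] Black by simp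
  show ?thesis
  proof (cases "a < c")
    case True
    have "(\<lambda>t. h t * of_bool (t < c) * of_bool (t \<le> a)) = (\<lambda>t. h t * of_bool (t \<le> a))"
      using True by (auto simp: fun_eq_iff of_bool_def)
    then show ?thesis using True H' Black by simp
  next
    case False
    have "(\<lambda>t. h t * of_bool (t < c) * of_bool (t \<le> a)) = (\<lambda>t. h t * of_bool (t \<le> c))"
      using False c by (auto simp: fun_eq_iff of_bool_def)
    then show ?thesis using False H' Black c by simp
  qed
next
  case White
  have H': "sint (\<lambda>t. h t * of_bool (a \<le> t)) = h a" for a using H[of a] White by simp
  show ?thesis
  proof (cases "a < c")
    case True
    have "(\<lambda>t. h t * of_bool (t < c) * of_bool (a \<le> t)) = (\<lambda>t. h t * of_bool (a \<le> t) - h t * of_bool (c \<le> t))"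
      using True by (auto simp: fun_eq_iff of_bool_def)
    then show ?thesis using True H' White c by (simp add: sint_diff h step_intros)
  next
    case False
    have "(\<lambda>t. h t * of_bool (t < c) * of_bool (a \<le> t)) = (\<lambda>t. 0)"
      using False by (auto simp: fun_eq_iff of_bool_def)
    then show ?thesis using False White by simp
  qed
qed

lemma sint_split_gt:
  assumes h: "step h" and H: "\<And>a. sint (\<lambda>t. h t * of_bool (colour_le (Some d) t a)) = h a" and c: "h c = 0"
  shows "sint (\<lambda>t. h t * of_bool (c < t) * of_bool (colour_le (Some d) t a)) = h a * of_bool (c < a)"
proof -
  have "(\<lambda>t. h t * of_bool (c < t) * of_bool (colour_le (Some d) t a)) =
    (\<lambda>t. h t * of_bool (colour_le (Some d) t a) - h t * of_bool (t < c) * of_bool (colour_le (Some d) t a))"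
    using c by (auto simp: fun_eq_iff of_bool_def not_less)
  then have "sint (\<lambda>t. h t * of_bool (c < t) * of_bool (colour_le (Some d) t a)) = h a - h a * of_bool (a < c)"
    using sint_split_lt[OF assms] H by (simp add: sint_diff h step_intros step_colour_le)
  then show ?thesis using c by (cases a c rule: linorder_cases) auto
qed

section \<open>Functions of two real variables\<close>

definition inv2_step :: "real set \<Rightarrow> (real \<Rightarrow> real \<Rightarrow> 'k) \<Rightarrow> bool" where
  "inv2_step S h \<longleftrightarrow> finite S \<and> (\<forall>g\<in>auts S. \<forall>s t. h (g s) (g t) = h s t)"

lemma inv2_step_right: "inv2_step S h \<Longrightarrow> step (h s)"
proof (rule stepI[of "insert s S"])
  fix g t assume h: "inv2_step S h" and g: "g \<in> auts (insert s S)"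
  have "g \<in> auts S" using g auts_mono[of S "insert s S"] by auto
  then have "h (g s) (g t) = h s t" using h by (simp add: inv2_step_def)
  then show "h s (g t) = h s t" using auts_fix[OF g, of s] by simp
qed (simp add: inv2_step_def)

lemma inv2_step_flip: "inv2_step S h \<Longrightarrow> inv2_step S (\<lambda>s t. h t s)"
  by (simp add: inv2_step_def)

lemma inv2_step_sint: "inv2_step S h \<Longrightarrow> step (\<lambda>s. sint (h s))"
proof (rule stepI[of S])
  fix g s assume h: "inv2_step S h" and g: "g \<in> auts S"
  have "g \<in> auts {}" using g auts_mono[of "{}" S] by auto
  from sint_auts[OF inv2_step_right[OF h] this] have "sint (h (g s)) = sint (\<lambda>t. h (g s) (g t))" by simp
  then show "sint (h (g s)) = sint (h s)" using h g by (simp add: inv2_step_def)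
qed (simp add: inv2_step_def)

lemma fubini_inv2_step: "inv2_step S h \<Longrightarrow> sint (\<lambda>s. sint (h s)) = sint (\<lambda>t. sint (\<lambda>s. h s t))"
  using fubini2[of S h] by (simp add: inv2_step_def)

text \<open>The double integral over the quadrant below \<open>(a, a)\<close> is split along the diagonal.\<close>

lemma sint_diagonal:
  fixes h :: "real \<Rightarrow> real \<Rightarrow> 'k::comm_ring_1"
  assumes h: "inv2_step S h"
    and 1: "\<And>a t. sint (\<lambda>s. h s t * of_bool (colour_le (Some d) s a)) = h a t"
    and 2: "\<And>a s. sint (\<lambda>t. h s t * of_bool (colour_le (Some d) t a)) = h s a"
  shows "sint (\<lambda>t. h t t * of_bool (colour_le (Some d) t a)) = h a a"
proof -
  let ?l = "\<lambda>s t. of_bool (colour_le (Some d) s t) :: 'k"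
  let ?D = "sint (\<lambda>t. h t t * ?l t a)"
  define A1 where "A1 s t = h s t * ?l s t * ?l t a" for s t
  define A2 where "A2 s t = h s t * ?l t s * ?l s a" for s t
  define A3 where "A3 s t = h s t * ?l t a * of_bool (t = s)" for s t
  define A0 where "A0 s t = h s t * ?l t a * ?l s a" for s t
  have inv: "h (g s) (g t) = h s t" "?l (g s) (g t) = ?l s t" "?l (g s) a = ?l s a" "g s = g t \<longleftrightarrow> s = t"
    if g: "g \<in> auts (insert a S)" for g s t
  proof -
    have "g \<in> auts S" using g auts_mono[of S "insert a S"] by auto
    then show "h (g s) (g t) = h s t" using h by (simp add: inv2_step_def)
    show "?l (g s) (g t) = ?l s t" by (simp add: colour_le_auts[OF g])
    show "?l (g s) a = ?l s a" using colour_le_auts[OF g, of "Some d" s a] auts_fix[OF g, of a] by simp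
    show "g s = g t \<longleftrightarrow> s = t" by (rule auts_eq[OF g])
  qed
  have fin: "finite (insert a S)" using h by (simp add: inv2_step_def)
  have i1: "inv2_step (insert a S) A1" and i2: "inv2_step (insert a S) A2" and i3: "inv2_step (insert a S) A3"
    using fin by (simp_all add: inv2_step_def A1_def A2_def A3_def inv)
  have i12: "inv2_step (insert a S) (\<lambda>s t. A1 s t + A2 s t)"
    using i1 i2 by (simp add: inv2_step_def)
  have st: "step (\<lambda>t. h s t * ?l t b)" "step (\<lambda>s. h s t * ?l s b)" for s t b
    using inv2_step_right[OF h] inv2_step_right[OF inv2_step_flip[OF h]]
    by (intro step_times step_of_bool step_colour_le; simp)+
  \<comment> \<open>Inclusion and exclusion: the diagonal belongs to both triangles. Each of the
    three parts integrates to \<open>?D\<close>, so the quadrant, whose integral is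
    \<open>h a a\<close>, gives \<open>?D + ?D - ?D\<close>.\<close>
  have A0: "A0 s t = A1 s t + A2 s t - A3 s t" for s t
    by (cases d) (auto simp: A0_def A1_def A2_def A3_def of_bool_def)
  have "sint (\<lambda>s. sint (A1 s)) = sint (\<lambda>t. sint (\<lambda>s. A1 s t))" by (rule fubini_inv2_step[OF i1])
  also have "\<dots> = ?D" unfolding A1_def sint_multc[OF st(2)] 1 ..
  finally have e1: "sint (\<lambda>s. sint (A1 s)) = ?D" .
  have e2: "sint (\<lambda>s. sint (A2 s)) = ?D" unfolding A2_def sint_multc[OF st(1)] 2 ..
  have e3: "sint (\<lambda>s. sint (A3 s)) = ?D" unfolding A3_def using sint_point by metis
  have "sint (\<lambda>s. sint (A0 s)) = sint (\<lambda>s. sint (A1 s) + sint (A2 s) - sint (A3 s))"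
    unfolding A0 by (simp add: sint_diff sint_add inv2_step_right[OF i1] inv2_step_right[OF i2]
      inv2_step_right[OF i3] inv2_step_right[OF i12])
  also have "\<dots> = ?D"
    by (simp add: sint_diff sint_add step_plus inv2_step_sint[OF i1] inv2_step_sint[OF i2] inv2_step_sint[OF i3] e1 e2 e3)
  finally have "sint (\<lambda>s. sint (A0 s)) = ?D" .
  moreover have "sint (\<lambda>s. sint (A0 s)) = h a a" unfolding A0_def sint_multc[OF st(1)] 2 1 ..
  ultimately show ?thesis by simp
qed

text \<open>White integration of the black integral leaves the total integral of \<open>h\<close>
  (\<open>sint_black_white\<close>), and this is the integral from \<open>a\<close> on plus the
  integral up to \<open>a\<close>, minus \<open>h a\<close> for the point counted twice.\<close>

lemma sint_white_reproduce:
  assumes h: "step h"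
  shows "sint (\<lambda>s. (h s - sint (\<lambda>t. h t * of_bool (t \<le> s))) * of_bool (a \<le> s)) =
    h a - sint (\<lambda>t. h t * of_bool (t \<le> a))"
proof -
  obtain S where S: "step_on S h" using h by (auto simp: step_def)
  have "inv2_step S (\<lambda>s t. h t * of_bool (t \<le> s))"
    unfolding inv2_step_def
  proof (intro conjI ballI allI)
    fix g s t assume g: "g \<in> auts S"
    show "h (g t) * of_bool (g t \<le> g s) = h t * of_bool (t \<le> s)"
      using S g auts_le[OF g] by (simp add: step_on_def)
  qed (use S in \<open>simp add: step_on_def\<close>)
  from inv2_step_sint[OF this] have st: "step (\<lambda>s. sint (\<lambda>t. h t * of_bool (t \<le> s)))" .
  have "sint (\<lambda>s. (h s - sint (\<lambda>t. h t * of_bool (t \<le> s))) * of_bool (a \<le> s)) =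
     sint (\<lambda>s. h s * of_bool (a \<le> s)) - sint h"
    unfolding left_diff_distrib
    by (subst sint_diff) (auto intro!: step_intros h st simp: sint_black_white[OF h])
  also have "sint h = sint (\<lambda>s. h s * of_bool (a \<le> s) + h s * of_bool (s \<le> a) - h s * of_bool (s = a))"
    by (rule arg_cong[of _ _ sint]) (auto simp: fun_eq_iff of_bool_def)
  also have "\<dots> = sint (\<lambda>s. h s * of_bool (a \<le> s)) + sint (\<lambda>s. h s * of_bool (s \<le> a)) - h a"
    by (simp add: sint_diff sint_add h step_intros sint_point)
  finally show ?thesis by simp
qed

section \<open>Reindexing coordinates\<close>

definition pull :: "nat \<Rightarrow> (nat \<Rightarrow> nat) \<Rightarrow> real list \<Rightarrow> real list" where
  "pull N \<pi> x = map (\<lambda>i. x ! \<pi> i) [0..<N]"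

lemma length_pull [simp]: "length (pull N \<pi> x) = N"
  by (simp add: pull_def)

lemma nth_pull [simp]: "i < N \<Longrightarrow> pull N \<pi> x ! i = x ! \<pi> i"
  by (simp add: pull_def)

lemma pull_map: "\<forall>i<N. \<pi> i < length x \<Longrightarrow> pull N \<pi> (map g x) = map g (pull N \<pi> x)"
  by (simp add: pull_def)

lemma pull_id: "length x = N \<Longrightarrow> pull N (\<lambda>i. i) x = x"
  by (simp add: pull_def list_eq_iff_nth_eq)

text \<open>As a right factor it composes rows with \<open>pull\<close> and cuts them off outside
  \<open>Y\<close> (\<open>entry_times_pull\<close>); where \<open>pull\<close> is injective on
  \<open>Y\<close>, the transpose transports rows along it and extends them by zero
  (\<open>entry_times_push\<close>).\<close>

definition pull_rel :: "nat \<Rightarrow> (nat \<Rightarrow> nat) \<Rightarrow> real list set \<Rightarrow> real list \<Rightarrow> real list \<Rightarrow> bool" where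
  "pull_rel N \<pi> Y y x \<longleftrightarrow> x \<in> Y \<and> y = pull N \<pi> x"

definition reindexing :: "nat \<Rightarrow> nat \<Rightarrow> (nat \<Rightarrow> nat) \<Rightarrow> real list set \<Rightarrow> bool" where
  "reindexing N q \<pi> Y \<longleftrightarrow> (\<forall>i<N. \<pi> i < q) \<and> (\<forall>x\<in>Y. length x = q) \<and> invariant_set Y"

lemma auts_map_eq: "g \<in> auts S \<Longrightarrow> map g x = map g y \<longleftrightarrow> x = y"
  using auts_inj[of g S UNIV] by (simp add: inj_map_eq_map)

lemma admissible_pull_rel:
  assumes "reindexing N q \<pi> Y"
  shows "admissible (pull_rel N \<pi> Y)" "admissible (\<lambda>x y. pull_rel N \<pi> Y y x)"
proof -
  have 1: "pull_rel N \<pi> Y (map g y) (map g x) = pull_rel N \<pi> Y y x" if g: "g \<in> auts {}" for g y x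
  proof -
    have "map g x \<in> Y \<longleftrightarrow> x \<in> Y" using assms g by (simp add: reindexing_def invariant_set_def)
    moreover have "map g y = pull N \<pi> (map g x) \<longleftrightarrow> y = pull N \<pi> x" if "x \<in> Y"
      using assms that auts_map_eq[OF g] by (subst pull_map) (auto simp: reindexing_def)
    ultimately show ?thesis by (auto simp: pull_rel_def)
  qed
  have 2: "length y \<le> max N q \<and> length x \<le> max N q" if "pull_rel N \<pi> Y y x" for y x
    using that assms by (auto simp: pull_rel_def reindexing_def)
  show "admissible (pull_rel N \<pi> Y)" by (rule admissibleI[of _ "max N q"]) (use 1 2 in auto)
  show "admissible (\<lambda>x y. pull_rel N \<pi> Y y x)" by (rule admissibleI[of _ "max N q"]) (use 1 2 in auto)
qed

lemma entry_times_pull: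
  assumes "reindexing N q \<pi> Y"
  shows "entry (K * ind (pull_rel N \<pi> Y)) z x = of_bool (x \<in> Y) * entry K z (pull N \<pi> x)"
proof -
  have "entry (K * ind (pull_rel N \<pi> Y)) z x = full_int (\<lambda>y. (of_bool (x \<in> Y) * entry K z y) * of_bool (y = pull N \<pi> x))"
    unfolding entry_times entry_ind[OF admissible_pull_rel(1)[OF assms]]
    by (rule arg_cong[of _ _ full_int]) (auto simp: pull_rel_def fun_eq_iff)
  then show ?thesis by (simp add: full_int_point)
qed

lemma entry_pull_times:
  assumes "reindexing N q \<pi> Y"
  shows "entry (ind (\<lambda>x y. pull_rel N \<pi> Y y x) * K) x z = of_bool (x \<in> Y) * entry K (pull N \<pi> x) z"
proof -
  have "entry (ind (\<lambda>x y. pull_rel N \<pi> Y y x) * K) x z = full_int (\<lambda>y. (of_bool (x \<in> Y) * entry K y z) * of_bool (y = pull N \<pi> x))"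
    unfolding entry_times entry_ind[OF admissible_pull_rel(2)[OF assms]]
    by (rule arg_cong[of _ _ full_int]) (auto simp: pull_rel_def fun_eq_iff)
  then show ?thesis by (simp add: full_int_point)
qed

lemma entry_times_push:
  assumes "reindexing N q \<pi> Y" "inj_on (pull N \<pi>) Y"
  shows "x \<in> Y \<Longrightarrow> entry (K * ind (\<lambda>x y. pull_rel N \<pi> Y y x)) z (pull N \<pi> x) = entry K z x"
    and "y \<notin> pull N \<pi> ` Y \<Longrightarrow> entry (K * ind (\<lambda>x y. pull_rel N \<pi> Y y x)) z y = 0"
proof -
  assume x: "x \<in> Y"
  have "pull_rel N \<pi> Y (pull N \<pi> x) x' \<longleftrightarrow> x' = x" for x'
    using assms(2) x by (auto simp: pull_rel_def inj_on_def)
  then show "entry (K * ind (\<lambda>x y. pull_rel N \<pi> Y y x)) z (pull N \<pi> x) = entry K z x"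
    unfolding entry_times entry_ind[OF admissible_pull_rel(2)[OF assms(1)]] by (simp add: full_int_point)
next
  assume "y \<notin> pull N \<pi> ` Y"
  then have "pull_rel N \<pi> Y y x' \<longleftrightarrow> False" for x' by (auto simp: pull_rel_def)
  then show "entry (K * ind (\<lambda>x y. pull_rel N \<pi> Y y x)) z y = 0"
    unfolding entry_times entry_ind[OF admissible_pull_rel(2)[OF assms(1)]] by (simp add: full_int_def)
qed

lemma pull_update:
  assumes "\<forall>i<N. \<pi> i < q" "j < N" "\<forall>i<N. \<pi> i = \<pi> j \<longrightarrow> i = j" "length x = q"
  shows "(pull N \<pi> x)[j := t] = pull N \<pi> (x[\<pi> j := t])"
proof (rule nth_equalityI)
  fix i assume "i < length ((pull N \<pi> x)[j := t])"
  then have i: "i < N" by simp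
  have "\<pi> j < length x" "\<pi> i = \<pi> j \<longleftrightarrow> i = j" using assms i by blast+
  then show "(pull N \<pi> x)[j := t] ! i = pull N \<pi> (x[\<pi> j := t]) ! i"
    using i by (cases "i = j") simp_all
qed simp

text \<open>Only the fibre of \<open>\<pi>\<close> through \<open>j\<close> has to be a single
  position, so this also covers the coordinates away from the collision when \<open>\<pi>\<close>
  merges two positions.\<close>

lemma semicont_pull:
  assumes f: "semicont N j d f" and "\<forall>i<N. \<pi> i < q" "j < N" "\<forall>i<N. \<pi> i = \<pi> j \<longrightarrow> i = j"
    and g: "\<And>x. length x = q \<Longrightarrow> g x = f (pull N \<pi> x)"
  shows "semicont q (\<pi> j) d g"
proof (cases d)
  case None then show ?thesis by (simp add: semicont_def)
next
  case (Some a)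
  have "sint (\<lambda>t. g (x[\<pi> j := t]) * of_bool (colour_le d t (x ! \<pi> j))) = g x" if x: "length x = q" for x
  proof -
    have "sint (\<lambda>t. f ((pull N \<pi> x)[j := t]) * of_bool (colour_le d t (pull N \<pi> x ! j))) = f (pull N \<pi> x)"
      using f Some by (simp add: semicont_def)
    then show ?thesis using pull_update[OF assms(2-4) x] g x assms(3) by simp
  qed
  then show ?thesis by (simp add: semicont_def)
qed

lemma sections_support: "sections N c X f \<Longrightarrow> x \<notin> X \<Longrightarrow> f x = 0"
  by (auto simp: sections_def)

lemma sections_semicont: "sections N c X f \<Longrightarrow> i < N \<Longrightarrow> semicont N i (c i) f"
  by (auto simp: sections_def)

lemma semicontD: "semicont N i (Some d) f \<Longrightarrow> length x = N \<Longrightarrow>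
   sint (\<lambda>t. f (x[i := t]) * of_bool (colour_le (Some d) t (x ! i))) = f x"
  by (simp add: semicont_def)

lemma semicont_line:
  assumes "semicont N i (Some d) f" "length x = N" "i < N"
  shows "sint (\<lambda>t. f (x[i := t]) * of_bool (colour_le (Some d) t a)) = f (x[i := a])"
  using semicontD[OF assms(1), of "x[i := a]"] assms(2,3) by simp

text \<open>Along coordinate \<open>p\<close> or \<open>q\<close> the line is cut where it meets the
  diagonal, and there the row vanishes; along any other coordinate the indicator is
  constant.\<close>

lemma semicont_cut:
  assumes K: "i < N" "semicont N i d (entry K z)" and p: "p < N" "q < N" "p \<noteq> q"
    and diag: "\<And>y. length y = N \<Longrightarrow> y ! p = y ! q \<Longrightarrow> entry K z y = 0"
  shows "semicont N i d (\<lambda>y. entry K z y * of_bool (y ! p < y ! q))"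
proof (cases d)
  case None then show ?thesis by (simp add: semicont_def)
next
  case (Some a)
  have "sint (\<lambda>t. entry K z (x[i := t]) * of_bool (x[i := t] ! p < x[i := t] ! q) * of_bool (colour_le d t (x ! i))) =
     entry K z x * of_bool (x ! p < x ! q)" if x: "length x = N" for x
  proof -
    have H: "sint (\<lambda>t. entry K z (x[i := t]) * of_bool (colour_le (Some a) t b)) = entry K z (x[i := b])" for b
      by (rule semicont_line) (use K Some x in auto)
    have st: "step (\<lambda>t. entry K z (x[i := t]))" using K x by (intro entry_step) auto
    consider "i = p" | "i = q" | "i \<noteq> p" "i \<noteq> q" by blast
    then show ?thesis
    proof cases
      case 1
      have "entry K z (x[i := x ! q]) = 0" using 1 p x by (intro diag) auto
      from sint_split_lt[OF st H this, of "x ! i"] show ?thesis using 1 p x Some by simp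
    next
      case 2
      have "entry K z (x[i := x ! p]) = 0" using 2 p x by (intro diag) auto
      from sint_split_gt[OF st H this, of "x ! i"] show ?thesis using 2 p x Some by simp
    next
      case 3
      then show ?thesis using H[of "x ! i"] Some by (cases "x ! p < x ! q") simp_all
    qed
  qed
  then show ?thesis by (simp add: semicont_def)
qed

text \<open>The open stratum on which coordinate \<open>p\<close> is smaller than coordinate \<open>q\<close>, with its
  coordinates permuted by \<open>\<pi>\<close>.\<close>

locale open_stratum =
  fixes N p q :: nat and \<pi> \<pi>' :: "nat \<Rightarrow> nat" and c c1 :: "nat \<Rightarrow> letter option"
    and R R1 :: "nat \<Rightarrow> nat \<Rightarrow> bool"
  assumes R: "\<forall>i j. R i j \<longrightarrow> i < j" and R1: "\<forall>i j. R1 i j \<longrightarrow> i < j"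
    and perm: "\<And>i. i < N \<Longrightarrow> \<pi> i < N \<and> \<pi>' i < N \<and> \<pi> (\<pi>' i) = i \<and> \<pi>' (\<pi> i) = i"
    and colours: "\<And>i. i < N \<Longrightarrow> c1 (\<pi> i) = c i"
    and pq: "p < N" "q < N" "p \<noteq> q"
    and conf1: "\<And>x. length x = N \<Longrightarrow> x \<in> conf N R1 \<longleftrightarrow> pull N \<pi> x \<in> conf N R \<and> x ! \<pi> p < x ! \<pi> q"
begin

abbreviation "e \<equiv> conf_idem N c R"
abbreviation "e1 \<equiv> conf_idem N c1 R1"
abbreviation "Y \<equiv> conf N R1"
abbreviation "j1 \<equiv> ind (pull_rel N \<pi> Y)"
abbreviation "j1' \<equiv> ind (\<lambda>x y. pull_rel N \<pi> Y y x)"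

lemma reindexing: "reindexing N N \<pi> Y"
  using perm by (simp add: reindexing_def conf_length invariant_conf)

lemma pull_inverse: "length x = N \<Longrightarrow> pull N \<pi>' (pull N \<pi> x) = x" "length x = N \<Longrightarrow> pull N \<pi> (pull N \<pi>' x) = x"
  using perm by (auto simp: list_eq_iff_nth_eq)

lemma inj: "inj_on (pull N \<pi>) Y"
  by (rule inj_on_inverseI[of _ "pull N \<pi>'"]) (simp add: pull_inverse conf_length)

lemma image: "pull N \<pi> ` Y = {y \<in> conf N R. y ! p < y ! q}"
proof (intro equalityI subsetI)
  fix y assume "y \<in> pull N \<pi> ` Y"
  then obtain x where x: "x \<in> Y" "y = pull N \<pi> x" by auto
  have "length x = N" using x(1) by (rule conf_length)
  then show "y \<in> {y \<in> conf N R. y ! p < y ! q}" using conf1 pq x by simp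
next
  fix y assume y: "y \<in> {y \<in> conf N R. y ! p < y ! q}"
  then have len: "length y = N" by (auto dest: conf_length)
  have "pull N \<pi>' y \<in> Y" using conf1[of "pull N \<pi>' y"] pull_inverse(2)[OF len] y pq perm len by simp
  then show "y \<in> pull N \<pi> ` Y" using pull_inverse(2)[OF len] by (metis image_eqI)
qed

lemma push_support: "entry (K * j1') z y \<noteq> 0 \<Longrightarrow> y \<in> conf N R \<and> y ! p < y ! q"
  using entry_times_push(2)[OF reindexing inj, of y K z] image by blast

lemma push_pull: "entry (K * j1 * j1') z y = entry K z y * of_bool (y \<in> conf N R \<and> y ! p < y ! q)"
proof (cases "y \<in> pull N \<pi> ` Y")
  case True
  then obtain x where "x \<in> Y" "y = pull N \<pi> x" by auto
  then show ?thesis using entry_times_push(1)[OF reindexing inj, of x "K * j1" z] True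
    unfolding image by (simp add: entry_times_pull[OF reindexing])
next
  case False
  then show ?thesis using entry_times_push(2)[OF reindexing inj False, of "K * j1" z] unfolding image by auto
qed

lemma pull_push: "e1 * j1' * j1 = (e1 :: 'k::comm_ring_1 kern)"
proof (rule kern_eqI)
  fix z x
  show "entry (e1 * j1' * j1) z x = (entry e1 z x :: 'k)"
    unfolding entry_times_pull[OF reindexing]
    using entry_times_push(1)[OF reindexing inj, of x e1 z]
    by (cases "x \<in> Y") (auto simp: entry_conf_idem conf_rel_def)
qed

text \<open>Semicontinuity is demanded on all lists of length \<open>N\<close> and not just on the
  stratum, so extension by zero preserves it; only the support and the renumbering of coordinates
  have to be followed.\<close>

lemma push_sections: "e1 * j1' * e = (e1 * j1' :: 'k::comm_ring_1 kern)"
  unfolding times_conf_idem_iff[OF R]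
proof
  fix z
  let ?f = "entry (e1 :: 'k kern) z" and ?g = "entry (e1 * j1' :: 'k kern) z"
  have f: "sections N c1 Y ?f" by (rule sections_conf_idem) (use R1 in blast)
  have g: "?g y = ?f (pull N \<pi>' y)" if y: "length y = N" for y
  proof (cases "pull N \<pi>' y \<in> Y")
    case True
    then show ?thesis using entry_times_push(1)[OF reindexing inj, of "pull N \<pi>' y" e1 z]
      by (simp add: pull_inverse y)
  next
    case False
    then have "y \<notin> pull N \<pi> ` Y" using pull_inverse(1) conf_length by auto
    then show ?thesis using entry_times_push(2)[OF reindexing inj, of y e1 z] sections_support[OF f False] by simp
  qed
  show "sections N c (conf N R) ?g"
    unfolding sections_def
  proof (intro conjI allI impI)
    fix y assume "?g y \<noteq> 0" then show "y \<in> conf N R" using push_support by blast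
  next
    fix i assume i: "i < N"
    have "semicont N (\<pi>' (\<pi> i)) (c1 (\<pi> i)) ?g"
    proof (rule semicont_pull[where f = ?f and \<pi> = \<pi>' and j = "\<pi> i" and N = N])
      show "semicont N (\<pi> i) (c1 (\<pi> i)) ?f" using perm[OF i] by (intro sections_semicont[OF f]) simp
      show "\<forall>j<N. \<pi>' j = \<pi>' (\<pi> i) \<longrightarrow> j = \<pi> i" using perm i by metis
    qed (use perm i g in auto)
    then show "semicont N i (c i) ?g" using perm colours i by simp
  qed
qed

text \<open>Restriction multiplies the rows by the indicator of \<open>y ! p < y ! q\<close>.
  Vanishing on the diagonal makes this compatible with semicontinuity
  (\<open>semicont_cut\<close>).\<close>

lemma restrict_sections:
  fixes K :: "'k::comm_ring_1 kern"
  assumes K: "K * e = K" and diag: "\<And>z y. length y = N \<Longrightarrow> y ! p = y ! q \<Longrightarrow> entry K z y = 0"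
  shows "K * j1 * e1 = K * j1"
  unfolding times_conf_idem_iff[OF R1]
proof
  fix z
  have f: "sections N c (conf N R) (entry K z)" using K times_conf_idem_iff[OF R] by blast
  let ?f = "\<lambda>y. entry K z y * of_bool (y ! p < y ! q)" and ?g = "entry (K * j1) z"
  have g: "?g x = ?f (pull N \<pi> x)" if x: "length x = N" for x
    using conf1[OF x] pq sections_support[OF f, of "pull N \<pi> x"]
    by (auto simp: entry_times_pull[OF reindexing] of_bool_def)
  show "sections N c1 Y ?g"
    unfolding sections_def
  proof (intro conjI allI impI)
    fix x assume "?g x \<noteq> 0" then show "x \<in> Y" by (auto simp: entry_times_pull[OF reindexing] of_bool_def split: if_splits)
  next
    fix i assume i: "i < N"
    have "semicont N (\<pi> (\<pi>' i)) (c (\<pi>' i)) ?g"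
    proof (rule semicont_pull[where f = ?f and \<pi> = \<pi> and j = "\<pi>' i" and N = N])
      show "semicont N (\<pi>' i) (c (\<pi>' i)) ?f"
        using perm[OF i] sections_semicont[OF f] pq diag by (intro semicont_cut) auto
      show "\<forall>j<N. \<pi> j = \<pi> (\<pi>' i) \<longrightarrow> j = \<pi>' i" using perm i by metis
    qed (use perm i g in auto)
    then show "semicont N i (c1 i) ?g" using perm[OF i] colours[of "\<pi>' i"] by simp
  qed
qed

end

lemma entry_inv2_step:
  assumes "i < length x" "j < length x"
  shows "inv2_step (set z \<union> set x) (\<lambda>s t. entry K z (x[i := s, j := t]))"
  unfolding inv2_step_def
proof (intro conjI ballI allI)
  fix g s t assume g: "g \<in> auts (set z \<union> set x)"
  have "g \<in> auts {}" using g auts_mono[of "{}" "set z \<union> set x"] by auto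
  moreover have "map g z = z" "map g x = x" using g by (auto simp: auts_fix intro!: map_idI)
  ultimately show "entry K z (x[i := g s, j := g t]) = entry K z (x[i := s, j := t])"
    using entry_map[of g K z "x[i := s, j := t]"] by (simp add: map_update)
qed auto

section \<open>Integrating out a neutral coordinate\<close>

lemma entry_times_black:
  assumes "k < N" "length x = N"
  shows "entry (K * ind (coord_rel N k (Some Black) UNIV)) z x = sint (\<lambda>t. entry K z (x[k := t]) * of_bool (t \<le> x ! k))"
  using entry_times_coord[OF assms(1), of UNIV x K "Some Black" z] assms by (simp add: invariant_set_def)

lemma entry_times_black_length:
  assumes "k < N" "length x \<noteq> N"
  shows "entry (K * ind (coord_rel N k (Some Black) UNIV)) z x = 0"
  by (rule entry_times_support)
     (use assms in \<open>simp add: entry_ind[OF admissible_coord_rel[OF assms(1)]] coord_rel_def invariant_set_def\<close>)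

context
  fixes N k :: nat and c :: "nat \<Rightarrow> letter option" and R :: "nat \<Rightarrow> nat \<Rightarrow> bool" and K :: "'k::comm_ring_1 kern"
  assumes irr: "\<And>j. \<not> R j j" and k: "k < N" "c k = None"
    and K: "\<And>z. sections N c (conf N R) (entry K z)"
    and integral: "\<forall>q<N. R k q \<longrightarrow> (\<forall>z x. length x = N \<longrightarrow> sint (\<lambda>t. entry K z (x[k := t])) = 0)"
begin

private abbreviation "b \<equiv> ind (coord_rel N k (Some Black) UNIV)"

lemma step_line: "length x = N \<Longrightarrow> step (\<lambda>t. entry K z (x[k := t]))"
  using k by (intro entry_step) simp

text \<open>Integration up to \<open>x ! k\<close> can enlarge the support only upwards. Beyond the
  bound set by a following coordinate it returns the total integral over coordinate
  \<open>k\<close>, which is zero by \<open>integral\<close>; if nothing follows, there is no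
  bound.\<close>

lemma times_black_support:
  assumes nz: "entry (K * b) z x \<noteq> 0"
  shows "x \<in> conf N R"
proof -
  have x: "length x = N" using nz entry_times_black_length[OF k(1)] by metis
  have nz': "sint (\<lambda>t. entry K z (x[k := t]) * of_bool (t \<le> x ! k)) \<noteq> 0" using nz entry_times_black[OF k(1) x] by metis
  then obtain t where t: "entry K z (x[k := t]) \<noteq> 0" "t \<le> x ! k"
  proof -
    assume A: "\<And>t. entry K z (x[k := t]) \<noteq> 0 \<Longrightarrow> t \<le> x ! k \<Longrightarrow> thesis"
    have "(\<lambda>t. entry K z (x[k := t]) * of_bool (t \<le> x ! k)) \<noteq> (\<lambda>t. 0)" using nz' by fastforce
    then obtain t where "entry K z (x[k := t]) * of_bool (t \<le> x ! k) \<noteq> 0" by blast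
    then show thesis by (intro A[of t]) (auto simp: of_bool_def split: if_splits)
  qed
  have upd: "x[k := s] ! i = (if i = k then s else x ! i)" if "i < N" for s i using that x by simp
  have conf: "x[k := s] \<in> conf N R" if "entry K z (x[k := s]) \<noteq> 0" for s
    using that K[of z] by (auto simp: sections_def)
  have o: "x[k := s] ! i < x[k := s] ! j" if "entry K z (x[k := s]) \<noteq> 0" "i < N" "j < N" "R i j" for s i j
    using conf_less[OF conf[OF that(1)] that(2-4)] .
  have "x ! i < x ! j" if ij: "i < N" "j < N" "R i j" for i j
  proof -
    have "i \<noteq> k \<or> j \<noteq> k" using irr ij by auto
    then consider "i \<noteq> k" "j \<noteq> k" | "i \<noteq> k" "j = k" | "i = k" "j \<noteq> k" by blast
    then show ?thesis
    proof cases
      case 1 then show ?thesis using o[OF t(1) ij] upd ij by simp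
    next
      case 2 then show ?thesis using o[OF t(1) ij] upd ij t(2) by simp
    next
      case 3
      show ?thesis
      proof (rule ccontr)
        assume "\<not> ?thesis"
        then have "s \<le> x ! k" if "entry K z (x[k := s]) \<noteq> 0" for s
          using o[OF that ij] upd ij 3 by simp
        then have "(\<lambda>t. entry K z (x[k := t]) * of_bool (t \<le> x ! k)) = (\<lambda>t. entry K z (x[k := t]))"
          by (auto simp: fun_eq_iff of_bool_def)
        then show False using nz' integral ij 3 x by simp
      qed
    qed
  qed
  then show ?thesis using x by (simp add: conf_def)
qed

text \<open>The condition in coordinate \<open>j\<close> and the integration in coordinate
  \<open>k\<close> concern different variables and commute by Fubini.\<close>

lemma times_black_semicont:
  assumes j: "j < N" "j \<noteq> k"
  shows "semicont N j (c j) (entry (K * b) z)"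
proof (cases "c j")
  case None then show ?thesis by (simp add: semicont_def)
next
  case (Some d)
  have "sint (\<lambda>s. entry (K * b) z (x[j := s]) * of_bool (colour_le (Some d) s (x ! j))) = entry (K * b) z x"
    if x: "length x = N" for x
  proof -
    let ?b = "\<lambda>s. of_bool (colour_le (Some d) s (x ! j)) :: 'k"
    let ?F = "\<lambda>s t. entry K z (x[j := s, k := t])"
    have F: "inv2_step (set z \<union> set x) ?F" by (rule entry_inv2_step) (use j k x in auto)
    have G: "inv2_step (set z \<union> set x) (\<lambda>s t. ?F s t * of_bool (t \<le> x ! k) * ?b s)"
      unfolding inv2_step_def
    proof (intro conjI ballI allI)
      fix g s t assume g: "g \<in> auts (set z \<union> set x)"
      have mem: "x ! j \<in> set z \<union> set x" "x ! k \<in> set z \<union> set x" using j k x by auto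
      have "?b (g s) = ?b s" using colour_le_auts[OF g, of "Some d" s "x ! j"] auts_fix[OF g mem(1)] by simp
      moreover have "?F (g s) (g t) = ?F s t" using F g by (simp add: inv2_step_def)
      ultimately show "?F (g s) (g t) * of_bool (g t \<le> x ! k) * ?b (g s) = ?F s t * of_bool (t \<le> x ! k) * ?b s"
        using auts_cmp_fix(3)[OF g mem(2)] by simp
    qed simp
    have stF: "step (\<lambda>t. ?F s t * of_bool (t \<le> x ! k))" for s
      by (intro step_times inv2_step_right[OF F] step_of_bool step_cmp)
    have stF2: "step (\<lambda>s. ?F s t * ?b s)" for t
      by (intro step_times inv2_step_right[OF inv2_step_flip[OF F]] step_of_bool step_colour_le)
    have "sint (\<lambda>s. entry (K * b) z (x[j := s]) * ?b s) = sint (\<lambda>s. sint (\<lambda>t. ?F s t * of_bool (t \<le> x ! k) * ?b s))"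
      using x j k by (simp add: entry_times_black sint_multc[OF stF])
    also have "\<dots> = sint (\<lambda>t. sint (\<lambda>s. ?F s t * of_bool (t \<le> x ! k) * ?b s))"
      by (rule fubini_inv2_step[OF G])
    also have "\<dots> = sint (\<lambda>t. sint (\<lambda>s. ?F s t * ?b s) * of_bool (t \<le> x ! k))"
      unfolding sint_multc[OF stF2, symmetric] by (simp add: mult.assoc mult.commute mult.left_commute)
    also have "\<dots> = sint (\<lambda>t. entry K z (x[k := t]) * of_bool (t \<le> x ! k))"
    proof -
      have "sint (\<lambda>s. ?F s t * ?b s) = entry K z (x[k := t])" for t
      proof -
        have "semicont N j (Some d) (entry K z)" using sections_semicont[OF K j(1)] Some by simp
        from semicontD[OF this, of "x[k := t]"] show ?thesis
          using x j by (simp add: list_update_swap)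
      qed
      then show ?thesis by simp
    qed
    finally show ?thesis using x k by (simp add: entry_times_black)
  qed
  then show ?thesis using Some by (simp add: semicont_def)
qed

lemma sections_black: "sections N (c(k := Some Black)) (conf N R) (entry (K * b) z)"
  unfolding sections_def
proof (intro conjI allI impI)
  show "semicont N i ((c(k := Some Black)) i) (entry (K * b) z)" if i: "i < N" for i
  proof (cases "i = k")
    case True
    have "sint (\<lambda>s. entry (K * b) z (x[k := s]) * of_bool (s \<le> x ! k)) = entry (K * b) z x" if x: "length x = N" for x
      using sint_black_black[OF step_line[OF x], of z "x ! k"] k x by (simp add: entry_times_black)
    then show ?thesis using True by (simp add: semicont_def)
  next
    case False then show ?thesis using times_black_semicont[OF i False] by simp
  qed
qed (rule times_black_support)

lemma sections_white: "sections N (c(k := Some White)) (conf N R) (entry (K - K * b) z)"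
  unfolding sections_def
proof (intro conjI allI impI)
  fix x assume "entry (K - K * b) z x \<noteq> 0"
  then have "entry K z x \<noteq> 0 \<or> entry (K * b) z x \<noteq> 0" by (auto simp: entry_minus)
  then show "x \<in> conf N R" using times_black_support K[of z] by (auto simp: sections_def)
next
  fix i assume i: "i < N"
  show "semicont N i ((c(k := Some White)) i) (entry (K - K * b) z)"
  proof (cases "i = k")
    case True
    have "sint (\<lambda>s. entry (K - K * b) z (x[k := s]) * of_bool (x ! k \<le> s)) = entry (K - K * b) z x" if x: "length x = N" for x
      using sint_white_reproduce[OF step_line[OF x], of z "x ! k"] k x by (simp add: entry_times_black entry_minus)
    then show ?thesis using True by (simp add: semicont_def)
  next
    case False
    show ?thesis
    proof (cases "c i")
      case None then show ?thesis using False by (simp add: semicont_def)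
    next
      case (Some d)
      have s: "semicont N i (Some d) (entry K z)" "semicont N i (Some d) (entry (K * b) z)"
        using sections_semicont[OF K i] times_black_semicont[OF i False] Some by simp_all
      have "sint (\<lambda>t. entry (K - K * b) z (x[i := t]) * of_bool (colour_le (Some d) t (x ! i))) = entry (K - K * b) z x"
        if x: "length x = N" for x
      proof -
        have st: "step (\<lambda>t. entry L z (x[i := t]) * of_bool (colour_le (Some d) t (x ! i)))" for L :: "'k kern"
          using i x by (intro step_times entry_step step_of_bool step_colour_le) simp
        show ?thesis
          unfolding entry_minus left_diff_distrib
          by (subst sint_diff[OF st st]) (simp add: semicontD[OF s(1) x] semicontD[OF s(2) x])
      qed
      then show ?thesis using Some False by (simp add: semicont_def)
    qed
  qed
qed

end

lemma black_times_black:
  assumes "k < N" "c k = Some Black" "\<And>z. sections N c (conf N R) (entry K z)"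
  shows "K * ind (coord_rel N k (Some Black) UNIV) = K"
proof (rule kern_eqI)
  fix z x
  show "entry (K * ind (coord_rel N k (Some Black) UNIV)) z x = entry K z x"
  proof (cases "length x = N")
    case True
    have "semicont N k (Some Black) (entry K z)" using sections_semicont[OF assms(3,1)] assms(2) by simp
    from semicontD[OF this True] show ?thesis using entry_times_black[OF assms(1) True, of K z] by simp
  next
    case False
    then have "x \<notin> conf N R" using conf_length by blast
    then show ?thesis using entry_times_black_length[OF assms(1) False, of K z] sections_support[OF assms(3)] by simp
  qed
qed

lemma white_line:
  assumes "k < N" "c k = Some White" "\<And>z. sections N c (conf N R) (entry K z)" "length x = N"
  shows "entry K z (x[k := s]) = sint (\<lambda>t. entry K z (x[k := t]) * of_bool (s \<le> t))"
proof -
  have "semicont N k (Some White) (entry K z)" using sections_semicont[OF assms(3,1)] assms(2) by simp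
  from semicont_line[OF this assms(4,1), of s] show ?thesis by simp
qed

text \<open>In coordinate \<open>k\<close> a white row is an integral of indicators of rays to minus
  infinity, and black integration kills these (\<open>sint_white_black\<close>).\<close>

lemma white_times_black:
  assumes "k < N" "c k = Some White" "\<And>z. sections N c (conf N R) (entry K z)"
  shows "K * ind (coord_rel N k (Some Black) UNIV) = 0"
proof (rule kern_eqI)
  fix z x
  show "entry (K * ind (coord_rel N k (Some Black) UNIV)) z x = entry 0 z x"
  proof (cases "length x = N")
    case True
    have "(\<lambda>s. entry K z (x[k := s]) * of_bool (s \<le> x ! k)) =
      (\<lambda>s. sint (\<lambda>t. entry K z (x[k := t]) * of_bool (s \<le> t)) * of_bool (s \<le> x ! k))"
      by (intro ext arg_cong2[of _ _ _ _ "(*)"] refl white_line[where R = R, OF assms True])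
    moreover have "sint (\<lambda>s. sint (\<lambda>t. entry K z (x[k := t]) * of_bool (s \<le> t)) * of_bool (s \<le> x ! k)) = 0"
      by (rule sint_white_black) (use assms(1) True in \<open>auto intro: entry_step\<close>)
    ultimately have "sint (\<lambda>s. entry K z (x[k := s]) * of_bool (s \<le> x ! k)) = 0" by (simp only:)
    then show ?thesis using entry_times_black[OF assms(1) True, of K z] by (simp add: zero_kern.rep_eq)
  next
    case False
    then show ?thesis using entry_times_black_length[OF assms(1) False, of K z] by (simp add: zero_kern.rep_eq)
  qed
qed

text \<open>At the bound \<open>x ! q\<close> the black integral has already collected everything,
  and the row vanishes there.\<close>

lemma black_integral:
  assumes "k < N" "c k = Some Black" "\<And>z. sections N c (conf N R) (entry K z)" "length x = N"
    and q: "q < N" "R k q" "q \<noteq> k"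
  shows "sint (\<lambda>t. entry K z (x[k := t])) = 0"
proof -
  have "semicont N k (Some Black) (entry K z)" using sections_semicont[OF assms(3,1)] assms(2) by simp
  from semicont_line[OF this assms(4,1), of "x ! q"]
  have "sint (\<lambda>t. entry K z (x[k := t]) * of_bool (t \<le> x ! q)) = entry K z (x[k := x ! q])" by simp
  moreover have conf: "t < x ! q" if "entry K z (x[k := t]) \<noteq> 0" for t
  proof -
    have "x[k := t] \<in> conf N R" using that assms(3)[of z] by (auto simp: sections_def)
    from conf_less[OF this assms(1) q(1,2)] show ?thesis using assms(1,4) q by simp
  qed
  moreover have "(\<lambda>t. entry K z (x[k := t]) * of_bool (t \<le> x ! q)) = (\<lambda>t. entry K z (x[k := t]))"
    using conf by (auto simp: fun_eq_iff of_bool_def intro: less_imp_le)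
  moreover have "entry K z (x[k := x ! q]) = 0" using conf[of "x ! q"] by auto
  ultimately show ?thesis by simp
qed

lemma white_integral:
  assumes "k < N" "c k = Some White" "\<And>z. sections N c (conf N R) (entry K z)" "length x = N"
  shows "sint (\<lambda>t. entry K z (x[k := t])) = 0"
proof -
  have "(\<lambda>s. entry K z (x[k := s])) = (\<lambda>s. sint (\<lambda>t. entry K z (x[k := t]) * of_bool (s \<le> t)))"
    by (intro ext white_line[where R = R, OF assms])
  moreover have "sint (\<lambda>s. sint (\<lambda>t. entry K z (x[k := t]) * of_bool (s \<le> t))) = 0"
    by (rule sint_white) (use assms in \<open>auto intro: entry_step\<close>)
  ultimately show ?thesis by (simp only:)
qed

section \<open>Integration along the fibres of the deletion of a coordinate\<close>

definition delete_rel :: "nat \<Rightarrow> nat \<Rightarrow> real list set \<Rightarrow> real list \<Rightarrow> real list \<Rightarrow> bool" where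
  "delete_rel N k X y x \<longleftrightarrow> y \<in> X \<and> length y = N \<and> x = remove_nth k y"

lemma admissible_delete_rel:
  assumes "k < N" "invariant_set X"
  shows "admissible (delete_rel N k X)" "admissible (\<lambda>x y. delete_rel N k X y x)"
proof -
  have 1: "delete_rel N k X (map g y) (map g x) = delete_rel N k X y x" if g: "g \<in> auts {}" for g y x
    using assms(2) g auts_map_eq[OF g] by (auto simp: delete_rel_def remove_nth_map invariant_set_def)
  have 2: "length y \<le> N \<and> length x \<le> N" if "delete_rel N k X y x" for y x
    using that assms(1) by (auto simp: delete_rel_def remove_nth_def)
  show "admissible (delete_rel N k X)" "admissible (\<lambda>x y. delete_rel N k X y x)"
    by (rule admissibleI[of _ N]; use 1 2 in auto)+
qed

lemma entry_times_delete:
  assumes "k < N" "invariant_set X" "Suc (length x) = N"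
  shows "entry (K * ind (delete_rel N k X)) z x = sint (\<lambda>t. entry K z (insert_nth k t x) * of_bool (insert_nth k t x \<in> X))"
proof -
  have "entry (K * ind (delete_rel N k X)) z x =
    full_int (\<lambda>y. (entry K z y * of_bool (y \<in> X)) * of_bool (length y = N \<and> remove_nth k y = x))"
    unfolding entry_times entry_ind[OF admissible_delete_rel(1)[OF assms(1,2)]]
    by (intro arg_cong[of _ _ full_int]) (auto simp: delete_rel_def fun_eq_iff of_bool_def)
  then show ?thesis by (simp only: full_int_fibre[OF assms(1,3)])
qed

lemma entry_times_delete_length:
  assumes "k < N" "invariant_set X" "Suc (length x) \<noteq> N"
  shows "entry (K * ind (delete_rel N k X)) z x = 0"
  by (rule entry_times_support)
     (use assms in \<open>auto simp: entry_ind[OF admissible_delete_rel(1)[OF assms(1,2)]] delete_rel_def length_remove_nth\<close>)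

lemma entry_delete_times:
  assumes "k < N" "invariant_set X" "Suc (length x) = N"
  shows "entry (ind (\<lambda>x y. delete_rel N k X y x) * K) x z =
    sint (\<lambda>t. entry K (insert_nth k t x) z * of_bool (insert_nth k t x \<in> X))"
proof -
  have "entry (ind (\<lambda>x y. delete_rel N k X y x) * K) x z =
    full_int (\<lambda>y. (entry K y z * of_bool (y \<in> X)) * of_bool (length y = N \<and> remove_nth k y = x))"
    unfolding entry_times entry_ind[OF admissible_delete_rel(2)[OF assms(1,2)]]
    by (intro arg_cong[of _ _ full_int]) (auto simp: delete_rel_def fun_eq_iff of_bool_def)
  then show ?thesis by (simp only: full_int_fibre[OF assms(1,3)])
qed

lemma entry_delete_times_length:
  assumes "k < N" "invariant_set X" "Suc (length x) \<noteq> N"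
  shows "entry (ind (\<lambda>x y. delete_rel N k X y x) * K) x z = 0"
proof -
  have "entry (ind (\<lambda>x y. delete_rel N k X y x)) x y = (0::'a)" for y
    unfolding entry_ind[OF admissible_delete_rel(2)[OF assms(1,2)]]
    using assms by (auto simp: delete_rel_def length_remove_nth)
  then show ?thesis by (simp add: entry_times full_int_def)
qed

lemma length_insert_nth [simp]: "length (insert_nth k t x) = Suc (length x)"
  by (simp add: insert_nth_def)

lemma nth_insert_nth:
  "k \<le> length x \<Longrightarrow> i \<le> length x \<Longrightarrow> insert_nth k t x ! i = (if i < k then x ! i else if i = k then t else x ! (i - 1))"
  by (auto simp: insert_nth_def nth_append min_def nth_Cons')

definition skip :: "nat \<Rightarrow> nat \<Rightarrow> nat" where
  "skip k i = (if i < k then i else Suc i)"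

lemma nth_insert_skip: "k \<le> length x \<Longrightarrow> i < length x \<Longrightarrow> insert_nth k t x ! skip k i = x ! i"
  by (simp add: nth_insert_nth skip_def)

lemma skip_cases: "j < Suc n \<Longrightarrow> k \<le> n \<Longrightarrow> j = k \<or> (\<exists>i<n. j = skip k i)"
proof -
  assume j: "j < Suc n" "k \<le> n"
  consider "j < k" | "j = k" | "k < j" by linarith
  then show ?thesis
  proof cases
    case 1 then show ?thesis using j by (intro disjI2 exI[of _ j]) (simp add: skip_def)
  next
    case 3 then show ?thesis using j by (intro disjI2 exI[of _ "j - 1"]) (auto simp: skip_def)
  qed simp
qed

lemma insert_nth_update: "k \<le> length x \<Longrightarrow> i < length x \<Longrightarrow> (insert_nth k t x)[skip k i := s] = insert_nth k t (x[i := s])"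
  by (rule nth_equalityI) (auto simp: nth_insert_nth skip_def nth_list_update)

lemma all_skip: "k \<le> n \<Longrightarrow> (\<forall>i<Suc n. P i) \<longleftrightarrow> P k \<and> (\<forall>i<n. P (skip k i))"
proof
  assume k: "k \<le> n" and P: "\<forall>i<Suc n. P i"
  have "skip k i < Suc n" if "i < n" for i using that by (simp add: skip_def)
  then show "P k \<and> (\<forall>i<n. P (skip k i))" using k P by auto
next
  assume k: "k \<le> n" and P: "P k \<and> (\<forall>i<n. P (skip k i))"
  show "\<forall>i<Suc n. P i"
  proof (intro allI impI)
    fix i assume "i < Suc n"
    from skip_cases[OF this k] show "P i" using P by auto
  qed
qed

lemma nth_insert_same: "k \<le> length x \<Longrightarrow> insert_nth k t x ! k = t"
  by (simp add: nth_insert_nth)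

lemma set_insert_nth: "set (insert_nth k t x) = insert t (set x)"
proof -
  have "set x = set (take k x) \<union> set (drop k x)" by (metis append_take_drop_id set_append)
  then show ?thesis by (auto simp: insert_nth_def)
qed

text \<open>An open interval bounded above has volume -1 with or without a lower bound: 0 - 1 for a
  ray to minus infinity without its end, 1 - 1 - 1 for a closed interval without its two ends.
  Without an upper bound the volume would be 0, so \<open>B \<noteq> {}\<close> is
  essential.\<close>

lemma sint_gap:
  assumes "finite A" "finite B" "B \<noteq> {}" "\<And>a b. a \<in> A \<Longrightarrow> b \<in> B \<Longrightarrow> a < b"
  shows "sint (\<lambda>t. of_bool ((\<forall>a\<in>A. a < t) \<and> (\<forall>b\<in>B. t < b))) = (- 1 :: 'k::comm_ring_1)"
proof -
  define u where "u = Min B"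
  have u: "u \<in> B" "\<And>t. (\<forall>b\<in>B. t < b) \<longleftrightarrow> t < u"
    using assms by (simp_all add: u_def)
  have pt: "sint (\<lambda>t. of_bool (t = a)) = (1 :: 'k)" for a using sint_point[of "\<lambda>_. 1" a] by simp
  show ?thesis
  proof (cases "A = {}")
    case True
    have "(\<lambda>t. of_bool (t < u)) = (\<lambda>t. of_bool (t \<le> u) - of_bool (t = u) :: 'k)"
      by (auto simp: fun_eq_iff of_bool_def)
    then show ?thesis unfolding u(2) using True
      by (simp add: sint_diff step_intros sint_atMost pt)
  next
    case False
    define l where "l = Max A"
    have l: "l \<in> A" "\<And>t. (\<forall>a\<in>A. a < t) \<longleftrightarrow> l < t" using assms(1) False by (simp_all add: l_def)
    have lu: "l < u" using assms(4) l u by blast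
    have "(\<lambda>t. of_bool (l < t \<and> t < u)) = (\<lambda>t. of_bool (l \<le> t \<and> t \<le> u) - of_bool (t = l) - of_bool (t = u) :: 'k)"
      using lu by (auto simp: fun_eq_iff of_bool_def)
    moreover have "sint (\<lambda>t. of_bool (l \<le> t \<and> t \<le> u) - of_bool (t = l) - of_bool (t = u)) = (1 - 1 - 1 :: 'k)"
      using lu by (subst sint_diff; (subst sint_diff)?) (auto simp: sint_Icc[unfolded of_bool_conj] pt of_bool_conj intro!: step_intros)
    ultimately show ?thesis unfolding u(2) l(2) by simp
  qed
qed

text \<open>Position \<open>k\<close> is comparable to every other position. Hence the fibre of its
  deletion is an open interval between the coordinates before and those after it, and
  \<open>across\<close> keeps these two groups apart once \<open>k\<close> is gone.\<close>

locale neutral_coordinate =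
  fixes n k :: nat and c c' :: "nat \<Rightarrow> letter option" and R R' :: "nat \<Rightarrow> nat \<Rightarrow> bool"
  assumes k: "k \<le> n" and ck: "c k = None" and c': "\<And>i. i < n \<Longrightarrow> c' i = c (skip k i)"
    and R: "\<forall>i j. R i j \<longrightarrow> i < j" and R': "\<forall>i j. R' i j \<longrightarrow> i < j"
    and R_skip: "\<And>i j. i < n \<Longrightarrow> j < n \<Longrightarrow> R (skip k i) (skip k j) = R' i j"
    and R_left: "\<And>i. i < n \<Longrightarrow> R (skip k i) k \<longleftrightarrow> i < k"
    and R_right: "\<And>j. j < n \<Longrightarrow> R k (skip k j) \<longleftrightarrow> k \<le> j"
    and across: "\<And>i j. i < k \<Longrightarrow> k \<le> j \<Longrightarrow> j < n \<Longrightarrow> R' i j"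
begin

abbreviation "X \<equiv> conf (Suc n) R"
abbreviation "V \<equiv> conf n R'"
abbreviation "e \<equiv> conf_idem (Suc n) c R"
abbreviation "ev \<equiv> conf_idem n c' R'"
abbreviation "D \<equiv> ind (delete_rel (Suc n) k X)"
abbreviation "D' \<equiv> ind (\<lambda>x y. delete_rel (Suc n) k X y x)"
abbreviation "eB \<equiv> conf_idem (Suc n) (c(k := Some Black)) R"
abbreviation "eW \<equiv> conf_idem (Suc n) (c(k := Some White)) R"
abbreviation "b \<equiv> ind (coord_rel (Suc n) k (Some Black) UNIV)"

lemma irr: "\<not> R j j"
  using R by blast

lemma conf_insert: "length x = n \<Longrightarrow> insert_nth k t x \<in> X \<longleftrightarrow>
   x \<in> V \<and> (\<forall>i<n. i < k \<longrightarrow> x ! i < t) \<and> (\<forall>j<n. k \<le> j \<longrightarrow> t < x ! j)"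
  unfolding conf_def using k irr
  by (simp add: all_skip nth_insert_same nth_insert_skip R_skip R_left R_right) blast

lemma conf_rel_insert: "length x = n \<Longrightarrow> length x' = n \<Longrightarrow>
   conf_rel (Suc n) c R (insert_nth k s x') (insert_nth k t x) \<longleftrightarrow> s = t \<and> conf_rel n c' R' x' x \<and>
   (\<forall>i<n. i < k \<longrightarrow> x' ! i < s \<and> x ! i < s) \<and> (\<forall>j<n. k \<le> j \<longrightarrow> s < x' ! j \<and> s < x ! j)"
  unfolding conf_rel_def conf_insert using k irr
  by (simp add: all_skip nth_insert_same nth_insert_skip R_skip R_left R_right c' ck cong: conj_cong) blast

lemma delete_support:
  assumes "\<And>z. sections (Suc n) d X (entry K z)" "length x = n"
  shows "entry (K * D) z x = sint (\<lambda>t. entry K z (insert_nth k t x))"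
proof -
  have "entry K z y * of_bool (y \<in> X) = entry K z y" for y
    using sections_support[OF assms(1)[of z], of y] by (cases "y \<in> X") auto
  then show ?thesis using entry_times_delete[of k "Suc n" X x K z] k assms(2) by (simp add: invariant_conf)
qed

lemma insert_zero_update: "length x = n \<Longrightarrow> (insert_nth k 0 x)[k := t] = insert_nth k t x"
  using k by (simp add: insert_nth_def list_update_append)

text \<open>By Fubini, the total integral over coordinate \<open>k\<close> commutes with the
  conditions in the other coordinates.\<close>

lemma delete_sections:
  assumes K: "\<And>z. sections (Suc n) c X (entry (K :: 'k::comm_ring_1 kern) z)"
  shows "K * D * ev = K * D"
  unfolding times_conf_idem_iff[OF R']
proof
  fix z
  show "sections n c' V (entry (K * D) z)"
    unfolding sections_def
  proof (intro conjI allI impI)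
    fix x assume nz: "entry (K * D) z x \<noteq> 0"
    have x: "length x = n"
    proof (rule ccontr)
      assume "length x \<noteq> n"
      then show False using nz entry_times_delete_length[of k "Suc n" X x K z] k by (simp add: invariant_conf)
    qed
    obtain t where "entry K z (insert_nth k t x) \<noteq> 0"
    proof (rule ccontr)
      assume "\<not> thesis"
      then have "(\<lambda>t. entry K z (insert_nth k t x)) = (\<lambda>t. 0)" using that by auto
      then show False using nz delete_support[OF K x] by simp
    qed
    then have "insert_nth k t x \<in> X" using K[of z] by (auto simp: sections_def)
    then show "x \<in> V" using conf_insert[OF x] by simp
  next
    fix i assume i: "i < n"
    show "semicont n i (c' i) (entry (K * D) z)"
    proof (cases "c' i")
      case None then show ?thesis by (simp add: semicont_def)
    next
      case (Some d)
      have "sint (\<lambda>s. entry (K * D) z (x[i := s]) * of_bool (colour_le (Some d) s (x ! i))) = entry (K * D) z x"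
        if x: "length x = n" for x
      proof -
        let ?b = "\<lambda>s. of_bool (colour_le (Some d) s (x ! i)) :: 'k"
        let ?y = "insert_nth k 0 x"
        let ?F = "\<lambda>s t. entry K z (?y[skip k i := s, k := t])"
        have lt: "skip k i < Suc n" "skip k i \<noteq> k" using i by (auto simp: skip_def)
        have y: "?y[skip k i := s, k := t] = insert_nth k t (x[i := s])" for s t
          using insert_nth_update[of k x i 0 s] insert_zero_update[of "x[i := s]" t] x k i by simp
        have F: "inv2_step (set z \<union> set ?y) ?F"
          by (rule entry_inv2_step) (use lt x k in auto)
        have xi: "x ! i \<in> set z \<union> set ?y" using x i by (simp add: set_insert_nth)
        have G: "inv2_step (set z \<union> set ?y) (\<lambda>s t. ?F s t * ?b s)"
          unfolding inv2_step_def
        proof (intro conjI ballI allI)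
          fix g s t assume g: "g \<in> auts (set z \<union> set ?y)"
          have "?b (g s) = ?b s" using colour_le_auts[OF g, of "Some d" s "x ! i"] auts_fix[OF g xi] by simp
          moreover have "?F (g s) (g t) = ?F s t" using F g by (simp add: inv2_step_def)
          ultimately show "?F (g s) (g t) * ?b (g s) = ?F s t * ?b s" by simp
        qed simp
        have "sint (\<lambda>s. entry (K * D) z (x[i := s]) * ?b s) = sint (\<lambda>s. sint (\<lambda>t. ?F s t * ?b s))"
          unfolding sint_multc[OF inv2_step_right[OF F]] unfolding y using x by (simp add: delete_support[OF K])
        also have "\<dots> = sint (\<lambda>t. sint (\<lambda>s. ?F s t * ?b s))" by (rule fubini_inv2_step[OF G])
        also have "\<dots> = sint (\<lambda>t. entry K z (insert_nth k t x))"
        proof -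
          have "sint (\<lambda>s. ?F s t * ?b s) = entry K z (insert_nth k t x)" for t
          proof -
            have "semicont (Suc n) (skip k i) (Some d) (entry K z)"
              using sections_semicont[OF K lt(1)] Some c'[OF i] by simp
            from semicontD[OF this, of "insert_nth k t x"] show ?thesis
              unfolding y using x i k by (simp add: insert_nth_update nth_insert_skip)
          qed
          then show ?thesis by simp
        qed
        finally show ?thesis using delete_support[OF K x] by simp
      qed
      then show ?thesis using Some by (simp add: semicont_def)
    qed
  qed
qed

text \<open>For a neutral coordinate the two inserted values agree (\<open>s = t\<close>), so what
  is integrated is the indicator of the interval of values that fit into both \<open>x\<close> and
  \<open>x'\<close>. As \<open>k < n\<close>, it is bounded above, and \<open>sint_gap\<close> gives
  -1.\<close>

lemma delete_idem_delete:
  assumes "k < n"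
  shows "D' * (e * D) = - (ev :: 'k::comm_ring_1 kern)"
proof (rule kern_eqI)
  fix x' x
  have e: "\<And>z. sections (Suc n) c X (entry (e :: 'k kern) z)" by (rule sections_conf_idem) (rule irr)
  have inv: "invariant_set X" by (rule invariant_conf)
  have ev: "entry (- (ev :: 'k kern)) x' x = - of_bool (conf_rel n c' R' x' x)"
    by (simp add: uminus_kern.rep_eq entry_conf_idem)
  show "entry (D' * (e * D)) x' x = entry (- (ev :: 'k kern)) x' x"
  proof (cases "length x = n \<and> length x' = n")
    case False
    have "entry (D' * (e * D)) x' x = (0 :: 'k)"
    proof (cases "length x' = n")
      case True
      then have "length x \<noteq> n" using False by simp
      then have "entry (e * D) y x = (0 :: 'k)" for y
        using k by (intro entry_times_delete_length inv) auto
      then show ?thesis by (rule entry_times_support)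
    next
      case False
      then show ?thesis using k by (intro entry_delete_times_length inv) auto
    qed
    then show ?thesis unfolding ev using False by (auto simp: conf_rel_def conf_length)
  next
    case True
    then have x: "length x = n" "length x' = n" by auto
    let ?G = "\<lambda>s. (\<forall>i<n. i < k \<longrightarrow> x' ! i < s \<and> x ! i < s) \<and> (\<forall>j<n. k \<le> j \<longrightarrow> s < x' ! j \<and> s < x ! j)"
    have inner: "entry (e * D) (insert_nth k s x') x = (of_bool (conf_rel n c' R' x' x \<and> ?G s) :: 'k)" for s
    proof -
      have "entry (e * D) (insert_nth k s x') x = (sint (\<lambda>t. of_bool (conf_rel n c' R' x' x \<and> ?G s) * of_bool (t = s)) :: 'k)"
        unfolding delete_support[OF e x(1)] entry_conf_idem conf_rel_insert[OF x]
        by (intro arg_cong[of _ _ sint]) (auto simp: fun_eq_iff of_bool_def)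
      then show ?thesis by (simp only: sint_point)
    qed
    have "entry (D' * (e * D)) x' x = (sint (\<lambda>s. of_bool (conf_rel n c' R' x' x) * of_bool (?G s)) :: 'k)"
    proof -
      have "entry (D' * (e * D)) x' x = (sint (\<lambda>s. entry (e * D) (insert_nth k s x') x * of_bool (insert_nth k s x' \<in> X)) :: 'k)"
        by (rule entry_delete_times[OF _ inv]) (use k x in auto)
      also have "\<dots> = sint (\<lambda>s. of_bool (conf_rel n c' R' x' x) * of_bool (?G s))"
        unfolding inner by (intro arg_cong[of _ _ sint] ext) (auto simp: of_bool_def conf_insert[OF x(2)] conf_rel_def)
      finally show ?thesis .
    qed
    also have "\<dots> = - of_bool (conf_rel n c' R' x' x)"
    proof (cases "conf_rel n c' R' x' x")
      case True
      define A where "A = (!) x ` {..<k} \<union> (!) x' ` {..<k}"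
      define B where "B = (!) x ` {k..<n} \<union> (!) x' ` {k..<n}"
      have "?G s \<longleftrightarrow> (\<forall>a\<in>A. a < s) \<and> (\<forall>b\<in>B. s < b)" for s
        using k by (auto simp: A_def B_def)
      moreover have "sint (\<lambda>t. of_bool ((\<forall>a\<in>A. a < t) \<and> (\<forall>b\<in>B. t < b))) = (- 1 :: 'k)"
      proof (rule sint_gap)
        show "B \<noteq> {}" using assms by (auto simp: B_def)
        have "x ! i < x ! j \<and> x ! i < x' ! j \<and> x' ! i < x ! j \<and> x' ! i < x' ! j" if "i < k" "k \<le> j" "j < n" for i j
          using True across[OF that] that by (auto simp: conf_rel_def conf_def)
        then show "a < b" if "a \<in> A" "b \<in> B" for a b using that by (auto simp: A_def B_def)
      qed (auto simp: A_def B_def)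
      ultimately show ?thesis using True by simp
    qed simp
    finally show ?thesis unfolding ev .
  qed
qed

text \<open>Forgetting a colour drops a condition on the rows.\<close>

lemma add_colour_times: "conf_idem (Suc n) (c(k := Some d)) R * e = (conf_idem (Suc n) (c(k := Some d)) R :: 'k::comm_ring_1 kern)"
  unfolding times_conf_idem_iff[OF R]
proof
  fix z
  have "sections (Suc n) (c(k := Some d)) X (entry (conf_idem (Suc n) (c(k := Some d)) R :: 'k kern) z)"
    by (rule sections_conf_idem) (rule irr)
  then show "sections (Suc n) c X (entry (conf_idem (Suc n) (c(k := Some d)) R :: 'k kern) z)"
    unfolding sections_def using ck by (auto simp: semicont_def split: if_splits)
qed

text \<open>Coloured rows have total integral zero in coordinate \<open>k\<close>: white ones
  always, black ones because position \<open>Suc k\<close> follows.\<close>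

lemma colour_delete:
  assumes "k < n"
  shows "conf_idem (Suc n) (c(k := Some d)) R * D = (0 :: 'k::comm_ring_1 kern)"
proof (rule kern_eqI)
  fix z x
  let ?c = "c(k := Some d)"
  let ?K = "conf_idem (Suc n) ?c R :: 'k kern"
  have K: "\<And>z. sections (Suc n) ?c X (entry ?K z)" by (rule sections_conf_idem) (rule irr)
  show "entry (?K * D) z x = entry 0 z x"
  proof (cases "length x = n")
    case False
    then show ?thesis using entry_times_delete_length[of k "Suc n" X x ?K z] k
      by (simp add: invariant_conf zero_kern.rep_eq)
  next
    case True
    have "sint (\<lambda>t. entry ?K z ((insert_nth k 0 x)[k := t])) = 0"
    proof (cases d)
      case Black
      show ?thesis
      proof (rule black_integral[OF _ _ K])
        show "R k (Suc k)" using R_right[of k] assms by (simp add: skip_def)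
      qed (use Black assms True in auto)
    next
      case White
      show ?thesis by (rule white_integral[OF _ _ K]) (use White assms True in auto)
    qed
    then show ?thesis using insert_zero_update[OF True] delete_support[OF K True] by (simp add: zero_kern.rep_eq)
  qed
qed

text \<open>\<open>t\<close> is \<open>e\<close> if nothing follows \<open>k\<close>, and otherwise
  the complement of the part obtained by deletion. In both cases its rows meet the integral
  condition under which black integration stays within the configuration space.\<close>

lemma decomposes_colours:
  assumes t: "t * t = t" "t * e = (t :: 'k::comm_ring_1 kern)" "eB * t = eB" "eW * t = eW"
    and z: "k < n \<Longrightarrow> t * D = 0"
    and E: "E iB = eB" "E iW = eW" "iB \<noteq> iW"
  shows "decomposes t {iB, iW} E"
proof (rule decomposes_projection[where b = b, OF t(1,3,4)])
  have f: "sections (Suc n) c X (entry t z)" for z using t(2) times_conf_idem_iff[OF R] by blast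
  \<comment> \<open>This is \<open>t * D = 0\<close> in terms of rows; a successor of
    \<open>k\<close> exists only if \<open>k < n\<close>.\<close>
  have int: "\<forall>q<Suc n. R k q \<longrightarrow> (\<forall>z x. length x = Suc n \<longrightarrow> sint (\<lambda>s. entry t z (x[k := s])) = 0)"
  proof (intro allI impI)
    fix q z and x :: "real list" assume q: "q < Suc n" "R k q" "length x = Suc n"
    have "k < n" using R q by (metis less_Suc_eq_le less_le_trans)
    moreover have "insert_nth k s (remove_nth k x) = x[k := s]" for s
      using k q by (intro insert_remove_nth) simp
    moreover have "length (remove_nth k x) = n" using length_remove_nth[of k x] q k by simp
    ultimately show "sint (\<lambda>s. entry t z (x[k := s])) = 0"
      using delete_support[OF f, of "remove_nth k x" z] z by (simp add: zero_kern.rep_eq)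
  qed
  have k': "k < Suc n" using k by simp
  show "t * b * eB = t * b"
    unfolding times_conf_idem_iff[OF R] using sections_black[where K = t and R = R and c = c, OF irr k' ck f int] by blast
  show "(t - t * b) * eW = t - t * b"
    unfolding times_conf_idem_iff[OF R] using sections_white[where K = t and R = R and c = c, OF irr k' ck f int] by blast
  show "eB * b = (eB :: 'k kern)"
    by (rule black_times_black[OF k' _ sections_conf_idem]) (use irr in auto)
  show "eW * b = (0 :: 'k kern)"
    by (rule white_times_black[OF k' _ sections_conf_idem]) (use irr in auto)
  show "eB * eB = (eB :: 'k kern)" "eW * eW = (eW :: 'k kern)" by (rule conf_idem_idem[OF R])+
qed (rule E)+

lemma decomposes_last:
  assumes "k = n" and E: "E iB = eB" "E iW = eW" "iB \<noteq> iW"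
  shows "decomposes (e :: 'k::comm_ring_1 kern) {iB, iW} E"
  by (rule decomposes_colours[OF conf_idem_idem[OF R] conf_idem_idem[OF R] add_colour_times add_colour_times])
     (use assms in auto)

lemma decomposes_inner:
  assumes "k < n" and E: "E i0 = ev" "E iB = eB" "E iW = eW" "iB \<noteq> iW" "i0 \<noteq> iB" "i0 \<noteq> iW"
  shows "decomposes (e :: 'k::comm_ring_1 kern) {i0, iB, iW} E"
proof -
  define r :: "'k kern" where "r = e * D"
  \<comment> \<open>The sign compensates the volume -1 in \<open>delete_idem_delete\<close> and
    makes \<open>s * r = ev\<close>.\<close>
  define s :: "'k kern" where "s = - (ev * D' * e)"
  define t :: "'k kern" where "t = e - r * s"
  have ee: "e * e = (e :: 'k kern)" and vv: "ev * ev = (ev :: 'k kern)"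
    by (rule conf_idem_idem[OF R] conf_idem_idem[OF R'])+
  have rv: "r * ev = r" unfolding r_def
    by (rule delete_sections[OF sections_conf_idem]) (rule irr)
  have er: "e * r = r" by (simp add: r_def ee flip: mult.assoc)
  have vs: "ev * s = s" by (simp add: s_def vv flip: mult.assoc)
  have se: "s * e = s" by (simp add: s_def ee mult.assoc)
  have sr: "s * r = ev"
  proof -
    have "s * r = - (ev * (D' * (e * e * D)))" by (simp add: s_def r_def mult.assoc)
    then show ?thesis by (simp add: ee delete_idem_delete[OF assms(1)] vv)
  qed
  have te: "t * e = t" unfolding t_def by (simp add: algebra_simps ee se mult.assoc)
  have et: "e * t = t" unfolding t_def by (simp add: algebra_simps ee er flip: mult.assoc)
  have tr: "t * r = 0" unfolding t_def by (simp add: algebra_simps sr er rv mult.assoc)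
  have tt: "t * t = t"
  proof -
    have "t * t = t * e - t * r * s" unfolding t_def by (simp add: algebra_simps)
    then show ?thesis using te tr by simp
  qed
  have td: "t * D = 0"
  proof -
    have "t * D = t * e * D" by (simp add: te)
    also have "\<dots> = t * r" by (simp add: r_def mult.assoc)
    finally show ?thesis by (simp add: tr)
  qed
  have col: "conf_idem (Suc n) (c(k := Some d)) R * t = conf_idem (Suc n) (c(k := Some d)) R" for d
  proof -
    have "conf_idem (Suc n) (c(k := Some d)) R * t = conf_idem (Suc n) (c(k := Some d)) R * e - conf_idem (Suc n) (c(k := Some d)) R * e * D * s"
      by (simp add: t_def r_def algebra_simps)
    then show ?thesis by (simp add: add_colour_times colour_delete[OF assms(1)])
  qed
  have "decomposes t {iB, iW} E"
    by (rule decomposes_colours[OF tt te col col td E(2,3,4)])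
  then show ?thesis
    by (rule decomposes_insert[of t "{iB, iW}" E i0 ev r s e])
       (use E ee rv er vs se sr in \<open>auto simp: t_def\<close>)
qed

end

section \<open>Collisions\<close>

text \<open>\<open>\<pi>\<close> merges the positions \<open>p\<close> and \<open>q\<close> into
  \<open>k\<close>, and \<open>\<rho>\<close> is its section that chooses \<open>p\<close>. Pulling
  back along \<open>\<pi>\<close> identifies \<open>Y\<close> with the diagonal
  \<open>y ! p = y ! q\<close> of the larger space; \<open>lift_rel\<close> ensures that merging
  creates no further relations.\<close>

locale closed_stratum =
  fixes N n p q k :: nat and \<pi> \<rho> :: "nat \<Rightarrow> nat" and c c0 :: "nat \<Rightarrow> letter option"
    and R R0 :: "nat \<Rightarrow> nat \<Rightarrow> bool" and a b :: letter
  assumes R: "\<forall>i j. R i j \<longrightarrow> i < j" and R0: "\<forall>i j. R0 i j \<longrightarrow> i < j"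
    and pq: "p < N" "q < N" "p \<noteq> q" and k: "k < n" "\<pi> p = k" "\<pi> q = k" "\<rho> k = p"
    and \<pi>: "\<And>i. i < N \<Longrightarrow> \<pi> i < n" "\<And>i. i < N \<Longrightarrow> i \<noteq> q \<Longrightarrow> \<rho> (\<pi> i) = i"
    and \<rho>: "\<And>i. i < n \<Longrightarrow> \<rho> i < N \<and> \<pi> (\<rho> i) = i"
    and colours: "\<And>i. i < N \<Longrightarrow> i \<noteq> p \<Longrightarrow> i \<noteq> q \<Longrightarrow> c0 (\<pi> i) = c i"
    and ab: "c p = Some a" "c q = Some b" "c0 k = (if a = b then Some a else None)"
    and push_rel: "\<And>i j. i < N \<Longrightarrow> j < N \<Longrightarrow> R i j \<Longrightarrow> R0 (\<pi> i) (\<pi> j)"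
    and lift_rel: "\<And>i j. i < n \<Longrightarrow> j < n \<Longrightarrow> R0 i j \<Longrightarrow> \<exists>i' j'. i' < N \<and> j' < N \<and> R i' j' \<and> \<pi> i' = i \<and> \<pi> j' = j"
begin

abbreviation "e \<equiv> conf_idem N c R"
abbreviation "e0 \<equiv> conf_idem n c0 R0"
abbreviation "Y \<equiv> conf n R0"
abbreviation "j0 \<equiv> ind (pull_rel N \<pi> Y)"
abbreviation "j0' \<equiv> ind (\<lambda>x y. pull_rel N \<pi> Y y x)"

lemma reindexing: "reindexing N n \<pi> Y"
  unfolding reindexing_def using \<pi>(1) conf_length invariant_conf by blast

lemma conf_pull: "length x = n \<Longrightarrow> pull N \<pi> x \<in> conf N R \<longleftrightarrow> x \<in> Y"
proof
  assume x: "length x = n" and "pull N \<pi> x \<in> conf N R"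
  then have *: "\<And>i j. i < N \<Longrightarrow> j < N \<Longrightarrow> R i j \<Longrightarrow> x ! \<pi> i < x ! \<pi> j" by (simp add: conf_def)
  have "x ! i < x ! j" if "i < n" "j < n" "R0 i j" for i j
    using lift_rel[OF that] * by blast
  then show "x \<in> Y" using x by (simp add: conf_def)
next
  assume "x \<in> Y"
  then show "pull N \<pi> x \<in> conf N R" using push_rel \<pi>(1) by (simp add: conf_def)
qed

text \<open>On the diagonal, opposite colours demand \<open>\<le>\<close> and \<open>\<ge>\<close>
  at once, that is equality, which is the condition of a position without colour; equal colours
  demand the same twice.\<close>

lemma conf_rel_pull:
  assumes x: "length x = n" "length x' = n"
  shows "conf_rel N c R (pull N \<pi> x') (pull N \<pi> x) \<longleftrightarrow> conf_rel n c0 R0 x' x"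
proof -
  have "(\<forall>i<N. colour_le (c i) (x' ! \<pi> i) (x ! \<pi> i)) \<longleftrightarrow> (\<forall>i<n. colour_le (c0 i) (x' ! i) (x ! i))"
  proof (intro iffI allI impI)
    fix i assume A: "\<forall>i<N. colour_le (c i) (x' ! \<pi> i) (x ! \<pi> i)" and i: "i < n"
    show "colour_le (c0 i) (x' ! i) (x ! i)"
    proof (cases "i = k")
      case True
      have "colour_le (Some a) (x' ! k) (x ! k)" "colour_le (Some b) (x' ! k) (x ! k)"
        using A pq k ab by metis+
      then show ?thesis using True ab(3) by (cases a; cases b) auto
    next
      case False
      then have "\<rho> i \<noteq> p" "\<rho> i \<noteq> q" using \<rho>[OF i] k by auto
      then show ?thesis using A \<rho>[OF i] colours[of "\<rho> i"] by auto
    qed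
  next
    fix i assume A: "\<forall>i<n. colour_le (c0 i) (x' ! i) (x ! i)" and i: "i < N"
    have kk: "colour_le (c0 k) (x' ! k) (x ! k)" using A k by blast
    consider "i = p" | "i = q" | "i \<noteq> p" "i \<noteq> q" by blast
    then show "colour_le (c i) (x' ! \<pi> i) (x ! \<pi> i)"
    proof cases
      case 1 then show ?thesis using kk k ab by (auto split: if_splits)
    next
      case 2 then show ?thesis using kk k ab by (auto split: if_splits)
    next
      case 3 then show ?thesis using A \<pi>(1)[OF i] colours[OF i] by auto
    qed
  qed
  moreover have "(\<forall>i<N. \<forall>j<N. R i j \<longrightarrow> x' ! \<pi> i < x ! \<pi> j \<and> x ! \<pi> i < x' ! \<pi> j) \<longleftrightarrow>
    (\<forall>i<n. \<forall>j<n. R0 i j \<longrightarrow> x' ! i < x ! j \<and> x ! i < x' ! j)"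
  proof (intro iffI allI impI)
    fix i j assume A: "\<forall>i<N. \<forall>j<N. R i j \<longrightarrow> x' ! \<pi> i < x ! \<pi> j \<and> x ! \<pi> i < x' ! \<pi> j"
      and ij: "i < n" "j < n" "R0 i j"
    from lift_rel[OF ij] show "x' ! i < x ! j \<and> x ! i < x' ! j" using A by blast
  next
    fix i j assume A: "\<forall>i<n. \<forall>j<n. R0 i j \<longrightarrow> x' ! i < x ! j \<and> x ! i < x' ! j"
      and ij: "i < N" "j < N" "R i j"
    show "x' ! \<pi> i < x ! \<pi> j \<and> x ! \<pi> i < x' ! \<pi> j"
      using A push_rel[OF ij] \<pi>(1)[OF ij(1)] \<pi>(1)[OF ij(2)] by blast
  qed
  ultimately show ?thesis using x by (simp add: conf_rel_def conf_pull)
qed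

lemma pull_inverse: "length x = n \<Longrightarrow> pull n \<rho> (pull N \<pi> x) = x"
  by (rule nth_equalityI) (use \<rho> in auto)

lemma inj: "inj_on (pull N \<pi>) Y"
  by (rule inj_on_inverseI[of _ "pull n \<rho>"]) (rule pull_inverse, rule conf_length)

lemma image: "pull N \<pi> ` Y = {y \<in> conf N R. y ! p = y ! q}"
proof (intro equalityI subsetI)
  fix y assume "y \<in> pull N \<pi> ` Y"
  then obtain x where x: "x \<in> Y" "y = pull N \<pi> x" by auto
  have "length x = n" using x(1) by (rule conf_length)
  then show "y \<in> {y \<in> conf N R. y ! p = y ! q}" using conf_pull pq k x by simp
next
  fix y assume y: "y \<in> {y \<in> conf N R. y ! p = y ! q}"
  then have len: "length y = N" by (auto dest: conf_length)
  have eq: "pull N \<pi> (pull n \<rho> y) = y"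
  proof (rule nth_equalityI)
    fix i assume "i < length (pull N \<pi> (pull n \<rho> y))"
    then have i: "i < N" by simp
    show "pull N \<pi> (pull n \<rho> y) ! i = y ! i"
      using i \<pi>(1)[OF i] \<pi>(2)[OF i] y k pq by (cases "i = q") auto
  qed (simp add: len)
  then have "pull n \<rho> y \<in> Y" using conf_pull[of "pull n \<rho> y"] y by simp
  then show "y \<in> pull N \<pi> ` Y" using eq by (metis image_eqI)
qed

lemma push_pull: "entry (K * j0 * j0') z y = entry K z y * of_bool (y \<in> conf N R \<and> y ! p = y ! q)"
proof (cases "y \<in> pull N \<pi> ` Y")
  case True
  then obtain x where "x \<in> Y" "y = pull N \<pi> x" by auto
  then show ?thesis using entry_times_push(1)[OF reindexing inj, of x "K * j0" z] True
    unfolding image by (simp add: entry_times_pull[OF reindexing])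
next
  case False
  then show ?thesis using entry_times_push(2)[OF reindexing inj False, of "K * j0" z] unfolding image by auto
qed

text \<open>Restricting the kernel \<open>e\<close> to the diagonal in both arguments yields
  \<open>e0\<close>. This is what makes the restriction of sections to the diagonal split.\<close>

lemma pull_idem_push: "j0' * (e * j0) = (e0 :: 'k::comm_ring_1 kern)"
proof (rule kern_eqI)
  fix x' x
  have "conf_rel n c0 R0 x' x \<longrightarrow> x' \<in> Y \<and> x \<in> Y" by (simp add: conf_rel_def)
  moreover have "conf_rel N c R (pull N \<pi> x') (pull N \<pi> x) \<longleftrightarrow> conf_rel n c0 R0 x' x" if "x' \<in> Y \<and> x \<in> Y"
    using that conf_length by (intro conf_rel_pull) blast+
  ultimately show "entry (j0' * (e * j0)) x' x = (entry e0 x' x :: 'k)"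
    by (cases "x' \<in> Y \<and> x \<in> Y") (auto simp: entry_pull_times[OF reindexing] entry_times_pull[OF reindexing] entry_conf_idem)
qed

text \<open>For opposite colours nothing is required at \<open>k\<close>. For equal colours the row
  meets the condition in each of two variables, and \<open>sint_diagonal\<close> transfers it to the
  diagonal.\<close>

lemma restrict_sections: "e * j0 * e0 = (e * j0 :: 'k::comm_ring_1 kern)"
  unfolding times_conf_idem_iff[OF R0]
proof
  fix z
  let ?f = "entry (e :: 'k kern) z" and ?g = "entry (e * j0 :: 'k kern) z"
  have f: "sections N c (conf N R) ?f" by (rule sections_conf_idem) (use R in blast)
  have g: "?g x = ?f (pull N \<pi> x)" if x: "length x = n" for x
    using conf_pull[OF x] sections_support[OF f, of "pull N \<pi> x"]
    by (auto simp: entry_times_pull[OF reindexing])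
  show "sections n c0 Y ?g"
    unfolding sections_def
  proof (intro conjI allI impI)
    fix x assume "?g x \<noteq> 0" then show "x \<in> Y" by (auto simp: entry_times_pull[OF reindexing] of_bool_def split: if_splits)
  next
    fix i assume i: "i < n"
    show "semicont n i (c0 i) ?g"
    proof (cases "i = k")
      case False
      then have ne: "\<rho> i \<noteq> p" "\<rho> i \<noteq> q" using \<rho>[OF i] k by auto
      have "semicont n (\<pi> (\<rho> i)) (c (\<rho> i)) ?g"
      proof (rule semicont_pull[where f = ?f and \<pi> = \<pi> and j = "\<rho> i" and N = N])
        show "semicont N (\<rho> i) (c (\<rho> i)) ?f" using \<rho>[OF i] by (intro sections_semicont[OF f]) simp
        show "\<forall>i'<N. \<pi> i' = \<pi> (\<rho> i) \<longrightarrow> i' = \<rho> i"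
          using \<pi>(2) \<rho>[OF i] k False by metis
      qed (use \<pi> \<rho>[OF i] g in auto)
      then show ?thesis using colours[of "\<rho> i"] ne \<rho>[OF i] by simp
    next
      case True
      show ?thesis
      proof (cases "a = b")
        case False then show ?thesis using True ab by (simp add: semicont_def)
      next
        case eq: True
        have "sint (\<lambda>t. ?g (x[k := t]) * of_bool (colour_le (Some a) t (x ! k))) = ?g x" if x: "length x = n" for x
        proof -
          let ?y = "pull N \<pi> x"
          let ?h = "\<lambda>s t. ?f (?y[p := s, q := t])"
          have sp: "semicont N p (Some a) ?f" "semicont N q (Some a) ?f"
            using sections_semicont[OF f pq(1)] sections_semicont[OF f pq(2)] ab eq by simp_all
          have upd: "pull N \<pi> (x[k := t]) = ?y[p := t, q := t]" for t
          proof (rule nth_equalityI)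
            fix i assume "i < length (pull N \<pi> (x[k := t]))"
            then have i: "i < N" by simp
            have "\<pi> i = k \<longleftrightarrow> i = p \<or> i = q" using \<pi>(2)[OF i] k by metis
            then show "pull N \<pi> (x[k := t]) ! i = ?y[p := t, q := t] ! i"
              using i x k \<pi>(1)[OF i] pq by (auto simp: nth_list_update)
          qed simp
          have "sint (\<lambda>t. ?h t t * of_bool (colour_le (Some a) t (x ! k))) = ?h (x ! k) (x ! k)"
          proof (rule sint_diagonal[where h = ?h and S = "set z \<union> set ?y"])
            show "inv2_step (set z \<union> set ?y) ?h" by (rule entry_inv2_step) (use pq in auto)
            show "sint (\<lambda>s. ?h s t * of_bool (colour_le (Some a) s u)) = ?h u t" for u t
              using semicont_line[OF sp(1), of "?y[q := t]" u] pq by (simp add: list_update_swap)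
            show "sint (\<lambda>t. ?h s t * of_bool (colour_le (Some a) t u)) = ?h s u" for u s
              using semicont_line[OF sp(2), of "?y[p := s]" u] pq by simp
          qed
          then show ?thesis using x upd[of "x ! k"] by (simp add: g upd)
        qed
        then show ?thesis using True ab eq by (simp add: semicont_def)
      qed
    qed
  qed
qed

end

section \<open>Two parallel chains\<close>

text \<open>The positions below \<open>k\<close> form a chain, followed by two incomparable chains, the first of
  which has length \<open>m\<close>.\<close>

definition two_chains :: "nat \<Rightarrow> nat \<Rightarrow> nat \<Rightarrow> nat \<Rightarrow> bool" where
  "two_chains k m i j \<longleftrightarrow> i < j \<and> \<not> (k \<le> i \<and> i < k + m \<and> k + m \<le> j)"

text \<open>The state of the recursion: \<open>w\<close> is the part already merged into a single
  chain, and \<open>l\<close> and \<open>r\<close> are the letters of the two words still to be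
  placed.\<close>

definition chain_idem :: "letter option list \<Rightarrow> letter option list \<Rightarrow> letter option list \<Rightarrow> 'k::comm_ring_1 kern" where
  "chain_idem w l r = conf_idem (length w + length l + length r) (\<lambda>i. (w @ l @ r) ! i) (two_chains (length w) (length l))"

lemma two_chains_less: "\<forall>i j. two_chains k m i j \<longrightarrow> i < j"
  by (simp add: two_chains_def)

lemma chain_idem_idem: "chain_idem w l r * chain_idem w l r = chain_idem w l r"
  unfolding chain_idem_def by (rule conf_idem_idem[OF two_chains_less])

lemma chain_idem_right_Nil: "chain_idem w l [] = chain_idem (w @ l) [] []"
  unfolding chain_idem_def by (intro arg_cong[of _ _ ind]) (auto intro!: conf_rel_cong simp: two_chains_def)

lemma chain_idem_left_Nil: "chain_idem w [] r = chain_idem (w @ r) [] []"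
  unfolding chain_idem_def by (intro arg_cong[of _ _ ind]) (auto intro!: conf_rel_cong simp: two_chains_def)

text \<open>Position \<open>length w\<close> follows all of \<open>w\<close> and precedes both
  chains, so it is comparable to everything; it is the last one exactly if both chains are
  empty.\<close>

lemma decomposes_neutral:
  assumes E: "E iB = chain_idem (w @ [Some Black]) l r" "E iW = chain_idem (w @ [Some White]) l r" "iB \<noteq> iW"
  shows "l = [] \<Longrightarrow> r = [] \<Longrightarrow> decomposes (chain_idem (w @ [None]) l r :: 'k::comm_ring_1 kern) {iB, iW} E"
    and "l \<noteq> [] \<or> r \<noteq> [] \<Longrightarrow> E i0 = chain_idem w l r \<Longrightarrow> i0 \<noteq> iB \<Longrightarrow> i0 \<noteq> iW \<Longrightarrow>
      decomposes (chain_idem (w @ [None]) l r :: 'k::comm_ring_1 kern) {i0, iB, iW} E"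
proof -
  define k where "k = length w"
  define m where "m = length l"
  define n where "n = k + m + length r"
  let ?c = "\<lambda>i. (w @ [None] @ l @ r) ! i" and ?c' = "\<lambda>i. (w @ l @ r) ! i"
  let ?R = "two_chains (Suc k) m" and ?R' = "two_chains k m"
  interpret neutral_coordinate n k ?c ?c' ?R ?R'
  proof
    show "k \<le> n" "?c k = None" by (simp_all add: n_def k_def)
    show "?c' i = ?c (skip k i)" for i by (auto simp: skip_def k_def nth_append)
    show "\<forall>i j. ?R i j \<longrightarrow> i < j" "\<forall>i j. ?R' i j \<longrightarrow> i < j" by (rule two_chains_less)+
    show "?R (skip k i) (skip k j) = ?R' i j" for i j by (auto simp: two_chains_def skip_def)
    show "?R (skip k i) k \<longleftrightarrow> i < k" for i by (auto simp: two_chains_def skip_def)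
    show "?R k (skip k j) \<longleftrightarrow> k \<le> j" for j by (auto simp: two_chains_def skip_def)
    show "?R' i j" if "i < k" "k \<le> j" for i j using that by (auto simp: two_chains_def)
  qed
  have e: "e = (chain_idem (w @ [None]) l r :: 'k kern)"
    unfolding chain_idem_def by (simp add: n_def k_def m_def)
  have ev: "ev = (chain_idem w l r :: 'k kern)"
    unfolding chain_idem_def by (simp add: n_def k_def m_def)
  have col: "conf_idem (Suc n) (?c(k := Some d)) ?R = (chain_idem (w @ [Some d]) l r :: 'k kern)" for d
  proof -
    have "(?c(k := Some d)) i = (w @ [Some d] @ l @ r) ! i" for i
      by (auto simp: k_def nth_append nth_Cons')
    then have "?c(k := Some d) = (\<lambda>i. (w @ [Some d] @ l @ r) ! i)" by blast
    then show ?thesis unfolding chain_idem_def by (simp add: n_def k_def m_def)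
  qed
  have E': "E iB = eB" "E iW = eW" using E col by simp_all
  show "decomposes (chain_idem (w @ [None]) l r :: 'k kern) {iB, iW} E" if "l = []" "r = []"
  proof -
    have "k = n" using that by (simp add: n_def m_def)
    from decomposes_last[OF this E' E(3)] show ?thesis unfolding e .
  qed
  show "decomposes (chain_idem (w @ [None]) l r :: 'k kern) {i0, iB, iW} E"
    if "l \<noteq> [] \<or> r \<noteq> []" "E i0 = chain_idem w l r" "i0 \<noteq> iB" "i0 \<noteq> iW"
  proof -
    have "k < n" using that by (auto simp: n_def m_def)
    from decomposes_inner[OF this _ E' E(3) that(3,4)] show ?thesis unfolding e ev using that(2) by simp
  qed
qed

text \<open>The merged chain continues with the first letter of either chain or with their
  collision, according to the order of the coordinates \<open>k\<close> and
  \<open>q\<close>.\<close>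

lemma decomposes_first_letters:
  fixes a b :: letter
  assumes E: "E i0 = chain_idem (w @ [if a = b then Some a else None]) l r"
    "E i1 = chain_idem (w @ [Some a]) l (Some b # r)" "E i2 = chain_idem (w @ [Some b]) (Some a # l) r"
    and i: "i0 \<noteq> i1" "i0 \<noteq> i2" "i1 \<noteq> i2"
  shows "decomposes (chain_idem w (Some a # l) (Some b # r) :: 'k::comm_ring_1 kern) {i0, i1, i2} E"
proof -
  define k where "k = length w"
  define m where "m = length l"
  define q where "q = Suc (k + m)"
  define N where "N = Suc (Suc (k + m + length r))"
  define n where "n = Suc (k + m + length r)"
  let ?c = "\<lambda>i. (w @ (Some a # l) @ (Some b # r)) ! i"
  let ?R = "two_chains k (Suc m)"
  define \<pi>0 where "\<pi>0 i = (if i < q then i else if i = q then k else i - 1)" for i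
  define \<rho>0 where "\<rho>0 i = (if i < q then i else Suc i)" for i
  define \<pi>2 where "\<pi>2 i = (if i < k then i else if i < q then Suc i else if i = q then k else i)" for i
  define \<rho>2 where "\<rho>2 i = (if i < k then i else if i = k then q else if i \<le> q then i - 1 else i)" for i
  let ?cm = "\<lambda>i. (w @ [if a = b then Some a else None] @ l @ r) ! i" and ?Rm = "two_chains (Suc k) m"
  let ?cs = "\<lambda>i. (w @ [Some b] @ (Some a # l) @ r) ! i" and ?Rs = "two_chains (Suc k) (Suc m)"
  interpret S0: closed_stratum N n k q k \<pi>0 \<rho>0 ?c ?cm ?R ?Rm a b
  proof
    show "\<forall>i j. ?R i j \<longrightarrow> i < j" "\<forall>i j. ?Rm i j \<longrightarrow> i < j" by (rule two_chains_less)+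
    show "k < N" "q < N" "k \<noteq> q" "k < n" "\<pi>0 k = k" "\<pi>0 q = k" "\<rho>0 k = k"
      by (simp_all add: N_def q_def n_def \<pi>0_def \<rho>0_def)
    show "\<pi>0 i < n" if "i < N" for i using that by (auto simp: \<pi>0_def N_def n_def q_def)
    show "\<rho>0 (\<pi>0 i) = i" if "i \<noteq> q" for i using that by (auto simp: \<pi>0_def \<rho>0_def)
    show "\<rho>0 i < N \<and> \<pi>0 (\<rho>0 i) = i" if "i < n" for i using that by (auto simp: \<pi>0_def \<rho>0_def N_def n_def)
    show "?cm (\<pi>0 i) = ?c i" if "i \<noteq> k" "i \<noteq> q" for i
      using that by (auto simp: \<pi>0_def q_def k_def m_def nth_append nth_Cons')
    show "?c k = Some a" "?c q = Some b" "?cm k = (if a = b then Some a else None)"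
      by (auto simp: k_def q_def m_def nth_append)
    show "?Rm (\<pi>0 i) (\<pi>0 j)" if "?R i j" for i j
      using that by (auto simp: two_chains_def \<pi>0_def q_def)
    show "\<exists>i' j'. i' < N \<and> j' < N \<and> ?R i' j' \<and> \<pi>0 i' = i \<and> \<pi>0 j' = j" if "i < n" "j < n" "?Rm i j" for i j
    \<comment> \<open>Relations from the merged position to the second chain come from
      \<open>q\<close>; for all others the positions chosen by \<open>\<rho>0\<close> are
      related.\<close>
    proof (cases "i = k \<and> q \<le> j")
      case True
      then show ?thesis using that by (intro exI[of _ q] exI[of _ "Suc j"]) (auto simp: two_chains_def \<pi>0_def q_def n_def N_def)
    next
      case False
      then show ?thesis using that by (intro exI[of _ "\<rho>0 i"] exI[of _ "\<rho>0 j"]) (auto simp: two_chains_def \<pi>0_def \<rho>0_def q_def n_def N_def)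
    qed
  qed
  have kq: "k < N" "q < N" "k \<noteq> q" "k < q" by (simp_all add: N_def q_def)
  interpret S1: open_stratum N k q "\<lambda>i. i" "\<lambda>i. i" ?c ?c ?R ?Rm
  proof
    show "\<forall>i j. ?R i j \<longrightarrow> i < j" "\<forall>i j. ?Rm i j \<longrightarrow> i < j" by (rule two_chains_less)+
    show "x \<in> conf N ?Rm \<longleftrightarrow> pull N (\<lambda>i. i) x \<in> conf N ?R \<and> x ! k < x ! q" if x: "length x = N" for x
    proof -
      have 1: "two_chains k (Suc m) i j \<Longrightarrow> ?Rm i j" for i j by (auto simp: two_chains_def)
      have 2: "?Rm k q" by (auto simp: two_chains_def q_def)
      \<comment> \<open>Every new relation leads from \<open>k\<close> to the second chain and
        follows from \<open>x ! k < x ! q\<close> by transitivity.\<close>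
      have 3: "?R i j \<or> (i = k \<and> (j = q \<or> ?R q j))" if "?Rm i j" for i j
        using that by (auto simp: two_chains_def q_def)
      have "x ! i < x ! j" if "\<forall>i<N. \<forall>j<N. ?R i j \<longrightarrow> x ! i < x ! j" "x ! k < x ! q" "i < N" "j < N" "?Rm i j" for i j
        using 3[OF that(5)] that kq by (metis less_trans)
      then show ?thesis unfolding pull_id[OF x] conf_def using 1 2 kq x by blast
    qed
  qed (use kq in auto)
  interpret S2: open_stratum N q k \<pi>2 \<rho>2 ?c ?cs ?R ?Rs
  proof
    show "\<forall>i j. ?R i j \<longrightarrow> i < j" "\<forall>i j. ?Rs i j \<longrightarrow> i < j" by (rule two_chains_less)+
    show perm: "\<pi>2 i < N \<and> \<rho>2 i < N \<and> \<pi>2 (\<rho>2 i) = i \<and> \<rho>2 (\<pi>2 i) = i" if "i < N" for i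
      using that kq by (auto simp: \<pi>2_def \<rho>2_def)
    show "?cs (\<pi>2 i) = ?c i" for i
      by (auto simp: \<pi>2_def q_def k_def m_def nth_append nth_Cons')
    show "x \<in> conf N ?Rs \<longleftrightarrow> pull N \<pi>2 x \<in> conf N ?R \<and> x ! \<pi>2 q < x ! \<pi>2 k" if x: "length x = N" for x
    proof -
      have 1: "?Rs (\<pi>2 i) (\<pi>2 j)" if "?R i j" for i j
        using that by (auto simp: two_chains_def \<pi>2_def q_def)
      have 2: "?Rs (\<pi>2 q) (\<pi>2 k)" by (auto simp: two_chains_def \<pi>2_def q_def)
      have 3: "?R (\<rho>2 i) (\<rho>2 j) \<or> (\<rho>2 i = q \<and> (\<rho>2 j = k \<or> ?R k (\<rho>2 j)))" if "?Rs i j" for i j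
        using that by (auto simp: two_chains_def \<rho>2_def q_def)
      have "x ! i < x ! j" if A: "\<forall>i<N. \<forall>j<N. ?R i j \<longrightarrow> x ! \<pi>2 i < x ! \<pi>2 j" "x ! \<pi>2 q < x ! \<pi>2 k"
        "i < N" "j < N" "?Rs i j" for i j
      proof -
        have "x ! \<pi>2 (\<rho>2 i) < x ! \<pi>2 (\<rho>2 j)"
          using 3[OF A(5)] A(1,2) kq perm[OF A(3)] perm[OF A(4)] by (metis less_trans)
        then show ?thesis using perm[OF A(3)] perm[OF A(4)] by simp
      qed
      moreover have "x ! \<pi>2 i < x ! \<pi>2 j" if "x \<in> conf N ?Rs" "i < N" "j < N" "?Rs (\<pi>2 i) (\<pi>2 j)" for i j
        using conf_less[OF that(1) _ _ that(4)] perm that by blast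
      moreover have "pull N \<pi>2 x \<in> conf N ?R \<longleftrightarrow> (\<forall>i<N. \<forall>j<N. ?R i j \<longrightarrow> x ! \<pi>2 i < x ! \<pi>2 j)"
        by (simp add: conf_def)
      ultimately show ?thesis using 1 2 kq x unfolding conf_def[of N ?Rs] by blast
    qed
  qed (use kq in auto)
  have e: "conf_idem N ?c ?R = (chain_idem w (Some a # l) (Some b # r) :: 'k kern)"
    unfolding chain_idem_def by (simp add: N_def k_def m_def)
  have E0: "E i0 = conf_idem n ?cm ?Rm"
    unfolding E chain_idem_def by (simp add: n_def k_def m_def)
  have E1: "E i1 = conf_idem N ?c ?Rm"
    unfolding E chain_idem_def by (simp add: N_def k_def m_def)
  have E2: "E i2 = conf_idem N ?cs ?Rs"
    unfolding E chain_idem_def by (simp add: N_def k_def m_def)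
  \<comment> \<open>Extending the vanishing restriction back to the full space recovers the row on
    the diagonal.\<close>
  have zero: "entry K z y = 0" if K: "K * S0.e = K" "K * S0.j0 = 0" and y: "length y = N" "y ! k = y ! q" for K :: "'k kern" and z y
  proof (cases "y \<in> conf N ?R")
    case True
    have "entry (K * S0.j0 * S0.j0') z y = 0" using K(2) by (simp add: zero_kern.rep_eq)
    then show ?thesis using S0.push_pull[of K z y] True y by simp
  next
    case False
    have "sections N ?c (conf N ?R) (entry K z)" using K(1) times_conf_idem_iff[OF S0.R] by blast
    then show ?thesis using sections_support False by blast
  qed
  have supp1: "entry (S1.e1 * S1.j1') z y \<noteq> (0 :: 'k) \<Longrightarrow> y ! k < y ! q" for z y
    using S1.push_support by blast
  have supp2: "entry (S2.e1 * S2.j1') z y \<noteq> (0 :: 'k) \<Longrightarrow> y ! q < y ! k" for z y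
    using S2.push_support by blast
  show ?thesis
    unfolding e[symmetric]
  proof (rule decomposes_restriction[where j = S0.j0 and j' = S0.j0' and ja = S1.j1 and ja' = S1.j1'
        and jb = S2.j1 and jb' = S2.j1', OF _ _ S0.restrict_sections S0.pull_idem_push S1.push_sections S2.push_sections])
    show "K * S1.j1 * S1.e1 = K * S1.j1" if "K * S0.e = K" "K * S0.j0 = 0" for K :: "'k kern"
      by (rule S1.restrict_sections[OF that(1)]) (use zero[OF that] in blast)
    show "K * S2.j1 * S2.e1 = K * S2.j1" if "K * S0.e = K" "K * S0.j0 = 0" for K :: "'k kern"
      by (rule S2.restrict_sections[OF that(1)]) (use zero[OF that] in metis)
    show "S1.e1 * S1.j1' * S1.j1 = (S1.e1 :: 'k kern)" by (rule S1.pull_push)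
    show "S2.e1 * S2.j1' * S2.j1 = (S2.e1 :: 'k kern)" by (rule S2.pull_push)
    show "S1.e1 * S1.j1' * S2.j1 = (0 :: 'k kern)"
    proof (rule kern_eqI)
      fix z x
      have "entry (S1.e1 * S1.j1') z (pull N \<pi>2 x) = (0 :: 'k)" if "x \<in> S2.Y"
      proof -
        have "pull N \<pi>2 x \<in> pull N \<pi>2 ` S2.Y" using that by (rule imageI)
        then have "(pull N \<pi>2 x) ! q < pull N \<pi>2 x ! k" unfolding S2.image by simp
        then show ?thesis using supp1[of z "pull N \<pi>2 x"] by (metis less_asym less_irrefl)
      qed
      then show "entry (S1.e1 * S1.j1' * S2.j1) z x = (entry 0 z x :: 'k)"
        by (auto simp: entry_times_pull[OF S2.reindexing] zero_kern.rep_eq)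
    qed
    show "S2.e1 * S2.j1' * S1.j1 = (0 :: 'k kern)"
    proof (rule kern_eqI)
      fix z x
      have "entry (S2.e1 * S2.j1') z (pull N (\<lambda>i. i) x) = (0 :: 'k)" if "x \<in> S1.Y"
      proof -
        have "pull N (\<lambda>i. i) x \<in> pull N (\<lambda>i. i) ` S1.Y" using that by (rule imageI)
        then have "pull N (\<lambda>i. i) x ! k < pull N (\<lambda>i. i) x ! q" unfolding S1.image by simp
        then show ?thesis using supp2[of z "pull N (\<lambda>i. i) x"] by (metis less_asym less_irrefl)
      qed
      then show "entry (S2.e1 * S2.j1' * S1.j1) z x = (entry 0 z x :: 'k)"
        by (auto simp: entry_times_pull[OF S1.reindexing] zero_kern.rep_eq)
    qed
    show "S1.e1 * S1.j1' * S0.j0 = (0 :: 'k kern)"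
    proof (rule kern_eqI)
      fix z x
      have "entry (S1.e1 * S1.j1') z (pull N \<pi>0 x) = (0 :: 'k)" if "x \<in> S0.Y"
      proof -
        have "pull N \<pi>0 x \<in> pull N \<pi>0 ` S0.Y" using that by (rule imageI)
        then have "pull N \<pi>0 x ! k = pull N \<pi>0 x ! q" unfolding S0.image by simp
        then show ?thesis using supp1[of z "pull N \<pi>0 x"] by (metis less_asym less_irrefl)
      qed
      then show "entry (S1.e1 * S1.j1' * S0.j0) z x = (entry 0 z x :: 'k)"
        by (auto simp: entry_times_pull[OF S0.reindexing] zero_kern.rep_eq)
    qed
    show "S2.e1 * S2.j1' * S0.j0 = (0 :: 'k kern)"
    proof (rule kern_eqI)
      fix z x
      have "entry (S2.e1 * S2.j1') z (pull N \<pi>0 x) = (0 :: 'k)" if "x \<in> S0.Y"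
      proof -
        have "pull N \<pi>0 x \<in> pull N \<pi>0 ` S0.Y" using that by (rule imageI)
        then have "pull N \<pi>0 x ! k = pull N \<pi>0 x ! q" unfolding S0.image by simp
        then show ?thesis using supp2[of z "pull N \<pi>0 x"] by (metis less_asym less_irrefl)
      qed
      then show "entry (S2.e1 * S2.j1' * S0.j0) z x = (entry 0 z x :: 'k)"
        by (auto simp: entry_times_pull[OF S0.reindexing] zero_kern.rep_eq)
    qed
    \<comment> \<open>The three strata partition the configuration space, so restricting to them and
      extending by zero adds up to the identity on its rows.\<close>
    show "S0.e * S0.j0 * S0.j0' + S0.e * S1.j1 * S1.j1' + S0.e * S2.j1 * S2.j1' = (S0.e :: 'k kern)"
    proof (rule kern_eqI)
      fix z y
      have "entry S0.e z y = (0 :: 'k)" if "y \<notin> conf N ?R" using that by (simp add: entry_conf_idem conf_rel_def)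
      then show "entry (S0.e * S0.j0 * S0.j0' + S0.e * S1.j1 * S1.j1' + S0.e * S2.j1 * S2.j1') z y = (entry S0.e z y :: 'k)"
        unfolding plus_kern.rep_eq S0.push_pull S1.push_pull S2.push_pull
        by (cases "y ! k" "y ! q" rule: linorder_cases; cases "y \<in> conf N ?R") auto
    qed
  qed (use E0 E1 E2 i conf_idem_idem[OF two_chains_less] in auto)
qed

section \<open>Ruffles as sequences of steps\<close>

datatype ruffle_step = Left_step | Right_step | Collision "letter option"

text \<open>A collision of equal letters carries that letter as its only mark, so that
  \<open>code_word\<close> can treat all collisions alike.\<close>

definition marks :: "letter \<Rightarrow> letter \<Rightarrow> weight \<Rightarrow> weight \<Rightarrow> letter option set" where
  "marks a b l r = (if a = b then {Some a}
     else {Some Black, Some White} \<union> (if l = [] \<and> r = [] then {} else {None}))"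

fun codes :: "weight \<Rightarrow> weight \<Rightarrow> ruffle_step list set" where
  "codes [] [] = {[]}"
| "codes (a # l) [] = {Left_step # c | c. c \<in> codes l []}"
| "codes [] (b # r) = {Right_step # c | c. c \<in> codes [] r}"
| "codes (a # l) (b # r) = {Left_step # c | c. c \<in> codes l (b # r)} \<union>
     {Right_step # c | c. c \<in> codes (a # l) r} \<union>
     {Collision d # c | d c. d \<in> marks a b l r \<and> c \<in> codes l r}"

fun code_word :: "weight \<Rightarrow> weight \<Rightarrow> ruffle_step list \<Rightarrow> weight" where
  "code_word (a # l) r (Left_step # c) = a # code_word l r c"
| "code_word l (b # r) (Right_step # c) = b # code_word l r c"
| "code_word (a # l) (b # r) (Collision d # c) = (case d of None \<Rightarrow> [] | Some x \<Rightarrow> [x]) @ code_word l r c"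
| "code_word l r c = []"

lemma decomposes_refine:
  assumes e: "decomposes e (insert i I) E" and i: "i \<notin> I"
    and J: "decomposes (E i) J E'" "J \<inter> I = {}"
    and idem: "\<And>j. j \<in> I \<Longrightarrow> E j * E j = E j"
  shows "decomposes e (I \<union> J) (\<lambda>j. if j \<in> J then E' j else E j)"
proof -
  \<comment> \<open>\<open>decomposes_trans\<close> produces the indices \<open>[i, x]\<close> for
    \<open>x \<in> J\<close> and, for the summands left alone, \<open>[j, j]\<close>; in both cases
    \<open>last\<close> recovers the index wanted.\<close>
  let ?F = "\<lambda>xs. if last xs \<in> J then E' (last xs) else E (last xs)"
  let ?C = "\<lambda>j. if j = i then (\<lambda>x. [x]) ` J else {[j]}"
  have "decomposes (E j) (?C j) (\<lambda>c. ?F (j # c))" if j: "j \<in> insert i I" for j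
  proof (cases "j = i")
    case True
    have "decomposes (E i) ((\<lambda>x. [x]) ` J) (\<lambda>c. ?F (i # c))"
      by (rule decomposes_reindex[OF J(1), of hd]) (auto simp: bij_betw_def inj_on_def image_image)
    then show ?thesis unfolding True by (simp only: simp_thms if_True)
  next
    case False
    then have "j \<in> I" "j \<notin> J" using j J(2) by auto
    then have "decomposes (E j) {[j]} (\<lambda>c. ?F (j # c))"
      by (intro decomposes_cong[OF decomposes_refl[OF idem]]) auto
    then show ?thesis using False by (simp only: if_False)
  qed
  from decomposes_trans[OF e this]
  have "decomposes e {j # c | j c. j \<in> insert i I \<and> c \<in> ?C j} ?F" .
  moreover have "bij_betw (\<lambda>x. if x \<in> J then [i, x] else [x, x]) (I \<union> J) {j # c | j c. j \<in> insert i I \<and> c \<in> ?C j}"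
    unfolding bij_betw_def using i J(2) by (auto simp: inj_on_def image_iff split: if_splits)
  ultimately show ?thesis
    by (rule decomposes_reindex) auto
qed

definition step_idem :: "weight \<Rightarrow> letter \<Rightarrow> letter \<Rightarrow> weight \<Rightarrow> weight \<Rightarrow> ruffle_step \<Rightarrow> 'k::comm_ring_1 kern" where
  "step_idem w a b l r s = (case s of
     Left_step \<Rightarrow> chain_idem (map Some (w @ [a])) (map Some l) (map Some (b # r))
   | Right_step \<Rightarrow> chain_idem (map Some (w @ [b])) (map Some (a # l)) (map Some r)
   | Collision d \<Rightarrow> chain_idem (map Some w @ (case d of None \<Rightarrow> [] | Some x \<Rightarrow> [Some x])) (map Some l) (map Some r))"

text \<open>If the letters agree, the three strata already have the required form. If they differ,
  the diagonal stratum has a neutral coordinate and is split further by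
  \<open>decomposes_neutral\<close>.\<close>

lemma decomposes_first_step:
  "decomposes (chain_idem (map Some w) (map Some (a # l)) (map Some (b # r)) :: 'k::comm_ring_1 kern)
     ({Left_step, Right_step} \<union> Collision ` marks a b l r) (step_idem w a b l r)"
proof (cases "a = b")
  case True
  have "decomposes (chain_idem (map Some w) (Some a # map Some l) (Some b # map Some r) :: 'k kern)
     {Collision (Some a), Left_step, Right_step} (step_idem w a b l r)"
    by (rule decomposes_first_letters) (use True in \<open>auto simp: step_idem_def\<close>)
  moreover have "{Left_step, Right_step} \<union> Collision ` marks a b l r = {Collision (Some a), Left_step, Right_step}"
    using True by (auto simp: marks_def)
  ultimately show ?thesis by simp
next
  case False
  define L where "L = map Some l"
  define S where "S = map Some r"
  let ?i = "Collision None"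
  \<comment> \<open>Here the index \<open>Collision None\<close> stands for the whole neutral
    stratum; after the refinement it stands for the part in which the coordinate is integrated
    out.\<close>
  define E where "E s = (if s = ?i then chain_idem (map Some w @ [None]) L S else step_idem w a b l r s :: 'k kern)" for s
  have "decomposes (chain_idem (map Some w) (Some a # L) (Some b # S) :: 'k kern) {?i, Left_step, Right_step} E"
    by (rule decomposes_first_letters) (use False in \<open>auto simp: E_def step_idem_def L_def S_def\<close>)
  moreover have "decomposes (E ?i) (Collision ` marks a b l r) (step_idem w a b l r)"
  proof -
    have E: "step_idem w a b l r (Collision (Some d)) = (chain_idem (map Some w @ [Some d]) L S :: 'k kern)" for d
      by (simp add: step_idem_def L_def S_def)
    have E0: "step_idem w a b l r (Collision None) = (chain_idem (map Some w) L S :: 'k kern)"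
      by (simp add: step_idem_def L_def S_def)
    note D = decomposes_neutral[of "step_idem w a b l r :: _ \<Rightarrow> 'k kern" "Collision (Some Black)" "map Some w" L S "Collision (Some White)", OF E E]
    show ?thesis
    proof (cases "l = [] \<and> r = []")
      case True
      then show ?thesis using D(1) False by (simp add: E_def marks_def L_def S_def)
    next
      case ne: False
      then have "decomposes (chain_idem (map Some w @ [None]) L S :: 'k kern)
         {Collision None, Collision (Some Black), Collision (Some White)} (step_idem w a b l r)"
        by (intro D(2)) (auto simp: E0 L_def S_def)
      moreover have "Collision ` marks a b l r = {Collision None, Collision (Some Black), Collision (Some White)}"
        using ne False by (auto simp: marks_def)
      ultimately show ?thesis by (simp add: E_def)
    qed
  qed
  moreover have idem: "step_idem w a b l r s * step_idem w a b l r s = (step_idem w a b l r s :: 'k kern)" for s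
    by (cases s) (auto simp: step_idem_def chain_idem_idem split: option.split)
  ultimately have "decomposes (chain_idem (map Some w) (Some a # L) (Some b # S) :: 'k kern)
     ({Left_step, Right_step} \<union> Collision ` marks a b l r) 
     (\<lambda>j. if j \<in> Collision ` marks a b l r then step_idem w a b l r j else E j)"
  proof (intro decomposes_refine[where i = ?i and I = "{Left_step, Right_step}"])
    show "E j * E j = E j" if "j \<in> {Left_step, Right_step}" for j using idem that by (auto simp: E_def)
  qed auto
  then have "decomposes (chain_idem (map Some w) (Some a # L) (Some b # S) :: 'k kern)
     ({Left_step, Right_step} \<union> Collision ` marks a b l r) (step_idem w a b l r)"
    by (rule decomposes_cong) (auto simp: E_def)
  then show ?thesis by (simp add: L_def S_def)
qed

lemma decomposes_codes:
  "decomposes (chain_idem (map Some w) (map Some l) (map Some r) :: 'k::comm_ring_1 kern) (codes l r)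
     (\<lambda>c. chain_idem (map Some (w @ code_word l r c)) [] [])"
proof (induction l r arbitrary: w rule: codes.induct)
  case 1
  have "decomposes (chain_idem (map Some w) [] [] :: 'k kern) {[]} (\<lambda>_. chain_idem (map Some w) [] [])"
    by (rule decomposes_refl[OF chain_idem_idem])
  then show ?case by simp
next
  case (2 a l)
  have "decomposes (chain_idem (map Some w) (map Some (a # l)) [] :: 'k kern)
     {i # c | i c. i \<in> {Left_step} \<and> c \<in> codes l []} (\<lambda>c. chain_idem (map Some (w @ code_word (a # l) [] c)) [] [])"
  proof (rule decomposes_trans)
    \<comment> \<open>With the other chain exhausted all positions form a single chain, so moving a
      letter into \<open>w\<close> does not change the idempotent.\<close>
    show "decomposes (chain_idem (map Some w) (map Some (a # l)) [] :: 'k kern) {Left_step} (\<lambda>_. chain_idem (map Some (w @ [a])) (map Some l) [])"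
      by (rule decomposes_cong[OF decomposes_refl[OF chain_idem_idem]]) (simp add: chain_idem_right_Nil[of "map Some w" "Some a # map Some l"]
          chain_idem_right_Nil[of "map Some w @ [Some a]" "map Some l"])
    show "decomposes (chain_idem (map Some (w @ [a])) (map Some l) [] :: 'k kern) (codes l [])
       (\<lambda>c. chain_idem (map Some (w @ code_word (a # l) [] (i # c))) [] [])" if "i \<in> {Left_step}" for i
      using "2.IH"[of "w @ [a]"] that by simp
  qed
  moreover have "{i # c | i c. i \<in> {Left_step} \<and> c \<in> codes l []} = codes (a # l) []" by auto
  ultimately show ?case by simp
next
  case (3 b r)
  have "decomposes (chain_idem (map Some w) [] (map Some (b # r)) :: 'k kern)
     {i # c | i c. i \<in> {Right_step} \<and> c \<in> codes [] r} (\<lambda>c. chain_idem (map Some (w @ code_word [] (b # r) c)) [] [])"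
  proof (rule decomposes_trans)
    show "decomposes (chain_idem (map Some w) [] (map Some (b # r)) :: 'k kern) {Right_step} (\<lambda>_. chain_idem (map Some (w @ [b])) [] (map Some r))"
      by (rule decomposes_cong[OF decomposes_refl[OF chain_idem_idem]]) (simp add: chain_idem_left_Nil[of "map Some w" "Some b # map Some r"]
          chain_idem_left_Nil[of "map Some w @ [Some b]" "map Some r"])
    show "decomposes (chain_idem (map Some (w @ [b])) [] (map Some r) :: 'k kern) (codes [] r)
       (\<lambda>c. chain_idem (map Some (w @ code_word [] (b # r) (i # c))) [] [])" if "i \<in> {Right_step}" for i
      using "3.IH"[of "w @ [b]"] that by simp
  qed
  moreover have "{i # c | i c. i \<in> {Right_step} \<and> c \<in> codes [] r} = codes [] (b # r)" by auto
  ultimately show ?case by simp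
next
  case (4 a l b r)
  let ?I = "{Left_step, Right_step} \<union> Collision ` marks a b l r"
  let ?J = "\<lambda>s. case s of Left_step \<Rightarrow> codes l (b # r) | Right_step \<Rightarrow> codes (a # l) r | Collision d \<Rightarrow> codes l r"
  have "decomposes (chain_idem (map Some w) (map Some (a # l)) (map Some (b # r)) :: 'k kern)
     {i # c | i c. i \<in> ?I \<and> c \<in> ?J i} (\<lambda>c. chain_idem (map Some (w @ code_word (a # l) (b # r) c)) [] [])"
  proof (rule decomposes_trans[OF decomposes_first_step])
    fix i assume i: "i \<in> ?I"
    show "decomposes (step_idem w a b l r i :: 'k kern) (?J i)
       (\<lambda>c. chain_idem (map Some (w @ code_word (a # l) (b # r) (i # c))) [] [])"
    proof (cases i)
      case Left_step
      then show ?thesis using "4.IH"(1)[of "w @ [a]"] by (simp add: step_idem_def)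
    next
      case Right_step
      then show ?thesis using "4.IH"(2)[of "w @ [b]"] by (simp add: step_idem_def)
    next
      case (Collision d)
      then have d: "d \<in> marks a b l r" using i by auto
      show ?thesis
        using Collision "4.IH"(3)[of "w @ (case d of None \<Rightarrow> [] | Some x \<Rightarrow> [x])"] d
        by (cases d) (auto simp: step_idem_def)
    qed
  qed
  moreover have "{i # c | i c. i \<in> ?I \<and> c \<in> ?J i} = codes (a # l) (b # r)" by auto
  ultimately show ?case by simp
qed

section \<open>Orbit types\<close>

definition rank :: "real set \<Rightarrow> real \<Rightarrow> nat" where
  "rank S t = card {s\<in>S. s < t}"

text \<open>The indices whose entries lie below \<open>t\<close> form an initial segment, which is
  determined by its cardinality.\<close>

lemma nth_less_rank:
  assumes "finite S" "i < card S"
  shows "sorted_list_of_set S ! i < t \<longleftrightarrow> i < rank S t"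
proof -
  let ?a = "sorted_list_of_set S"
  have len: "length ?a = card S" by simp
  have mono: "?a ! i < ?a ! j" if "i < j" "j < card S" for i j
    using that strict_sorted_list_of_set[of S] by (simp add: sorted_wrt_iff_nth_less)
  have set: "S = (!) ?a ` {..<card S}"
    using assms(1) by (metis len set_sorted_list_of_set nth_image lessThan_atLeast0 take_all order_refl)
  have inj: "inj_on ((!) ?a) {..<card S}" by (rule inj_on_nth) (use assms in auto)
  define D where "D = {i. i < card S \<and> ?a ! i < t}"
  have "{s\<in>S. s < t} = (!) ?a ` D" using set by (auto simp: D_def)
  moreover have "inj_on ((!) ?a) D" by (rule inj_on_subset[OF inj]) (auto simp: D_def)
  ultimately have r: "rank S t = card D" by (simp add: rank_def card_image)
  have fD: "finite D" by (simp add: D_def)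
  have down: "j \<in> D" if "i \<in> D" "j \<le> i" for i j
    using that mono[of j i] by (cases "j = i") (auto simp: D_def)
  have "i \<in> D \<longleftrightarrow> i < card D"
  proof
    assume "i \<in> D"
    then have "{..i} \<subseteq> D" using down by auto
    from card_mono[OF fD this] show "i < card D" by simp
  next
    assume i: "i < card D"
    show "i \<in> D"
    proof (rule ccontr)
      assume "i \<notin> D"
      then have "D \<subseteq> {..<i}" using down by (metis lessThan_iff linorder_not_less subsetI)
      from card_mono[OF _ this] i show False by simp
    qed
  qed
  then show ?thesis using assms by (simp add: r D_def)
qed

lemma rank_mono: "finite S \<Longrightarrow> t \<le> u \<Longrightarrow> rank S t \<le> rank S u"
  unfolding rank_def by (intro card_mono) auto

lemma rank_le_card: "finite S \<Longrightarrow> rank S t \<le> card S"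
  unfolding rank_def by (intro card_mono) auto

lemma rank_eq_less:
  assumes "finite S" "rank S t = rank S u" "s \<in> S"
  shows "s < t \<longleftrightarrow> s < u"
proof -
  have A: "{s\<in>S. s < t} = {s\<in>S. s < u}" if "t \<le> u" "rank S t = rank S u" for t u
    using that assms(1) by (intro card_subset_eq) (auto simp: rank_def)
  have "{s\<in>S. s < t} = {s\<in>S. s < u}"
  proof (cases "t \<le> u")
    case True show ?thesis by (rule A[OF True assms(2)])
  next
    case False
    then have "u \<le> t" by simp
    from A[OF this assms(2)[symmetric]] show ?thesis by (rule sym)
  qed
  then show ?thesis using assms(3) by blast
qed

lemma rank_strict:
  assumes "finite A" "t \<in> A" "t < u"
  shows "rank A t < rank A u"
  unfolding rank_def
proof (rule psubset_card_mono)
  have "{s\<in>A. s < t} \<subseteq> {s\<in>A. s < u}" using assms(3) by auto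
  moreover have "t \<in> {s\<in>A. s < u}" "t \<notin> {s\<in>A. s < t}" using assms(2,3) by auto
  ultimately show "{s\<in>A. s < t} \<subset> {s\<in>A. s < u}" by blast
qed (use assms(1) in simp)

lemma rank_auts: "g \<in> auts S \<Longrightarrow> rank S (g t) = rank S t"
  unfolding rank_def by (rule arg_cong[of _ _ card]) (auto simp: auts_cmp_fix)

text \<open>Ranks replace the explicit end points because they are visibly invariant under
  \<open>auts S\<close>.\<close>

lemma gap_eq:
  assumes "finite S" "j \<le> card S"
  shows "gap S j = {t. t \<notin> S \<and> rank S t = j}"
proof (rule Set.set_eqI)
  fix t
  let ?a = "sorted_list_of_set S"
  have g: "t \<in> gap S j \<longleftrightarrow> (0 < j \<longrightarrow> ?a ! (j - 1) < t) \<and> (j < card S \<longrightarrow> t < ?a ! j)"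
    by (simp add: gap_def Let_def)
  have nS: "?a ! i \<in> S" if "i < card S" for i using that assms(1) nth_mem[of i ?a] by simp
  have ex: "\<exists>i<card S. t = ?a ! i" if "t \<in> S"
    using that assms(1) by (metis in_set_conv_nth length_sorted_list_of_set set_sorted_list_of_set)
  have mono: "?a ! i < ?a ! j" if "i < j" "j < card S" for i j
    using that strict_sorted_list_of_set[of S] by (simp add: sorted_wrt_iff_nth_less)
  have mono_le: "?a ! i \<le> ?a ! j" if "i \<le> j" "j < card S" for i j
    using mono[of i j] that by (cases "i = j") auto
  show "t \<in> gap S j \<longleftrightarrow> t \<in> {t. t \<notin> S \<and> rank S t = j}"
  proof
    assume "t \<in> gap S j"
    then have 1: "0 < j \<Longrightarrow> ?a ! (j - 1) < t" and 2: "j < card S \<Longrightarrow> t < ?a ! j" using g by auto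
    have "j \<le> rank S t"
    proof (cases "j = 0")
      case False
      then have "j - 1 < rank S t" using nth_less_rank[OF assms(1), of "j - 1" t] assms(2) 1 by simp
      then show ?thesis by simp
    qed simp
    moreover have "rank S t \<le> j"
    proof (cases "j < card S")
      case True
      then show ?thesis using nth_less_rank[OF assms(1) True, of t] 2 by simp
    next
      case False
      then show ?thesis using rank_le_card[OF assms(1), of t] by simp
    qed
    moreover have "t \<notin> S"
    proof
      assume "t \<in> S"
      then obtain i where i: "i < card S" "t = ?a ! i" using ex by blast
      show False
      proof (cases "i < j")
        case True
        then have "?a ! i \<le> ?a ! (j - 1)" using assms(2) by (intro mono_le) auto
        then show False using 1 i True by simp
      next
        case False
        then have "?a ! j \<le> ?a ! i" using i by (intro mono_le) auto
        then show False using 2 i False by simp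
      qed
    qed
    ultimately show "t \<in> {t. t \<notin> S \<and> rank S t = j}" by simp
  next
    assume t: "t \<in> {t. t \<notin> S \<and> rank S t = j}"
    have "0 < j \<longrightarrow> ?a ! (j - 1) < t"
      using nth_less_rank[OF assms(1), of "j - 1" t] t assms(2) by auto
    moreover have "j < card S \<longrightarrow> t < ?a ! j"
    proof
      assume j: "j < card S"
      have "\<not> ?a ! j < t" using nth_less_rank[OF assms(1) j, of t] t by simp
      moreover have "?a ! j \<noteq> t" using nS[OF j] t by auto
      ultimately show "t < ?a ! j" by simp
    qed
    ultimately show "t \<in> gap S j" unfolding g ..
  qed
qed

lemma sorted_list_image:
  assumes "g \<in> auts S" "finite A"
  shows "sorted_list_of_set (g ` A) = map g (sorted_list_of_set A)"
proof (rule sorted_distinct_set_unique)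
  show "sorted (map g (sorted_list_of_set A))"
    unfolding sorted_map by (rule sorted_wrt_mono_rel[of _ "(\<le>)"]) (auto simp: auts_le[OF assms(1)])
  show "distinct (map g (sorted_list_of_set A))"
    using auts_inj[OF assms(1)] by (simp add: distinct_map)
qed (use assms in auto)

lemma sorted_list_rank:
  assumes "finite A" "i < card A"
  shows "rank A (sorted_list_of_set A ! i) = i"
proof -
  let ?a = "sorted_list_of_set A"
  have mono: "?a ! i < ?a ! j \<longleftrightarrow> i < j" if "i < card A" "j < card A" for i j
  proof -
    have *: "?a ! i < ?a ! j" if "i < j" "j < card A" for i j
      using that strict_sorted_list_of_set[of A] by (simp add: sorted_wrt_iff_nth_less)
    show ?thesis using *[of i j] *[of j i] that by (cases i j rule: linorder_cases) auto
  qed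
  have "i' < rank A (?a ! i) \<longleftrightarrow> i' < i" if "i' < card A" for i'
    using nth_less_rank[OF assms(1) that, of "?a ! i"] mono[OF that assms(2)] by simp
  note * = this
  have "\<not> i < rank A (?a ! i)" using *[OF assms(2)] by simp
  moreover have "\<not> rank A (?a ! i) < i" using *[of "rank A (?a ! i)"] assms(2) by auto
  ultimately show ?thesis by simp
qed

text \<open>Serves to recover the entries of a point from its stabilizer: an automorphism fixing all
  other relevant values can still move \<open>t\<close>.\<close>

lemma exists_moving:
  assumes "finite A" "t \<notin> A"
  shows "\<exists>g\<in>auts A. g t \<noteq> t"
proof -
  have "\<exists>g\<in>auts A. g t = pred_point A t"
  proof (rule auts_move[OF assms(1)], intro ballI)
    fix s assume s: "s \<in> A"
    then have "s \<noteq> t" using assms(2) by auto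
    then show "(s < t \<longleftrightarrow> s < pred_point A t) \<and> (t < s \<longleftrightarrow> pred_point A t < s)"
      using pred_point(1)[OF assms(1), of t] pred_point(2)[OF assms(1) s, of t] by linarith
  qed
  then show ?thesis using pred_point(1)[OF assms(1), of t] by (metis less_irrefl)
qed

text \<open>Fix \<open>S\<close> and send the \<open>i\<close>-th element of \<open>C\<close> in
  each gap to the \<open>i\<close>-th entry of the tuple prescribed there. This is increasing within
  a gap by construction and across gaps because ranks are kept, so it extends to the line.\<close>

lemma exists_standard:
  assumes S: "finite S" and C: "finite C"
    and b: "\<And>j. j \<le> card S \<Longrightarrow> b j \<in> increasing_tuples (gap S j) (card {t\<in>C. t \<notin> S \<and> rank S t = j})"
  shows "\<exists>g\<in>auts S. \<forall>j\<le>card S. map g (sorted_list_of_set {t\<in>C. t \<notin> S \<and> rank S t = j}) = b j"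
proof -
  define A where "A j = {t\<in>C. t \<notin> S \<and> rank S t = j}" for j
  have fA: "finite (A j)" for j using C by (simp add: A_def)
  have len: "length (b j) = card (A j)" and srt: "sorted_wrt (<) (b j)" and sub: "set (b j) \<subseteq> gap S j"
    if "j \<le> card S" for j
    using b[OF that] by (auto simp: increasing_tuples_def A_def)
  define f where "f t = (if t \<in> S then t else b (rank S t) ! rank (A (rank S t)) t)" for t
  have rk: "rank (A j) t < card (A j)" if "t \<in> A j" for t j
    unfolding rank_def using that fA[of j] by (intro psubset_card_mono) auto
  have fC: "f t \<notin> S \<and> rank S (f t) = rank S t" if t: "t \<in> C" "t \<notin> S" for t
  proof -
    have tA: "t \<in> A (rank S t)" using t by (simp add: A_def)
    have j: "rank S t \<le> card S" by (rule rank_le_card[OF S])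
    have "f t \<in> set (b (rank S t))" using t rk[OF tA] len[OF j] by (simp add: f_def)
    then have "f t \<in> gap S (rank S t)" using sub[OF j] by auto
    then show ?thesis using gap_eq[OF S j] by simp
  qed
  have mono: "f t < f u" if tu: "t \<in> S \<union> C" "u \<in> S \<union> C" "t < u" for t u
  proof -
    consider "t \<in> S" "u \<in> S" | "t \<in> S" "u \<notin> S" | "t \<notin> S" "u \<in> S" | "t \<notin> S" "u \<notin> S" by blast
    then show ?thesis
    proof cases
      case 1 then show ?thesis using tu by (simp add: f_def)
    next
      case 2
      then have "u \<in> C" using tu by simp
      then have "t < f u" using rank_eq_less[OF S, of "f u" u t] fC[of u] 2 tu by simp
      then show ?thesis using 2 by (simp add: f_def)
    next
      case 3
      then have "t \<in> C" using tu by simp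
      then have "\<not> u < f t" "f t \<noteq> u" using rank_eq_less[OF S, of "f t" t u] fC[of t] 3 tu by auto
      then show ?thesis using 3 by (simp add: f_def)
    next
      case 4
      then have tC: "t \<in> C" "u \<in> C" using tu by auto
      show ?thesis
      proof (cases "rank S t = rank S u")
        case True
        let ?j = "rank S t"
        have j: "?j \<le> card S" by (rule rank_le_card[OF S])
        have mem: "t \<in> A ?j" "u \<in> A ?j" using 4 tC True by (auto simp: A_def)
        have "rank (A ?j) t < rank (A ?j) u"
          by (rule rank_strict[OF fA mem(1) tu(3)])
        then have "b ?j ! rank (A ?j) t < b ?j ! rank (A ?j) u"
          using srt[OF j] rk[OF mem(2)] len[OF j] by (simp add: sorted_wrt_iff_nth_less)
        moreover have "f t = b ?j ! rank (A ?j) t" unfolding f_def using 4 by (simp only: if_False)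
        moreover have "f u = b ?j ! rank (A ?j) u" unfolding f_def True using 4 by (simp only: if_False)
        ultimately show ?thesis by simp
      next
        case False
        then have "rank S t < rank S u" using rank_mono[OF S, of t u] tu by simp
        then have "rank S (f t) < rank S (f u)" using fC tC 4 by simp
        then show ?thesis using rank_mono[OF S, of "f u" "f t"] by (meson linorder_not_less)
      qed
    qed
  qed
  then obtain g where g: "g \<in> auts {}" "\<forall>t\<in>S \<union> C. g t = f t"
    using strict_mono_on_extends[of "S \<union> C" f] S C by auto
  have "g \<in> auts S" using g by (auto simp: auts_def f_def)
  moreover have "map g (sorted_list_of_set (A j)) = b j" if j: "j \<le> card S" for j
  proof (rule nth_equalityI)
    fix i assume "i < length (map g (sorted_list_of_set (A j)))"
    then have i: "i < card (A j)" by simp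
    let ?t = "sorted_list_of_set (A j) ! i"
    have "?t \<in> A j" using i fA[of j] nth_mem[of i "sorted_list_of_set (A j)"] by simp
    then have "?t \<in> C" "?t \<notin> S" "rank S ?t = j" by (auto simp: A_def)
    then show "map g (sorted_list_of_set (A j)) ! i = b j ! i"
      using g(2) i sorted_list_rank[OF fA i] by (simp add: f_def)
  qed (simp add: len j)
  ultimately show ?thesis unfolding A_def by blast
qed

section \<open>Integration over coded sets\<close>

text \<open>Products and coproducts of tuple spaces both embed equivariantly into finitely many
  copies of the set of real lists, indexed by \<open>lab\<close>. Orbit types and integrals are
  computed once for this common form.\<close>

locale coded_gset =
  fixes X :: "'a gset" and lab :: "'a \<Rightarrow> 'i" and code :: "'a \<Rightarrow> real list" and I :: "'i set" and n :: "'i \<Rightarrow> nat"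
  assumes finite_I: "finite I"
    and lab: "x \<in> points X \<Longrightarrow> lab x \<in> I" and length_code: "x \<in> points X \<Longrightarrow> length (code x) = n (lab x)"
    and inj: "x \<in> points X \<Longrightarrow> y \<in> points X \<Longrightarrow> lab x = lab y \<Longrightarrow> code x = code y \<Longrightarrow> x = y"
    and act: "x \<in> points X \<Longrightarrow> g \<in> auts {} \<Longrightarrow> act X g x \<in> points X \<and> lab (act X g x) = lab x \<and> code (act X g x) = map g (code x)"
    and ext: "g \<in> auts {} \<Longrightarrow> act X g \<in> extensional (points X)"
begin

lemma actS: "x \<in> points X \<Longrightarrow> g \<in> auts S \<Longrightarrow> act X g x \<in> points X \<and> lab (act X g x) = lab x \<and> code (act X g x) = map g (code x)"
  using act auts_mono[of "{}" S] by blast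

lemma orbit_eq: "x \<in> points X \<Longrightarrow> orbit (fixing S) (act X) x = {y \<in> points X. lab y = lab x \<and> code y \<in> orb S (code x)}"
proof (intro equalityI subsetI)
  fix y assume x: "x \<in> points X" and "y \<in> orbit (fixing S) (act X) x"
  then obtain g where "g \<in> auts S" "y = act X g x" by (auto simp: orbit_def carrier_fixing)
  then show "y \<in> {y \<in> points X. lab y = lab x \<and> code y \<in> orb S (code x)}"
    using actS[OF x] by (auto simp: orb_def)
next
  fix y assume x: "x \<in> points X" and y: "y \<in> {y \<in> points X. lab y = lab x \<and> code y \<in> orb S (code x)}"
  then obtain g where g: "g \<in> auts S" "code y = map g (code x)" by (auto simp: orb_def)
  have "y = act X g x" using y g actS[OF x g(1)] by (intro inj) auto
  then show "y \<in> orbit (fixing S) (act X) x" using g by (auto simp: orbit_def carrier_fixing)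
qed

definition codes_at :: "'i \<Rightarrow> real list set" where
  "codes_at i = code ` {x \<in> points X. lab x = i}"

lemma codes_at_map: "g \<in> auts S \<Longrightarrow> map g c \<in> codes_at i \<longleftrightarrow> c \<in> codes_at i"
proof
  assume g: "g \<in> auts S"
  have *: "map h c \<in> codes_at i" if h: "h \<in> auts S" and c: "c \<in> codes_at i" for h c
  proof -
    from c obtain x where "x \<in> points X" "lab x = i" "code x = c" by (auto simp: codes_at_def)
    then show ?thesis using actS[OF _ h, of x] unfolding codes_at_def by (intro image_eqI[of _ _ "act X h x"]) auto
  qed
  show "c \<in> codes_at i" if "map g c \<in> codes_at i"
    using *[OF auts_inv(1)[OF g] that] inv_comp_auts[OF g, of c] by simp
  show "map g c \<in> codes_at i" if "c \<in> codes_at i" using *[OF g that] .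
qed

lemma codes_at_orb: "d \<in> orb S c \<Longrightarrow> d \<in> codes_at i \<longleftrightarrow> c \<in> codes_at i"
  by (auto simp: orb_def codes_at_map)

definition orbit_index :: "real set \<Rightarrow> ('i \<times> real list set) set" where
  "orbit_index S = (SIGMA i:I. {U \<in> orbs S (n i). repr U \<in> codes_at i})"

definition index_orbit :: "'i \<times> real list set \<Rightarrow> 'a set" where
  "index_orbit p = {x \<in> points X. lab x = fst p \<and> code x \<in> snd p}"

lemma orbit_indexE:
  assumes "p \<in> orbit_index S"
  obtains x where "x \<in> points X" "lab x = fst p" "code x = repr (snd p)" "snd p = orb S (code x)"
    "index_orbit p = orbit (fixing S) (act X) x"
proof -
  have U: "snd p \<in> orbs S (n (fst p))" "repr (snd p) \<in> codes_at (fst p)" using assms by (auto simp: orbit_index_def)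
  then obtain x where x: "x \<in> points X" "lab x = fst p" "code x = repr (snd p)" by (auto simp: codes_at_def)
  then have "snd p = orb S (code x)" using repr_in[OF U(1)] by simp
  then show thesis using that[OF x] orbit_eq[OF x(1), of S] x by (simp add: index_orbit_def)
qed

lemma index_orbit_bij: "bij_betw index_orbit (orbit_index S) (orbits (fixing S) (points X) (act X))"
  unfolding bij_betw_def
proof
  show "inj_on index_orbit (orbit_index S)"
  proof (rule inj_onI)
    fix p p' assume p: "p \<in> orbit_index S" and p': "p' \<in> orbit_index S" and eq: "index_orbit p = index_orbit p'"
    from p obtain x where x: "x \<in> points X" "lab x = fst p" "snd p = orb S (code x)" by (rule orbit_indexE)
    from p' obtain x' where x': "x' \<in> points X" "lab x' = fst p'" "snd p' = orb S (code x')" by (rule orbit_indexE)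
    have "x \<in> index_orbit p" using x orb_refl by (simp add: index_orbit_def)
    then have "x \<in> index_orbit p'" using eq by simp
    then have "lab x = fst p'" "code x \<in> orb S (code x')" using x' by (auto simp: index_orbit_def)
    then show "p = p'" using x x' orb_eq by (intro prod_eqI) auto
  qed
  show "index_orbit ` orbit_index S = orbits (fixing S) (points X) (act X)"
  proof (intro equalityI subsetI)
    fix O' assume "O' \<in> index_orbit ` orbit_index S"
    then obtain p where "p \<in> orbit_index S" "O' = index_orbit p" by auto
    then show "O' \<in> orbits (fixing S) (points X) (act X)"
      by (elim orbit_indexE) (auto simp: orbits_def)
  next
    fix O' assume "O' \<in> orbits (fixing S) (points X) (act X)"
    then obtain x where x: "x \<in> points X" "O' = orbit (fixing S) (act X) x" by (auto simp: orbits_def)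
    let ?U = "orb S (code x)"
    have "?U \<in> orbs S (n (lab x))" using length_code[OF x(1)] by (auto simp: orbs_def)
    moreover have "repr ?U \<in> codes_at (lab x)"
      using codes_at_orb[OF repr_orb[of S "code x"]] x by (auto simp: codes_at_def)
    ultimately have "(lab x, ?U) \<in> orbit_index S" using lab[OF x(1)] by (simp add: orbit_index_def)
    moreover have "O' = index_orbit (lab x, ?U)" using orbit_eq[OF x(1), of S] x(2) by (simp add: index_orbit_def)
    ultimately show "O' \<in> index_orbit ` orbit_index S" by blast
  qed
qed

lemma finite_orbit_index: "finite S \<Longrightarrow> finite (orbit_index S)"
  unfolding orbit_index_def using finite_I finite_orbs[of S] by (intro finite_SigmaI) auto

lemma finite_orbits: "finite S \<Longrightarrow> finite (orbits (fixing S) (points X) (act X))"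
  using finite_orbit_index bij_betw_finite[OF index_orbit_bij] by blast

definition slice :: "real set \<Rightarrow> 'a \<Rightarrow> nat \<Rightarrow> real set" where
  "slice S x j = {t \<in> set (code x). t \<notin> S \<and> rank S t = j}"

lemma slice_act: "x \<in> points X \<Longrightarrow> g \<in> auts S \<Longrightarrow> slice S (act X g x) j = g ` slice S x j"
  using actS[of x g S] auts_mem[of g S] rank_auts[of g S] by (auto simp: slice_def)

text \<open>Entries in \<open>S\<close> and repetitions are discarded, since the orbit varies freely
  only in the distinct entries inside the gaps.\<close>

definition orbit_type :: "real set \<Rightarrow> 'a \<Rightarrow> nat list" where
  "orbit_type S x = map (\<lambda>j. card (slice S x j)) [0..<Suc (card S)]"

lemma act_fixed_iff:
  assumes "x \<in> points X" "g \<in> auts S"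
  shows "act X g x = x \<longleftrightarrow> (\<forall>t\<in>set (code x). g t = t)"
proof
  assume "act X g x = x"
  then have "map g (code x) = code x" using actS[OF assms] by simp
  then show "\<forall>t\<in>set (code x). g t = t" by (metis list.map_ident map_eq_conv)
next
  assume "\<forall>t\<in>set (code x). g t = t"
  then have "map g (code x) = code x" by (simp add: map_idI)
  then show "act X g x = x" using actS[OF assms] assms by (intro inj) auto
qed

text \<open>The bijection lists, gap by gap, the distinct entries of the code in increasing order;
  that every standard tuple is reached is \<open>exists_standard\<close>.\<close>

lemma has_orbit_type:
  assumes S: "finite S" and x: "x \<in> points X"
  shows "has_orbit_type X S (orbit (fixing S) (act X) x) (orbit_type S x)"
  unfolding has_orbit_type_def
proof (intro conjI)
  show "length (orbit_type S x) = Suc (card S)" by (simp add: orbit_type_def)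
  let ?O = "orbit (fixing S) (act X) x"
  define h where "h y = map (\<lambda>j. sorted_list_of_set (slice S y j)) [0..<Suc (card S)]" for y
  have fin: "finite (slice S y j)" for y j by (simp add: slice_def)
  have h_act: "h (act X g y) = map (map g) (h y)" if "g \<in> auts S" "y \<in> points X" for g y
    using slice_act[OF that(2,1)] sorted_list_image[OF that(1) fin] by (simp add: h_def)
  have O: "y \<in> ?O \<longleftrightarrow> (\<exists>g\<in>auts S. y = act X g x)" for y
    by (auto simp: orbit_def carrier_fixing)
  have "bij_betw h ?O (standard_orbit S (orbit_type S x))"
    unfolding bij_betw_def
  proof
    show "inj_on h ?O"
    proof (rule inj_onI)
      fix y y' assume "y \<in> ?O" "y' \<in> ?O" and eq: "h y = h y'"
      then obtain g g' where g: "g \<in> auts S" "y = act X g x" and g': "g' \<in> auts S" "y' = act X g' x" using O by blast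
      have "g t = g' t" if "t \<in> set (code x)" for t
      proof (cases "t \<in> S")
        case True then show ?thesis using auts_fix[OF g(1)] auts_fix[OF g'(1)] by simp
      next
        case False
        let ?j = "rank S t"
        have j: "?j < Suc (card S)" using rank_le_card[OF S, of t] by simp
        have t: "t \<in> slice S x ?j" using that False by (simp add: slice_def)
        from eq have "map (map g) (h x) = map (map g') (h x)"
          unfolding g(2) g'(2) h_act[OF g(1) x] h_act[OF g'(1) x] .
        then have "map (map g) (h x) ! ?j = map (map g') (h x) ! ?j" by (rule arg_cong)
        then have "map g (sorted_list_of_set (slice S x ?j)) = map g' (sorted_list_of_set (slice S x ?j))"
          using j by (simp add: h_def del: upt_Suc)
        then show ?thesis using t fin[of x ?j] by simp
      qed
      then have "map g (code x) = map g' (code x)" by simp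
      then show "y = y'" using actS[OF x g(1)] actS[OF x g'(1)] g g' by (intro inj) auto
    qed
    show "h ` ?O = standard_orbit S (orbit_type S x)"
    proof (intro equalityI subsetI)
      fix xss assume "xss \<in> h ` ?O"
      then obtain y where y: "y \<in> ?O" "xss = h y" by (rule imageE) simp
      from y(1) obtain g where "g \<in> auts S" "y = act X g x" unfolding O by (rule bexE) simp
      then have g: "g \<in> auts S" "xss = h (act X g x)" using y(2) by simp_all
      let ?y = "act X g x"
      have card: "card (slice S ?y j) = card (slice S x j)" for j
        unfolding slice_act[OF x g(1)] by (rule card_image[OF auts_inj[OF g(1)]])
      show "xss \<in> standard_orbit S (orbit_type S x)"
        unfolding standard_orbit_def
      proof (intro CollectI conjI allI impI)
        show "length xss = length (orbit_type S x)" by (simp add: g h_def orbit_type_def)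
        fix j assume "j < length (orbit_type S x)"
        then have j: "j < Suc (card S)" by (simp add: orbit_type_def)
        have "slice S ?y j \<subseteq> gap S j" using j by (subst gap_eq[OF S]) (auto simp: slice_def)
        then show "xss ! j \<in> increasing_tuples (gap S j) (orbit_type S x ! j)"
          using j fin[of ?y j] card[of j] by (simp add: g h_def orbit_type_def increasing_tuples_def del: upt_Suc)
      qed
    next
      fix xss assume xss: "xss \<in> standard_orbit S (orbit_type S x)"
      have len: "length xss = Suc (card S)" using xss by (simp add: standard_orbit_def orbit_type_def)
      have "\<exists>g\<in>auts S. \<forall>j\<le>card S. map g (sorted_list_of_set {t \<in> set (code x). t \<notin> S \<and> rank S t = j}) = xss ! j"
      proof (rule exists_standard[OF S])
        fix j assume j: "j \<le> card S"
        have "xss ! j \<in> increasing_tuples (gap S j) (orbit_type S x ! j)"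
          using xss j by (simp add: standard_orbit_def orbit_type_def del: upt_Suc)
        then show "xss ! j \<in> increasing_tuples (gap S j) (card {t \<in> set (code x). t \<notin> S \<and> rank S t = j})"
          using j by (simp add: orbit_type_def slice_def del: upt_Suc)
      qed simp
      then obtain g where g: "g \<in> auts S" "\<And>j. j \<le> card S \<Longrightarrow> map g (sorted_list_of_set (slice S x j)) = xss ! j"
        unfolding slice_def by blast
      have "h (act X g x) = xss"
        unfolding h_act[OF g(1) x]
        by (rule nth_equalityI) (simp_all add: h_def len g(2) del: upt_Suc)
      moreover have "act X g x \<in> ?O" unfolding O using g(1) by (rule bexI[rotated]) simp
      ultimately show "xss \<in> h ` ?O" by (metis imageI)
    qed
  qed
  moreover have "\<forall>g\<in>carrier (fixing S). \<forall>y\<in>?O. h (act X g y) = map (map g) (h y)"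
    using h_act orbit_eq[OF x, of S] by (auto simp: carrier_fixing)
  ultimately show "\<exists>h. bij_betw h ?O (standard_orbit S (orbit_type S x)) \<and>
     (\<forall>g\<in>carrier (fixing S). \<forall>y\<in>?O. h (act X g y) = map (map g) (h y))" by blast
qed

text \<open>An equivariant bijection preserves stabilizers. The stabilizer of a point in
  \<open>auts S\<close> determines the finite set of its entries outside \<open>S\<close>, so
  \<open>code x\<close> and \<open>h x\<close> have the same entries there, and counting them gap by
  gap gives the type.\<close>

lemma orbit_type_unique:
  assumes S: "finite S" and x: "x \<in> points X" and t: "has_orbit_type X S (orbit (fixing S) (act X) x) ns"
  shows "ns = orbit_type S x"
proof -
  let ?O = "orbit (fixing S) (act X) x"
  obtain h where len: "length ns = Suc (card S)" and h: "bij_betw h ?O (standard_orbit S ns)"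
    and h_act: "\<And>g y. g \<in> auts S \<Longrightarrow> y \<in> ?O \<Longrightarrow> h (act X g y) = map (map g) (h y)"
    using t by (auto simp: has_orbit_type_def carrier_fixing)
  have xO: "x \<in> ?O" using orbit_eq[OF x, of S] x orb_refl by simp
  define V where "V = (\<Union>zs\<in>set (h x). set zs)"
  have hx: "h x \<in> standard_orbit S ns" using h xO by (auto simp: bij_betw_def)
  have lenx: "length (h x) = Suc (card S)" using hx len by (simp add: standard_orbit_def)
  have hxj: "h x ! j \<in> increasing_tuples (gap S j) (ns ! j)" if "j \<le> card S" for j
    using hx that len by (simp add: standard_orbit_def)
  have sub: "set (h x ! j) \<subseteq> {t. t \<notin> S \<and> rank S t = j}" if "j \<le> card S" for j
    using hxj[OF that] gap_eq[OF S that] by (auto simp: increasing_tuples_def)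
  have V: "t \<in> V \<longleftrightarrow> (\<exists>j\<le>card S. t \<in> set (h x ! j))" for t
  proof
    assume "t \<in> V"
    then obtain zs where "zs \<in> set (h x)" "t \<in> set zs" by (auto simp: V_def)
    then show "\<exists>j\<le>card S. t \<in> set (h x ! j)" using lenx by (metis in_set_conv_nth less_Suc_eq_le)
  next
    assume "\<exists>j\<le>card S. t \<in> set (h x ! j)"
    then obtain j where "j \<le> card S" "t \<in> set (h x ! j)" by auto
    then show "t \<in> V" using lenx nth_mem[of j "h x"] by (auto simp: V_def)
  qed
  have VS: "V \<inter> S = {}" using sub V by blast
  have fV: "finite V" by (simp add: V_def)
  have fixed: "(\<forall>t\<in>set (code x). g t = t) \<longleftrightarrow> (\<forall>t\<in>V. g t = t)" if g: "g \<in> auts S" for g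
  proof -
    have "act X g x = x \<longleftrightarrow> h (act X g x) = h x"
    proof
      assume "h (act X g x) = h x"
      moreover have "act X g x \<in> ?O" using g by (auto simp: orbit_def carrier_fixing)
      ultimately show "act X g x = x" using h xO by (auto simp: bij_betw_def inj_on_def)
    qed simp
    also have "\<dots> \<longleftrightarrow> map (map g) (h x) = h x" using h_act[OF g xO] by simp
    also have "\<dots> \<longleftrightarrow> (\<forall>zs\<in>set (h x). map g zs = zs)" using map_eq_conv[of "map g" "h x" "\<lambda>x. x"] by simp
    also have "\<dots> \<longleftrightarrow> (\<forall>zs\<in>set (h x). \<forall>t\<in>set zs. g t = t)"
      using map_eq_conv[of g _ "\<lambda>x. x"] by (intro ball_cong refl) simp
    also have "\<dots> \<longleftrightarrow> (\<forall>t\<in>V. g t = t)" unfolding V_def by blast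
    finally show ?thesis using act_fixed_iff[OF x g] by simp
  qed
  have eq: "set (code x) - S = V"
  proof (intro equalityI subsetI)
    fix t assume t: "t \<in> set (code x) - S"
    show "t \<in> V"
    proof (rule ccontr)
      assume "t \<notin> V"
      then obtain g where g: "g \<in> auts (S \<union> V)" "g t \<noteq> t" using exists_moving[of "S \<union> V" t] t S fV by auto
      have "g \<in> auts S" using g(1) auts_mono[of S "S \<union> V"] by auto
      from fixed[OF this] auts_fix[OF g(1)] t g(2) show False by auto
    qed
  next
    fix t assume t: "t \<in> V"
    show "t \<in> set (code x) - S"
    proof (rule ccontr)
      assume "t \<notin> set (code x) - S"
      then have "t \<notin> S \<union> set (code x)" using t VS by auto
      then obtain g where g: "g \<in> auts (S \<union> set (code x))" "g t \<noteq> t"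
        using exists_moving[of "S \<union> set (code x)" t] S by auto
      have "g \<in> auts S" using g(1) auts_mono[of S "S \<union> set (code x)"] by auto
      from fixed[OF this] auts_fix[OF g(1)] t g(2) show False by auto
    qed
  qed
  show ?thesis
  proof (rule nth_equalityI)
    fix j assume "j < length ns"
    then have j: "j \<le> card S" using len by simp
    have "slice S x j = {t \<in> V. rank S t = j}" using eq by (auto simp: slice_def)
    also have "\<dots> = set (h x ! j)" using V sub j by blast
    finally have "card (slice S x j) = card (set (h x ! j))" by simp
    also have "\<dots> = ns ! j"
      using hxj[OF j] distinct_card[of "h x ! j"] by (auto simp: increasing_tuples_def strict_sorted_iff)
    finally show "ns ! j = orbit_type S x ! j" using j by (simp add: orbit_type_def del: upt_Suc)
  qed (simp add: orbit_type_def len)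
qed

text \<open>Uniqueness of the orbit type resolves the choice in \<open>mu2\<close>. The sum of the
  type counts the entries outside \<open>S\<close>, which the slices partition, and its last
  component counts those above all of \<open>S\<close>.\<close>

lemma mu2_orbit:
  assumes S: "finite S" and x: "x \<in> points X"
  shows "mu2 X S (orbit (fixing S) (act X) x) = (orb_weight S (code x) :: 'k::field)"
proof -
  have some: "(SOME ns. has_orbit_type X S (orbit (fixing S) (act X) x) ns) = orbit_type S x"
    by (rule some_equality[where P = "has_orbit_type X S (orbit (fixing S) (act X) x)", OF has_orbit_type[OF S x]])
       (rule orbit_type_unique[OF S x])
  have last: "last (orbit_type S x) = card (slice S x (card S))" by (simp add: orbit_type_def last_map)
  have "slice S x (card S) = {t \<in> set (code x). \<forall>s\<in>S. s < t}"
  proof -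
    have "t \<notin> S \<and> rank S t = card S \<longleftrightarrow> (\<forall>s\<in>S. s < t)" for t
    proof
      assume "t \<notin> S \<and> rank S t = card S"
      then have "{s \<in> S. s < t} = S" using S by (intro card_subset_eq) (auto simp: rank_def)
      then show "\<forall>s\<in>S. s < t" by blast
    next
      assume "\<forall>s\<in>S. s < t"
      then have "{s \<in> S. s < t} = S" "t \<notin> S" by auto
      then show "t \<notin> S \<and> rank S t = card S" by (simp add: rank_def)
    qed
    then show ?thesis by (simp add: slice_def)
  qed
  then have l0: "last (orbit_type S x) = 0 \<longleftrightarrow> \<not> (\<exists>t\<in>set (code x). \<forall>s\<in>S. s < t)"
    unfolding last by auto
  have "sum_list (orbit_type S x) = (\<Sum>j<Suc (card S). card (slice S x j))"
    by (simp add: orbit_type_def sum_list_distinct_conv_sum_set lessThan_atLeast0 interv_sum_list_conv_sum_set_nat del: upt_Suc)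
  also have "\<dots> = card (\<Union>j<Suc (card S). slice S x j)"
    by (rule card_UN_disjoint[symmetric]) (auto simp: slice_def)
  also have "(\<Union>j<Suc (card S). slice S x j) = set (code x) - S"
    using rank_le_card[OF S] by (auto simp: slice_def less_Suc_eq_le)
  finally have "sum_list (orbit_type S x) = card (set (code x) - S)" .
  then show ?thesis unfolding mu2_def some Let_def orb_weight_def using l0 by simp
qed

text \<open>\<open>\<psi>\<close> is the integrand transported to lists and extended by zero off the
  codes of points. The set \<open>S\<close> chosen in \<open>gset_integral\<close> is unknown, but
  the iterated integrals do not mention it.\<close>

lemma integral_eq:
  fixes \<phi> :: "'a \<Rightarrow> 'k::field" and \<psi> :: "'i \<Rightarrow> real list \<Rightarrow> 'k"
  assumes inv: "finite T" "invariant_under X T \<phi>"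
    and \<psi>: "\<And>x. x \<in> points X \<Longrightarrow> \<psi> (lab x) (code x) = \<phi> x"
    and zero: "\<And>i c. \<psi> i c \<noteq> 0 \<Longrightarrow> \<exists>x\<in>points X. lab x = i \<and> code x = c"
  shows "gset_integral X \<phi> = (\<Sum>i\<in>I. lint (n i) (\<psi> i))"
proof -
  define S where "S = (SOME S. finite S \<and> invariant_under X S \<phi>)"
  have S: "finite S" "invariant_under X S \<phi>"
    unfolding S_def by (rule someI2[of _ T]; use inv in auto)+
  have z: "\<psi> i d = 0" if "d \<notin> codes_at i" for i d
    using zero[of i d] that unfolding codes_at_def by (metis (mono_tags, lifting) image_eqI mem_Collect_eq)
  have inv\<psi>: "inv_on S (\<psi> i)" for i
    unfolding inv_on_def
  proof (intro ballI allI)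
    fix g c assume g: "g \<in> auts S"
    show "\<psi> i (map g c) = \<psi> i c"
    proof (cases "c \<in> codes_at i")
      case True
      then obtain x where x: "x \<in> points X" "lab x = i" "code x = c" by (auto simp: codes_at_def)
      have "\<phi> (act X g x) = \<phi> x" using S(2) g x(1) by (simp add: invariant_under_def carrier_fixing)
      then show ?thesis using \<psi>[of "act X g x"] \<psi>[OF x(1)] actS[OF x(1) g] x by simp
    next
      case False
      then have "map g c \<notin> codes_at i" using codes_at_map[OF g] by blast
      then show ?thesis using False z[of c i] z[of "map g c" i] by simp
    qed
  qed
  have "gset_integral X \<phi> = (\<Sum>U\<in>orbits (fixing S) (points X) (act X). the_elem (\<phi> ` U) * mu2 X S U)"
    by (simp add: gset_integral_def Let_def S_def)
  also have "\<dots> = (\<Sum>p\<in>orbit_index S. the_elem (\<phi> ` index_orbit p) * mu2 X S (index_orbit p))"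
    by (rule sum.reindex_bij_betw[OF index_orbit_bij, symmetric])
  also have "\<dots> = (\<Sum>p\<in>orbit_index S. \<psi> (fst p) (repr (snd p)) * orb_weight S (repr (snd p)))"
  proof (rule sum.cong[OF refl])
    fix p assume "p \<in> orbit_index S"
    then obtain x where x: "x \<in> points X" "lab x = fst p" "code x = repr (snd p)"
      "index_orbit p = orbit (fixing S) (act X) x" by (rule orbit_indexE)
    have "\<phi> ` index_orbit p = {\<phi> x}"
    proof (intro equalityI subsetI)
      fix v assume "v \<in> \<phi> ` index_orbit p"
      then obtain g where "g \<in> auts S" "v = \<phi> (act X g x)" unfolding x(4) by (auto simp: orbit_def carrier_fixing)
      then show "v \<in> {\<phi> x}" using S(2) x(1) by (simp add: invariant_under_def carrier_fixing)
    next
      fix v assume "v \<in> {\<phi> x}"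
      then show "v \<in> \<phi> ` index_orbit p" unfolding x(4) using orbit_eq[OF x(1), of S] x(1) orb_refl by auto
    qed
    then show "the_elem (\<phi> ` index_orbit p) * mu2 X S (index_orbit p) =
        \<psi> (fst p) (repr (snd p)) * orb_weight S (repr (snd p))"
      using \<psi>[OF x(1)] mu2_orbit[OF S(1) x(1), where 'k = 'k] x by simp
  qed
  \<comment> \<open>Orbits of lists that are not codes contribute nothing, since
    \<open>\<psi>\<close> vanishes there.\<close>
  also have "\<dots> = (\<Sum>p\<in>(SIGMA i:I. orbs S (n i)). \<psi> (fst p) (repr (snd p)) * orb_weight S (repr (snd p)))"
  proof (rule sum.mono_neutral_left)
    show "finite (SIGMA i:I. orbs S (n i))" using finite_I finite_orbs[OF S(1)] by blast
    show "orbit_index S \<subseteq> (SIGMA i:I. orbs S (n i))" by (auto simp: orbit_index_def)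
    show "\<forall>p\<in>(SIGMA i:I. orbs S (n i)) - orbit_index S. \<psi> (fst p) (repr (snd p)) * orb_weight S (repr (snd p)) = 0"
    proof
      fix p assume "p \<in> (SIGMA i:I. orbs S (n i)) - orbit_index S"
      then have "repr (snd p) \<notin> codes_at (fst p)" by (auto simp: orbit_index_def)
      then show "\<psi> (fst p) (repr (snd p)) * orb_weight S (repr (snd p)) = 0"
        using z[of "repr (snd p)" "fst p"] by simp
    qed
  qed
  also have "\<dots> = (\<Sum>i\<in>I. orb_sum S (n i) (\<psi> i))"
    unfolding orb_sum_def using finite_I finite_orbs[OF S(1)] by (subst sum.Sigma) (auto simp: split_def)
  also have "\<dots> = (\<Sum>i\<in>I. lint (n i) (\<psi> i))"
    by (simp add: orb_sum_eq_lint[OF S(1) inv\<psi>])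
  finally show ?thesis .
qed

end

section \<open>Ruffles and their codes\<close>

fun moves_left :: "ruffle_step \<Rightarrow> bool" where
  "moves_left Right_step \<longleftrightarrow> False"
| "moves_left _ \<longleftrightarrow> True"

fun moves_right :: "ruffle_step \<Rightarrow> bool" where
  "moves_right Left_step \<longleftrightarrow> False"
| "moves_right _ \<longleftrightarrow> True"

definition read_left :: "ruffle_step list \<Rightarrow> nat \<Rightarrow> nat" where
  "read_left c i = length (filter moves_left (take i c))"

definition read_right :: "ruffle_step list \<Rightarrow> nat \<Rightarrow> nat" where
  "read_right c i = length (filter moves_right (take i c))"

definition allowed :: "letter \<Rightarrow> letter \<Rightarrow> bool \<Rightarrow> letter option \<Rightarrow> bool" where
  "allowed a b final d \<longleftrightarrow> (if a = b then d = Some a else d = None \<longrightarrow> \<not> final)"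

text \<open>A description position by position, which can be compared with a ruffle directly;
  \<open>codes\<close> is its recursive form. A collision is the final step exactly if no letters
  remain in either word, so the third argument of \<open>allowed\<close> matches the condition in
  \<open>marks\<close>.\<close>

definition is_code :: "weight \<Rightarrow> weight \<Rightarrow> ruffle_step list \<Rightarrow> bool" where
  "is_code l r c \<longleftrightarrow> length (filter moves_left c) = length l \<and> length (filter moves_right c) = length r \<and>
     (\<forall>i<length c. \<forall>d. c ! i = Collision d \<longrightarrow>
        allowed (l ! read_left c i) (r ! read_right c i) (Suc i = length c) d)"

lemma read_Cons [simp]:
  "read_left (s # c) 0 = 0" "read_right (s # c) 0 = 0"
  "read_left (s # c) (Suc i) = (if moves_left s then Suc (read_left c i) else read_left c i)"
  "read_right (s # c) (Suc i) = (if moves_right s then Suc (read_right c i) else read_right c i)"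
  by (simp_all add: read_left_def read_right_def)

lemma all_less_Suc: "(\<forall>i<Suc n. P i) \<longleftrightarrow> P 0 \<and> (\<forall>i<n. P (Suc i))"
  using less_Suc_eq_0_disj by auto

lemma mem_marks: "d \<in> marks a b l r \<longleftrightarrow> allowed a b (l = [] \<and> r = []) d"
proof (cases d)
  case None
  then show ?thesis by (simp add: marks_def allowed_def)
next
  case (Some x)
  then show ?thesis by (cases x; cases a; cases b) (simp_all add: marks_def allowed_def)
qed

text \<open>Every step consumes at least one letter.\<close>

lemma is_code_empty: "is_code l r c \<Longrightarrow> c = [] \<longleftrightarrow> l = [] \<and> r = []"
proof -
  assume c: "is_code l r c"
  have "moves_left s \<or> moves_right s" for s by (cases s) auto
  then show ?thesis using c by (cases c) (auto simp: is_code_def split: if_splits)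
qed

lemma codes_iff_is_code: "c \<in> codes l r \<longleftrightarrow> is_code l r c"
proof (induction c arbitrary: l r)
  case Nil
  show ?case by (cases l; cases r) (auto simp: is_code_def)
next
  case (Cons s c)
  show ?case
  proof (cases s)
    case Left_step
    have "is_code l r (Left_step # c) \<longleftrightarrow> (\<exists>a l'. l = a # l' \<and> is_code l' r c)"
      by (cases l) (auto simp: is_code_def all_less_Suc)
    moreover have "Left_step # c \<in> codes l r \<longleftrightarrow> (\<exists>a l'. l = a # l' \<and> c \<in> codes l' r)"
      by (cases l; cases r) auto
    ultimately show ?thesis using Cons Left_step by simp
  next
    case Right_step
    have "is_code l r (Right_step # c) \<longleftrightarrow> (\<exists>b r'. r = b # r' \<and> is_code l r' c)"
      by (cases r) (auto simp: is_code_def all_less_Suc)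
    moreover have "Right_step # c \<in> codes l r \<longleftrightarrow> (\<exists>b r'. r = b # r' \<and> c \<in> codes l r')"
      by (cases l; cases r) auto
    ultimately show ?thesis using Cons Right_step by simp
  next
    case (Collision d)
    have "is_code l r (Collision d # c) \<longleftrightarrow> (\<exists>a l' b r'. l = a # l' \<and> r = b # r' \<and> allowed a b (c = []) d \<and> is_code l' r' c)"
      by (cases l; cases r) (auto simp: is_code_def all_less_Suc)
    moreover have "Collision d # c \<in> codes l r \<longleftrightarrow> (\<exists>a l' b r'. l = a # l' \<and> r = b # r' \<and> d \<in> marks a b l' r' \<and> c \<in> codes l' r')"
      by (cases l; cases r) auto
    moreover have "d \<in> marks a b l' r' \<and> c \<in> codes l' r' \<longleftrightarrow> allowed a b (c = []) d \<and> is_code l' r' c" for a b l' r'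
      using mem_marks[of d a b l' r'] is_code_empty[of l' r' c] Cons by auto
    ultimately show ?thesis using Collision by simp
  qed
qed

definition code_letter :: "weight \<Rightarrow> weight \<Rightarrow> ruffle_step list \<Rightarrow> nat \<Rightarrow> weight" where
  "code_letter l r c i = (case c ! i of Left_step \<Rightarrow> [l ! read_left c i] | Right_step \<Rightarrow> [r ! read_right c i]
     | Collision d \<Rightarrow> (case d of None \<Rightarrow> [] | Some x \<Rightarrow> [x]))"

lemma code_word_eq: "is_code l r c \<Longrightarrow> code_word l r c = concat (map (code_letter l r c) [0..<length c])"
proof (induction c arbitrary: l r)
  case Nil then show ?case by simp
next
  case (Cons s c)
  have C: "s # c \<in> codes l r" using Cons.prems by (simp add: codes_iff_is_code)
  have split: "[0..<length (s # c)] = 0 # map Suc [0..<length c]" by (simp add: upt_conv_Cons map_Suc_upt del: upt_Suc)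
  have shift: "map (code_letter l r (s # c)) (map Suc [0..<length c]) = map (code_letter l' r' c) [0..<length c]"
    if "l = (if moves_left s then a # l' else l')" "r = (if moves_right s then b # r' else r')" for a b l' r'
    using that by (auto simp: code_letter_def split: ruffle_step.split)
  show ?case
  proof (cases s)
    case Left_step
    then obtain a l' where l: "l = a # l'" "c \<in> codes l' r" using C by (cases l; cases r) auto
    have "code_word l' r c = concat (map (code_letter l' r c) [0..<length c])"
      using Cons.IH l(2) codes_iff_is_code by blast
    moreover have "map (code_letter l r (s # c)) (map Suc [0..<length c]) = map (code_letter l' r c) [0..<length c]"
      by (rule shift[of a l' undefined r]) (use Left_step l in auto)
    moreover have "code_letter l r (s # c) 0 = [a]" using Left_step l by (simp add: code_letter_def)
    moreover have "code_word l r (s # c) = a # code_word l' r c" using Left_step l by simp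
    ultimately show ?thesis unfolding split list.map concat.simps by (simp only: append_Cons append_Nil)
  next
    case Right_step
    then obtain b r' where r: "r = b # r'" "c \<in> codes l r'" using C by (cases l; cases r) auto
    have "code_word l r' c = concat (map (code_letter l r' c) [0..<length c])"
      using Cons.IH r(2) codes_iff_is_code by blast
    moreover have "code_word l r (s # c) = b # code_word l r' c" using Right_step r by (cases l) auto
    moreover have "map (code_letter l r (s # c)) (map Suc [0..<length c]) = map (code_letter l r' c) [0..<length c]"
      by (rule shift[of undefined l b r']) (use Right_step r in auto)
    moreover have "code_letter l r (s # c) 0 = [b]" using Right_step r by (simp add: code_letter_def)
    ultimately show ?thesis unfolding split list.map concat.simps by (simp only: append_Cons append_Nil)
  next
    case (Collision d)
    then obtain a l' b r' where lr: "l = a # l'" "r = b # r'" "c \<in> codes l' r'" using C by (cases l; cases r) auto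
    have "code_word l' r' c = concat (map (code_letter l' r' c) [0..<length c])"
      using Cons.IH lr(3) codes_iff_is_code by blast
    moreover have "map (code_letter l r (s # c)) (map Suc [0..<length c]) = map (code_letter l' r' c) [0..<length c]"
      by (rule shift[of a l' b r']) (use Collision lr in auto)
    moreover have "code_letter l r (s # c) 0 = (case d of None \<Rightarrow> [] | Some x \<Rightarrow> [x])"
      using Collision by (simp add: code_letter_def)
    moreover have "code_word l r (s # c) = (case d of None \<Rightarrow> [] | Some x \<Rightarrow> [x]) @ code_word l' r' c"
      using Collision lr by simp
    ultimately show ?thesis unfolding split list.map concat.simps by (simp only:)
  qed
qed

section \<open>Increasing enumerations of finite sets of positions\<close>

definition below :: "nat set \<Rightarrow> nat \<Rightarrow> nat" where
  "below A i = card {j\<in>A. j < i}"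

lemma below_strict: "i \<in> A \<Longrightarrow> i < j \<Longrightarrow> below A i < below A j"
proof -
  assume "i \<in> A" "i < j"
  have "finite {k\<in>A. k < j}" by (rule finite_subset[of _ "{..<j}"]) auto
  moreover have "{k\<in>A. k < i} \<subseteq> {k\<in>A. k < j}" using \<open>i < j\<close> by auto
  moreover have "i \<in> {k\<in>A. k < j}" "i \<notin> {k\<in>A. k < i}" using \<open>i \<in> A\<close> \<open>i < j\<close> by auto
  ultimately show ?thesis unfolding below_def by (intro psubset_card_mono psubsetI) auto
qed

lemma below_inj: "i \<in> A \<Longrightarrow> j \<in> A \<Longrightarrow> below A i = below A j \<Longrightarrow> i = j"
  using below_strict[of i A j] below_strict[of j A i] by (cases i j rule: linorder_cases) auto

text \<open>Computes the inverse of an increasing map by counting, which matches the letters of a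
  ruffle with the counters \<open>read_left\<close> and \<open>read_right\<close>.\<close>

lemma below_strict_mono:
  fixes f :: "nat \<Rightarrow> nat"
  assumes "strict_mono_on {..<m} f" "a < m"
  shows "below (f ` {..<m}) (f a) = a"
proof -
  have less: "f b < f a \<longleftrightarrow> b < a" if "b < m" for b
    using strict_mono_onD[OF assms(1), of a b] strict_mono_onD[OF assms(1), of b a] that assms(2)
    by (cases a b rule: linorder_cases) auto
  have "{j \<in> f ` {..<m}. j < f a} = f ` {..<a}" using less assms(2) by auto
  moreover have "inj_on f {..<a}"
    by (rule inj_on_subset[OF strict_mono_on_imp_inj_on[OF assms(1)]]) (use assms(2) in auto)
  ultimately show ?thesis by (simp add: below_def card_image)
qed

text \<open>The argument of a value is its place within the image, so the image determines the
  map.\<close>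

lemma strict_mono_on_unique:
  fixes f h :: "nat \<Rightarrow> nat"
  assumes "strict_mono_on {..<m} f" "strict_mono_on {..<m} h" "f ` {..<m} = h ` {..<m}"
    and "f \<in> extensional {..<m}" "h \<in> extensional {..<m}"
  shows "f = h"
proof (rule extensionalityI[OF assms(4,5)])
  fix a assume a: "a \<in> {..<m}"
  then have "below (f ` {..<m}) (f a) = below (f ` {..<m}) (h a)"
    using below_strict_mono[OF assms(1), of a] below_strict_mono[OF assms(2), of a] assms(3) by simp
  then show "f a = h a" using a assms(3) by (intro below_inj[of "f a" "f ` {..<m}" "h a"]) auto
qed

definition enum :: "nat set \<Rightarrow> nat \<Rightarrow> nat \<Rightarrow> nat" where
  "enum A m = (\<lambda>a\<in>{..<m}. sorted_list_of_set A ! a)"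

lemma enum:
  assumes "finite A" "card A = m"
  shows "strict_mono_on {..<m} (enum A m)" "enum A m ` {..<m} = A"
proof -
  show "strict_mono_on {..<m} (enum A m)"
    using strict_sorted_list_of_set[of A] assms
    by (auto simp: strict_mono_on_def enum_def sorted_wrt_iff_nth_less)
  have "enum A m ` {..<m} = (!) (sorted_list_of_set A) ` {..<m}"
    by (rule image_cong) (auto simp: enum_def)
  also have "\<dots> = set (sorted_list_of_set A)"
    using assms by (auto simp: set_conv_nth)
  finally show "enum A m ` {..<m} = A" using assms by simp
qed

section \<open>Translation between ruffles and codes\<close>

definition ruffle_step_at :: "weight \<Rightarrow> weight \<Rightarrow> ruffle \<Rightarrow> nat \<Rightarrow> ruffle_step" where
  "ruffle_step_at l r \<rho> i =
     (if collision l r \<rho> i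
      then Collision (if neutral_collision l r \<rho> i then marking \<rho> i else Some (left_letter l \<rho> i))
      else if i \<in> left \<rho> ` {..<length l} then Left_step else Right_step)"

definition ruffle_code :: "weight \<Rightarrow> weight \<Rightarrow> ruffle \<Rightarrow> ruffle_step list" where
  "ruffle_code l r \<rho> = map (ruffle_step_at l r \<rho>) [0..<len \<rho>]"

context
  fixes l r :: weight and \<rho> :: ruffle
  assumes \<rho>: "\<rho> \<in> marked_ruffles l r"
begin

private definition "A = left \<rho> ` {..<length l}"
private definition "B = right \<rho> ` {..<length r}"

lemma ruffle_facts: "strict_mono_on {..<length l} (left \<rho>)" "strict_mono_on {..<length r} (right \<rho>)"
  "A \<union> B = {..<len \<rho>}"
  using \<rho> by (auto simp: marked_ruffles_def A_def B_def)

lemma moves_left_at: "i < len \<rho> \<Longrightarrow> moves_left (ruffle_step_at l r \<rho> i) \<longleftrightarrow> i \<in> A"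
  using ruffle_facts(3) by (auto simp: ruffle_step_at_def collision_def A_def B_def)

lemma moves_right_at: "i < len \<rho> \<Longrightarrow> moves_right (ruffle_step_at l r \<rho> i) \<longleftrightarrow> i \<in> B"
  using ruffle_facts(3) by (auto simp: ruffle_step_at_def collision_def A_def B_def)

lemma inv_left: "i \<in> A \<Longrightarrow> inv_into {..<length l} (left \<rho>) i = below A i \<and> below A i < length l"
  using below_strict_mono[OF ruffle_facts(1)] strict_mono_on_imp_inj_on[OF ruffle_facts(1)]
  by (auto simp: A_def inv_into_f_f)

lemma inv_right: "i \<in> B \<Longrightarrow> inv_into {..<length r} (right \<rho>) i = below B i \<and> below B i < length r"
  using below_strict_mono[OF ruffle_facts(2)] strict_mono_on_imp_inj_on[OF ruffle_facts(2)]
  by (auto simp: B_def inv_into_f_f)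

lemma read_ruffle_code:
  assumes "i \<le> len \<rho>"
  shows "read_left (ruffle_code l r \<rho>) i = below A i" "read_right (ruffle_code l r \<rho>) i = below B i"
proof -
  have sub: "A \<subseteq> {..<len \<rho>}" "B \<subseteq> {..<len \<rho>}" using ruffle_facts(3) by auto
  show "read_left (ruffle_code l r \<rho>) i = below A i"
    unfolding read_left_def below_def length_filter_conv_card
    by (rule arg_cong[of _ _ card]) (use assms sub moves_left_at in \<open>auto simp: ruffle_code_def\<close>)
  show "read_right (ruffle_code l r \<rho>) i = below B i"
    unfolding read_right_def below_def length_filter_conv_card
    by (rule arg_cong[of _ _ card]) (use assms sub moves_right_at in \<open>auto simp: ruffle_code_def\<close>)
qed

lemma below_len: "below A (len \<rho>) = length l" "below B (len \<rho>) = length r"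
proof -
  have "{j\<in>A. j < len \<rho>} = A" "{j\<in>B. j < len \<rho>} = B" using ruffle_facts(3) by auto
  moreover have "card A = length l" "card B = length r"
    using strict_mono_on_imp_inj_on[OF ruffle_facts(1)] strict_mono_on_imp_inj_on[OF ruffle_facts(2)]
    by (simp_all add: A_def B_def card_image)
  ultimately show "below A (len \<rho>) = length l" "below B (len \<rho>) = length r" by (simp_all add: below_def)
qed

lemma ruffle_letters:
  "i \<in> A \<Longrightarrow> left_letter l \<rho> i = l ! below A i" "i \<in> B \<Longrightarrow> right_letter r \<rho> i = r ! below B i"
  using inv_left inv_right by (auto simp: left_letter_def right_letter_def)

lemmas ruffle_letters_image = ruffle_letters[unfolded A_def B_def]

lemma collision_iff: "collision l r \<rho> i \<longleftrightarrow> i \<in> A \<and> i \<in> B"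
  by (simp add: collision_def A_def B_def)

lemma neutral_iff: "neutral_collision l r \<rho> i \<longleftrightarrow> i \<in> A \<and> i \<in> B \<and> l ! below A i \<noteq> r ! below B i"
  using ruffle_letters by (auto simp: neutral_collision_def collision_iff)

lemma is_code_ruffle_code:
  assumes "\<rho> \<in> marked_ruffles' l r"
  shows "is_code l r (ruffle_code l r \<rho>)"
  unfolding is_code_def
proof (intro conjI allI impI)
  have "take (len \<rho>) (ruffle_code l r \<rho>) = ruffle_code l r \<rho>" by (simp add: ruffle_code_def)
  then show "length (filter moves_left (ruffle_code l r \<rho>)) = length l" "length (filter moves_right (ruffle_code l r \<rho>)) = length r"
    using read_ruffle_code[of "len \<rho>"] below_len by (simp_all add: read_left_def read_right_def)
  fix i d assume i: "i < length (ruffle_code l r \<rho>)" and d: "ruffle_code l r \<rho> ! i = Collision d"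
  have len: "i < len \<rho>" using i by (simp add: ruffle_code_def)
  have s: "ruffle_step_at l r \<rho> i = Collision d" using d len by (simp add: ruffle_code_def)
  then have AB: "i \<in> A" "i \<in> B" using collision_iff by (auto simp: ruffle_step_at_def split: if_splits)
  have m: "Suc i = len \<rho> \<Longrightarrow> neutral_collision l r \<rho> i \<Longrightarrow> marking \<rho> i \<noteq> None"
    using assms by (simp add: marked_ruffles'_def)
  show "allowed (l ! read_left (ruffle_code l r \<rho>) i) (r ! read_right (ruffle_code l r \<rho>) i) (Suc i = length (ruffle_code l r \<rho>)) d"
    using s AB m neutral_iff[of i] ruffle_letters len unfolding ruffle_step_at_def read_ruffle_code[OF less_imp_le[OF len]]
    by (auto simp: allowed_def collision_iff ruffle_code_def split: if_splits)
qed

lemma ruffle_weight_code: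
  assumes "\<rho> \<in> marked_ruffles' l r"
  shows "ruffle_weight l r \<rho> = code_word l r (ruffle_code l r \<rho>)"
proof -
  have "ruffle_letter l r \<rho> i = code_letter l r (ruffle_code l r \<rho>) i" if i: "i < len \<rho>" for i
  proof -
    have "i \<in> A \<or> i \<in> B" using ruffle_facts(3) i by auto
    then show ?thesis
      using i ruffle_letters[of i] neutral_iff[of i] collision_iff[of i] read_ruffle_code[of i]
      by (auto simp: ruffle_letter_def code_letter_def ruffle_code_def ruffle_step_at_def A_def[symmetric])
  qed
  then show ?thesis
    unfolding ruffle_weight_def code_word_eq[OF is_code_ruffle_code[OF assms]]
    by (intro arg_cong[of _ _ concat]) (simp add: ruffle_code_def)
qed

lemma left_image_code: "left \<rho> ` {..<length l} = {i. i < length (ruffle_code l r \<rho>) \<and> moves_left (ruffle_code l r \<rho> ! i)}"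
proof (rule Set.set_eqI)
  fix i
  have "i \<in> A \<longrightarrow> i < len \<rho>" using ruffle_facts(3) by blast
  then show "i \<in> left \<rho> ` {..<length l} \<longleftrightarrow> i \<in> {i. i < length (ruffle_code l r \<rho>) \<and> moves_left (ruffle_code l r \<rho> ! i)}"
    unfolding A_def[symmetric] using moves_left_at[of i] by (cases "i < len \<rho>") (simp_all add: ruffle_code_def)
qed

lemma right_image_code: "right \<rho> ` {..<length r} = {i. i < length (ruffle_code l r \<rho>) \<and> moves_right (ruffle_code l r \<rho> ! i)}"
proof (rule Set.set_eqI)
  fix i
  have "i \<in> B \<longrightarrow> i < len \<rho>" using ruffle_facts(3) by blast
  then show "i \<in> right \<rho> ` {..<length r} \<longleftrightarrow> i \<in> {i. i < length (ruffle_code l r \<rho>) \<and> moves_right (ruffle_code l r \<rho> ! i)}"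
    unfolding B_def[symmetric] using moves_right_at[of i] by (cases "i < len \<rho>") (simp_all add: ruffle_code_def)
qed

end

text \<open>The code shows which positions lie in each image, hence both maps, and at neutral
  collisions it shows the mark.\<close>

lemma ruffle_code_inj: "inj_on (ruffle_code l r) (marked_ruffles l r)"
proof (rule inj_onI)
  fix \<rho> \<rho>' assume R: "\<rho> \<in> marked_ruffles l r" "\<rho>' \<in> marked_ruffles l r" and eq: "ruffle_code l r \<rho> = ruffle_code l r \<rho>'"
  have len: "len \<rho> = len \<rho>'" using arg_cong[OF eq, of length] by (simp add: ruffle_code_def)
  have left: "left \<rho> = left \<rho>'"
    by (rule strict_mono_on_unique[of "length l"])
       (use R left_image_code[OF R(1)] left_image_code[OF R(2)] eq in \<open>auto simp: marked_ruffles_def PiE_def\<close>)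
  have right: "right \<rho> = right \<rho>'"
    by (rule strict_mono_on_unique[of "length r"])
       (use R right_image_code[OF R(1)] right_image_code[OF R(2)] eq in \<open>auto simp: marked_ruffles_def PiE_def\<close>)
  have neutral: "neutral_collision l r \<rho> i = neutral_collision l r \<rho>' i" for i
    using left right by (simp add: neutral_collision_def collision_def left_letter_def right_letter_def)
  have "marking \<rho> = marking \<rho>'"
  proof (rule extensionalityI[of _ "{i. neutral_collision l r \<rho> i}"])
    show "marking \<rho> \<in> extensional {i. neutral_collision l r \<rho> i}" "marking \<rho>' \<in> extensional {i. neutral_collision l r \<rho> i}"
    proof -
      have "Collect (neutral_collision l r \<rho>) = Collect (neutral_collision l r \<rho>')" by (intro arg_cong[of _ _ Collect] ext neutral)
      then show "marking \<rho>' \<in> extensional {i. neutral_collision l r \<rho> i}" using R(2) by (simp add: marked_ruffles_def PiE_def)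
      show "marking \<rho> \<in> extensional {i. neutral_collision l r \<rho> i}" using R(1) by (simp add: marked_ruffles_def PiE_def)
    qed
    fix i assume i: "i \<in> {i. neutral_collision l r \<rho> i}"
    then have "i \<in> left \<rho> ` {..<length l}" by (simp add: neutral_collision_def collision_def)
    then have "i < len \<rho>" using R(1) by (auto simp: marked_ruffles_def)
    then have "ruffle_step_at l r \<rho> i = ruffle_step_at l r \<rho>' i"
      using arg_cong[OF eq, of "\<lambda>c. c ! i"] len by (simp add: ruffle_code_def)
    then show "marking \<rho> i = marking \<rho>' i"
      using i neutral[of i] by (auto simp: ruffle_step_at_def neutral_collision_def)
  qed
  then show "\<rho> = \<rho>'" using len left right by simp
qed

lemma ruffle_code_surj:
  assumes c: "is_code l r c"
  shows "\<exists>\<rho>\<in>marked_ruffles' l r. ruffle_code l r \<rho> = c"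
proof -
  define A where "A = {i. i < length c \<and> moves_left (c ! i)}"
  define B where "B = {i. i < length c \<and> moves_right (c ! i)}"
  have card: "card A = length l" "card B = length r"
    using c by (simp_all add: A_def B_def is_code_def length_filter_conv_card)
  have fin: "finite A" "finite B" by (simp_all add: A_def B_def)
  have moves: "moves_left s \<or> moves_right s" for s by (cases s) auto
  have AB: "A \<union> B = {..<length c}" using moves by (auto simp: A_def B_def)
  \<comment> \<open>Neutrality of a collision does not depend on the marking, so a provisional
    ruffle suffices to name the domain of the true marking.\<close>
  define \<rho>0 where "\<rho>0 = \<lparr>len = length c, left = enum A (length l), right = enum B (length r), marking = (\<lambda>_. None)\<rparr>"
  define \<rho> where "\<rho> = \<rho>0\<lparr>marking := \<lambda>i\<in>{i. neutral_collision l r \<rho>0 i}. (case c ! i of Collision d \<Rightarrow> d | _ \<Rightarrow> None)\<rparr>"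
  have img: "left \<rho> ` {..<length l} = A" "right \<rho> ` {..<length r} = B"
    using enum(2)[OF fin(1) card(1)] enum(2)[OF fin(2) card(2)] by (simp_all add: \<rho>_def \<rho>0_def)
  have neutral: "neutral_collision l r \<rho> i = neutral_collision l r \<rho>0 i" for i
    by (simp add: neutral_collision_def collision_def left_letter_def right_letter_def \<rho>_def)
  have mem: "\<rho> \<in> marked_ruffles l r"
    unfolding marked_ruffles_def
  proof (intro CollectI conjI)
    show "strict_mono_on {..<length l} (left \<rho>)" "strict_mono_on {..<length r} (right \<rho>)"
      using enum(1)[OF fin(1) card(1)] enum(1)[OF fin(2) card(2)] by (simp_all add: \<rho>_def \<rho>0_def)
    show "{..<len \<rho>} = left \<rho> ` {..<length l} \<union> right \<rho> ` {..<length r}"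
      unfolding img using AB by (simp add: \<rho>_def \<rho>0_def)
    have "left \<rho> \<in> extensional {..<length l}" "right \<rho> \<in> extensional {..<length r}"
      by (simp_all add: \<rho>_def \<rho>0_def enum_def)
    moreover have "len \<rho> = length c" by (simp add: \<rho>_def \<rho>0_def)
    ultimately show "left \<rho> \<in> {..<length l} \<rightarrow>\<^sub>E {..<len \<rho>}" "right \<rho> \<in> {..<length r} \<rightarrow>\<^sub>E {..<len \<rho>}"
      using img by (auto simp: PiE_def A_def B_def)
    show "marking \<rho> \<in> {i. neutral_collision l r \<rho> i} \<rightarrow>\<^sub>E UNIV"
      unfolding neutral by (auto simp: \<rho>_def)
  qed
  have len: "len \<rho> = length c" by (simp add: \<rho>_def \<rho>0_def)
  have read: "read_left c i = below A i" "read_right c i = below B i" if "i \<le> length c" for i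
    unfolding read_left_def read_right_def below_def length_filter_conv_card
    by (rule arg_cong[of _ _ card]; use that in \<open>auto simp: A_def B_def\<close>)+
  have letters: "left_letter l \<rho> i = l ! read_left c i" if "i \<in> A" for i
    using ruffle_letters_image(1)[OF mem, of i] read(1)[of i] that unfolding img by (simp add: A_def)
  have letters': "right_letter r \<rho> i = r ! read_right c i" if "i \<in> B" for i
    using ruffle_letters_image(2)[OF mem, of i] read(2)[of i] that unfolding img by (simp add: B_def)
  have step: "ruffle_step_at l r \<rho> i = c ! i" if i: "i < length c" for i
  proof (cases "c ! i")
    case Left_step
    then have "i \<in> A" "i \<notin> B" using i by (auto simp: A_def B_def)
    then show ?thesis using Left_step by (simp add: ruffle_step_at_def collision_def img)
  next
    case Right_step
    then have "i \<notin> A" using i by (auto simp: A_def B_def)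
    then show ?thesis using Right_step by (simp add: ruffle_step_at_def collision_def img)
  next
    case (Collision d)
    then have AB: "i \<in> A" "i \<in> B" using i by (auto simp: A_def B_def)
    have al: "allowed (l ! read_left c i) (r ! read_right c i) (Suc i = length c) d"
      using c i Collision by (auto simp: is_code_def)
    have col: "collision l r \<rho> i" using AB by (simp add: collision_def img)
    have mk: "marking \<rho> i = d" if "neutral_collision l r \<rho> i"
      using that Collision unfolding neutral by (simp add: \<rho>_def)
    have "left_letter l \<rho> i = right_letter r \<rho> i \<Longrightarrow> d = Some (left_letter l \<rho> i)"
      using al letters[OF AB(1)] letters'[OF AB(2)] by (auto simp: allowed_def split: if_splits)
    then show ?thesis using col mk Collision by (auto simp: ruffle_step_at_def neutral_collision_def)
  qed
  have code: "ruffle_code l r \<rho> = c"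
    by (rule nth_equalityI) (simp_all add: ruffle_code_def len step)
  have "marking \<rho> i \<noteq> None" if i: "Suc i = len \<rho>" "neutral_collision l r \<rho> i" for i
  proof -
    have il: "i < length c" using i(1) len by simp
    have ci: "c ! i = Collision (marking \<rho> i)"
      using step[OF il] i(2) by (auto simp: ruffle_step_at_def neutral_collision_def)
    have "i \<in> A" "i \<in> B" "left_letter l \<rho> i \<noteq> right_letter r \<rho> i"
      using i(2) by (auto simp: neutral_collision_def collision_def img)
    then have "l ! read_left c i \<noteq> r ! read_right c i" using letters letters' by simp
    moreover have "allowed (l ! read_left c i) (r ! read_right c i) (Suc i = length c) (marking \<rho> i)"
      using c il ci by (auto simp: is_code_def)
    ultimately show ?thesis using i(1) len by (simp add: allowed_def)
  qed
  then have "\<rho> \<in> marked_ruffles' l r" using mem by (simp add: marked_ruffles'_def)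
  then show ?thesis using code by blast
qed

lemma ruffle_code_bij: "bij_betw (ruffle_code l r) (marked_ruffles' l r) (codes l r)"
  unfolding bij_betw_def
proof
  have sub: "marked_ruffles' l r \<subseteq> marked_ruffles l r" by (auto simp: marked_ruffles'_def)
  show "inj_on (ruffle_code l r) (marked_ruffles' l r)" by (rule inj_on_subset[OF ruffle_code_inj sub])
  show "ruffle_code l r ` marked_ruffles' l r = codes l r"
    using is_code_ruffle_code[OF subsetD[OF sub]] ruffle_code_surj codes_iff_is_code by blast
qed

section \<open>Morphisms given by kernels\<close>

lemma group_AutR: "group AutR"
proof (rule groupI)
  fix g h assume "g \<in> carrier AutR" "h \<in> carrier AutR"
  then show "g \<otimes>\<^bsub>AutR\<^esub> h \<in> carrier AutR"
    unfolding carrier_AutR using auts_comp by (simp add: AutR_def)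
next
  show "\<one>\<^bsub>AutR\<^esub> \<in> carrier AutR" unfolding carrier_AutR using auts_id by (simp add: AutR_def)
next
  fix g assume g: "g \<in> carrier AutR"
  then have "ginv g \<in> carrier AutR" "ginv g \<circ> g = id"
    unfolding carrier_AutR using auts_inv by (auto simp: fun_eq_iff)
  then show "\<exists>h\<in>carrier AutR. h \<otimes>\<^bsub>AutR\<^esub> g = \<one>\<^bsub>AutR\<^esub>" by (auto simp: AutR_def)
qed (auto simp: AutR_def comp_assoc)

context coded_gset
begin

lemma act_Bij:
  assumes g: "g \<in> auts {}"
  shows "act X g \<in> Bij (points X)"
proof -
  have "bij_betw (act X g) (points X) (points X)"
    unfolding bij_betw_def
  proof
    show "inj_on (act X g) (points X)"
    proof (rule inj_onI)
      fix x y assume x: "x \<in> points X" and y: "y \<in> points X" and eq: "act X g x = act X g y"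
      have "map g (code x) = map g (code y)" "lab x = lab y" using act[OF x g] act[OF y g] eq by auto
      then show "x = y" using x y auts_map_eq[OF g] by (intro inj) auto
    qed
    show "act X g ` points X = points X"
    proof (intro equalityI subsetI)
      fix y assume y: "y \<in> points X"
      let ?x = "act X (ginv g) y"
      have x: "?x \<in> points X" "lab ?x = lab y" "code ?x = map (ginv g) (code y)" using act[OF y auts_inv(1)[OF g]] by auto
      have "map g (map (ginv g) (code y)) = code y" by (simp add: map_idI auts_inv(2)[OF g])
      then have "act X g ?x = y" using act[OF x(1) g] x y by (intro inj) auto
      then show "y \<in> act X g ` points X" using x(1) by (metis imageI)
    qed (use act g in auto)
  qed
  then show ?thesis using ext[OF g] by (simp add: Bij_def)
qed

lemma is_gset: "is_gset X"
  unfolding is_gset_def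
proof (intro conjI ballI)
  have comp: "act X (g \<circ> h) = compose (points X) (act X g) (act X h)" if g: "g \<in> auts {}" and h: "h \<in> auts {}" for g h
  proof (rule extensionalityI[OF ext[OF auts_comp[OF g h]]])
    fix x assume x: "x \<in> points X"
    note hx = act[OF x h]
    have "act X (g \<circ> h) x = act X g (act X h x)"
      using act[OF x auts_comp[OF g h]] act[OF conjunct1[OF hx] g] hx by (intro inj) auto
    then show "act X (g \<circ> h) x = compose (points X) (act X g) (act X h) x" using x by (simp add: compose_eq)
  qed (simp add: compose_def)
  have "act X \<in> hom AutR (BijGroup (points X))"
    unfolding hom_def carrier_AutR using act_Bij comp by (auto simp: BijGroup_def AutR_def)
  then show "group_action AutR (points X) (act X)"
    by (simp add: group_action_def group_hom_def group_hom_axioms_def group_AutR group_BijGroup)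
  have "orbits AutR (points X) (act X) = orbits (fixing {}) (points X) (act X)"
    by (simp add: orbits_def orbit_def carrier_AutR carrier_fixing)
  then show "finite (orbits AutR (points X) (act X))" using finite_orbits[of "{}"] by simp
  fix x assume x: "x \<in> points X"
  \<comment> \<open>The entries of its code are a finite support of the point.\<close>
  have "carrier (fixing (set (code x))) \<subseteq> stabilizer AutR (act X) x"
    unfolding carrier_fixing stabilizer_def carrier_AutR
    using act_fixed_iff[OF x] auts_fix auts_mono[of "{}" "set (code x)"] by blast
  then show "\<exists>S. finite S \<and> carrier (fixing S) \<subseteq> stabilizer AutR (act X) x" by blast
qed

end

text \<open>The morphism given by a matrix of kernels whose indices are the labels; through it,
  decompositions in the ring of kernels become isomorphisms of objects.\<close>

definition kernel_mor :: "'a gset \<Rightarrow> ('a \<Rightarrow> 'i) \<Rightarrow> ('a \<Rightarrow> real list) \<Rightarrow> 'b gset \<Rightarrow> ('b \<Rightarrow> 'j) \<Rightarrow> ('b \<Rightarrow> real list) \<Rightarrow>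
   ('j \<Rightarrow> 'i \<Rightarrow> 'k::field kern) \<Rightarrow> 'b \<times> 'a \<Rightarrow> 'k" where
  "kernel_mor X lx cx Y ly cy K = (\<lambda>(y, x)\<in>points Y \<times> points X. entry (K (ly y) (lx x)) (cy y) (cx x))"

lemma kernel_mor_mors:
  assumes "coded_gset X lx cx I n" "coded_gset Y ly cy J m"
  shows "kernel_mor X lx cx Y ly cy K \<in> mors X Y"
proof -
  interpret X: coded_gset X lx cx I n by fact
  interpret Y: coded_gset Y ly cy J m by fact
  show ?thesis
    unfolding mors_def kernel_mor_def carrier_AutR using X.act Y.act by (auto simp: entry_map)
qed

lemma entry_sum: "finite J \<Longrightarrow> entry (\<Sum>j\<in>J. F j) a b = (\<Sum>j\<in>J. entry (F j) a b)"
  by (induction J rule: finite_induct) (simp_all add: zero_kern.rep_eq plus_kern.rep_eq)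

text \<open>The product of kernels integrates over all lists, composition only over codes of points
  of \<open>Y\<close>; \<open>supp\<close> makes the two agree. \<open>R\<close> is the matrix
  product of \<open>L\<close> and \<open>K\<close>.\<close>

lemma kernel_mor_comp:
  assumes X: "coded_gset X lx cx I n" and Y: "coded_gset Y ly cy J m" and Z: "coded_gset Z lz cz H p"
    and supp: "\<And>j i c x. j \<in> J \<Longrightarrow> i \<in> I \<Longrightarrow> entry (K j i) c x \<noteq> 0 \<Longrightarrow> \<exists>y\<in>points Y. ly y = j \<and> cy y = c"
    and R: "\<And>h i. h \<in> H \<Longrightarrow> i \<in> I \<Longrightarrow> (\<Sum>j\<in>J. L h j * K j i) = R h i"
  shows "comp_mor X Y Z (kernel_mor Y ly cy Z lz cz L) (kernel_mor X lx cx Y ly cy K) =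
    kernel_mor X lx cx Z lz cz R"
proof -
  interpret X: coded_gset X lx cx I n by fact
  interpret Y: coded_gset Y ly cy J m by fact
  interpret Z: coded_gset Z lz cz H p by fact
  have "gset_integral Y (\<lambda>y. kernel_mor Y ly cy Z lz cz L (z, y) * kernel_mor X lx cx Y ly cy K (y, x)) =
    entry (R (lz z) (lx x)) (cz z) (cx x)" if z: "z \<in> points Z" and x: "x \<in> points X" for z x
  proof -
    let ?\<phi> = "\<lambda>y. kernel_mor Y ly cy Z lz cz L (z, y) * kernel_mor X lx cx Y ly cy K (y, x)"
    let ?\<psi> = "\<lambda>j c. if j \<in> J then entry (L (lz z) j) (cz z) c * entry (K j (lx x)) c (cx x) else 0"
    have \<phi>: "?\<phi> y = ?\<psi> (ly y) (cy y)" if "y \<in> points Y" for y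
      using that z x Y.lab by (simp add: kernel_mor_def)
    have "gset_integral Y ?\<phi> = (\<Sum>j\<in>J. lint (m j) (?\<psi> j))"
    proof (rule Y.integral_eq[where T = "set (cz z) \<union> set (cx x)"])
      show "invariant_under Y (set (cz z) \<union> set (cx x)) ?\<phi>"
        unfolding invariant_under_def carrier_fixing
      proof (intro ballI)
        fix g y assume g: "g \<in> auts (set (cz z) \<union> set (cx x))" and y: "y \<in> points Y"
        have g0: "g \<in> auts {}" using g auts_mono[of "{}"] by blast
        have "map g (cz z) = cz z" "map g (cx x) = cx x" using g by (auto simp: auts_fix intro: map_idI)
        then have "entry (L (lz z) (ly y)) (cz z) (map g (cy y)) = entry (L (lz z) (ly y)) (cz z) (cy y)"
          "entry (K (ly y) (lx x)) (map g (cy y)) (cx x) = entry (K (ly y) (lx x)) (cy y) (cx x)"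
          using entry_map[OF g0, of "L (lz z) (ly y)" "cz z" "cy y"] entry_map[OF g0, of "K (ly y) (lx x)" "cy y" "cx x"] by simp_all
        then show "?\<phi> (act Y g y) = ?\<phi> y" using Y.act[OF y g0] y by (simp add: \<phi>)
      qed
      show "?\<psi> (ly y) (cy y) = ?\<phi> y" if "y \<in> points Y" for y using \<phi>[OF that] by simp
      show "\<exists>y\<in>points Y. ly y = j \<and> cy y = c" if "?\<psi> j c \<noteq> 0" for j c
        using that supp[of j "lx x" c "cx x"] X.lab[OF x] by (auto split: if_splits)
    qed simp
    also have "\<dots> = (\<Sum>j\<in>J. entry (L (lz z) j * K j (lx x)) (cz z) (cx x))"
    proof (rule sum.cong[OF refl])
      fix j assume j: "j \<in> J"
      have "entry (L (lz z) j * K j (lx x)) (cz z) (cx x) =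
        lint (m j) (\<lambda>c. entry (L (lz z) j) (cz z) c * entry (K j (lx x)) c (cx x))"
        unfolding entry_times
      proof (rule full_int_length)
        fix c assume "entry (L (lz z) j) (cz z) c * entry (K j (lx x)) c (cx x) \<noteq> 0"
        then obtain y where "y \<in> points Y" "ly y = j" "cy y = c" using supp[OF j X.lab[OF x], of c "cx x"] by auto
        then show "length c = m j" using Y.length_code by blast
      qed
      then show "lint (m j) (?\<psi> j) = entry (L (lz z) j * K j (lx x)) (cz z) (cx x)" using j by simp
    qed
    also have "\<dots> = entry (R (lz z) (lx x)) (cz z) (cx x)"
      by (simp add: R[OF Z.lab[OF z] X.lab[OF x], symmetric] entry_sum[OF Y.finite_I])
    finally show ?thesis .
  qed
  then show ?thesis
    unfolding comp_mor_def kernel_mor_def[of X lx cx Z] by (intro restrict_ext) auto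
qed

section \<open>The objects of the theorem\<close>

lemma increasing_tuples_conf: "increasing_tuples UNIV n = conf n (<)"
  by (auto simp: increasing_tuples_def conf_def sorted_wrt_iff_nth_less)

lemma points_tuples: "x \<in> points (tuples_gset n) \<longleftrightarrow> x \<in> conf n (<)"
  by (simp add: tuples_gset_def increasing_tuples_conf)

lemma act_tuples: "x \<in> conf n (<) \<Longrightarrow> act (tuples_gset n) g x = map g x"
  by (simp add: tuples_gset_def increasing_tuples_conf)

text \<open>Concatenation is injective here because the lengths of the two factors are
  fixed.\<close>

lemma coded_prod: "coded_gset (prod_gset (tuples_gset m) (tuples_gset n)) (\<lambda>_. ()) (\<lambda>(x, y). x @ y) {()} (\<lambda>_. m + n)"
proof -
  let ?X = "prod_gset (tuples_gset m) (tuples_gset n)"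
  have pts: "points ?X = conf m (<) \<times> conf n (<)"
    by (simp add: prod_gset_def tuples_gset_def increasing_tuples_conf)
  have ac: "act ?X g (x, y) = (map g x, map g y)" if "x \<in> conf m (<)" "y \<in> conf n (<)" for g x y
    using that by (simp add: prod_gset_def points_tuples act_tuples)
  show ?thesis
  proof (rule coded_gset.intro)
    fix x y assume "x \<in> points ?X" "y \<in> points ?X" "(case x of (x, y) \<Rightarrow> x @ y) = (case y of (x, y) \<Rightarrow> x @ y)"
    then show "x = y" unfolding pts by (auto simp: conf_length append_eq_append_conv)
  next
    fix g :: "real \<Rightarrow> real" and p assume p: "p \<in> points ?X" and g: "g \<in> auts {}"
    obtain x y where xy: "p = (x, y)" "x \<in> conf m (<)" "y \<in> conf n (<)" using p unfolding pts by auto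
    then show "act ?X g p \<in> points ?X \<and> () = () \<and> (case act ?X g p of (x, y) \<Rightarrow> x @ y) = map g (case p of (x, y) \<Rightarrow> x @ y)"
      unfolding xy(1) ac[OF xy(2,3)] pts using conf_map[OF g] by simp
  next
    fix g show "act ?X g \<in> extensional (points ?X)" by (simp add: prod_gset_def)
  next
    fix x assume "x \<in> points ?X"
    then show "length (case x of (x, y) \<Rightarrow> x @ y) = m + n" unfolding pts by (auto simp: conf_length)
  qed simp_all
qed

lemma coded_coprod:
  assumes fin: "finite I"
  shows "coded_gset (coprod_gset I (\<lambda>i. tuples_gset (n i))) fst snd I n"
proof -
  let ?X = "coprod_gset I (\<lambda>i. tuples_gset (n i))"
  have pts: "points ?X = (SIGMA i:I. conf (n i) (<))"
    by (simp add: coprod_gset_def tuples_gset_def increasing_tuples_conf)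
  have ac: "act ?X g (i, x) = (i, map g x)" if "i \<in> I" "x \<in> conf (n i) (<)" for g i x
    using that by (simp add: coprod_gset_def points_tuples act_tuples)
  show ?thesis
  proof (rule coded_gset.intro)
    fix x y assume "fst x = fst y" "snd x = snd y"
    then show "x = y" by (rule prod_eqI)
  next
    fix g :: "real \<Rightarrow> real" and p assume p: "p \<in> points ?X" and g: "g \<in> auts {}"
    obtain i x where ix: "p = (i, x)" "i \<in> I" "x \<in> conf (n i) (<)" using p unfolding pts by auto
    then show "act ?X g p \<in> points ?X \<and> fst (act ?X g p) = fst p \<and> snd (act ?X g p) = map g (snd p)"
      unfolding ix(1) ac[OF ix(2,3)] pts using conf_map[OF g] by simp
  next
    fix g show "act ?X g \<in> extensional (points ?X)" by (simp add: coprod_gset_def)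
  next
    fix x assume "x \<in> points ?X"
    then show "length (snd x) = n (fst x)" "fst x \<in> I" unfolding pts by (auto simp: conf_length)
  qed (rule fin)
qed

text \<open>\<open>E_rel\<close> compares neighbours only; the conditions between distant positions
  follow because both tuples are increasing.\<close>

lemma conf_rel_chain: "conf_rel (length w) (\<lambda>i. Some (w ! i)) (<) y x \<longleftrightarrow>
   y \<in> increasing_tuples UNIV (length w) \<and> x \<in> increasing_tuples UNIV (length w) \<and> E_rel w y x"
proof -
  have col: "colour_le (Some d) s t \<longleftrightarrow> (case d of Black \<Rightarrow> s \<le> t | White \<Rightarrow> t \<le> s)" for d s t by (cases d) auto
  have "(\<forall>i<length w. \<forall>j<length w. i < j \<longrightarrow> y ! i < x ! j \<and> x ! i < y ! j) \<longleftrightarrow>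
    (\<forall>i. Suc i < length w \<longrightarrow> y ! i < x ! Suc i \<and> x ! i < y ! Suc i)"
    if "y \<in> conf (length w) (<)" "x \<in> conf (length w) (<)"
  proof
    assume A: "\<forall>i. Suc i < length w \<longrightarrow> y ! i < x ! Suc i \<and> x ! i < y ! Suc i"
    show "\<forall>i<length w. \<forall>j<length w. i < j \<longrightarrow> y ! i < x ! j \<and> x ! i < y ! j"
    proof (intro allI impI)
      fix i j assume ij: "i < length w" "j < length w" "i < j"
      then have "y ! i < x ! Suc i \<and> x ! i < y ! Suc i" using A by auto
      moreover have "x ! Suc i \<le> x ! j \<and> y ! Suc i \<le> y ! j"
        using conf_less[OF that(1), of "Suc i" j] conf_less[OF that(2), of "Suc i" j] ij by (cases "Suc i = j") auto
      ultimately show "y ! i < x ! j \<and> x ! i < y ! j" by auto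
    qed
  qed auto
  then show ?thesis unfolding increasing_tuples_conf conf_rel_def E_rel_def col by blast
qed

lemma entry_chain: "entry (chain_idem (map Some w) [] [] :: 'k::comm_ring_1 kern) y x =
   of_bool (y \<in> increasing_tuples UNIV (length w) \<and> x \<in> increasing_tuples UNIV (length w) \<and> E_rel w y x)"
proof -
  have "conf_rel (length (map Some w) + length ([] :: letter option list) + length ([] :: letter option list))
      (\<lambda>i. (map Some w @ [] @ []) ! i) (two_chains (length (map Some w)) (length ([] :: letter option list))) =
    conf_rel (length w) (\<lambda>i. Some (w ! i)) (<)"
    unfolding list.size add_0_right length_map by (rule conf_rel_cong) (auto simp: two_chains_def)
  then show ?thesis unfolding chain_idem_def entry_conf_idem conf_rel_chain[symmetric] by simp
qed

lemma all_less_add: "(\<forall>i<m + n. P i) \<longleftrightarrow> (\<forall>i<m. P i) \<and> (\<forall>i<n. P (m + i))" for m n :: nat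
proof (intro iffI conjI allI impI)
  fix i assume "(\<forall>i<m. P i) \<and> (\<forall>i<n. P (m + i))" "i < m + n"
  then show "P i" by (cases "i < m") (auto dest: spec[of _ "i - m"])
qed auto

text \<open>As the chains are incomparable, the conditions separate, which makes the idempotent a
  Kronecker product.\<close>

lemma conf_rel_two_chains:
  assumes "length y = length l" "length x = length l"
  shows "conf_rel (length l + length r) (\<lambda>i. (map Some l @ map Some r) ! i) (two_chains 0 (length l)) (y @ y') (x @ x') \<longleftrightarrow>
    conf_rel (length l) (\<lambda>i. Some (l ! i)) (<) y x \<and> conf_rel (length r) (\<lambda>i. Some (r ! i)) (<) y' x'"
  using assms unfolding conf_rel_def conf_def by (auto simp: all_less_add nth_append two_chains_def)

lemma entry_two_chains:
  assumes "length y = length l" "length x = length l"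
  shows "entry (chain_idem [] (map Some l) (map Some r) :: 'k::comm_ring_1 kern) (y @ y') (x @ x') =
   of_bool (y \<in> increasing_tuples UNIV (length l) \<and> x \<in> increasing_tuples UNIV (length l) \<and> E_rel l y x \<and>
     y' \<in> increasing_tuples UNIV (length r) \<and> x' \<in> increasing_tuples UNIV (length r) \<and> E_rel r y' x')"
  unfolding chain_idem_def entry_conf_idem using conf_rel_two_chains[OF assms, of r y' x']
  by (simp add: conf_rel_chain)

lemma two_chains_support:
  assumes "entry (chain_idem [] (map Some l) (map Some r) :: 'k::comm_ring_1 kern) c x \<noteq> 0"
  shows "\<exists>p\<in>points (prod_gset (tuples_gset (length l)) (tuples_gset (length r))). (case p of (y, y') \<Rightarrow> y @ y') = c"
proof -
  have "c \<in> conf (length l + length r) (two_chains 0 (length l))"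
    using assms by (auto simp: chain_idem_def entry_conf_idem conf_rel_def of_bool_def split: if_splits)
  then have c: "length c = length l + length r" "\<And>i j. i < length c \<Longrightarrow> j < length c \<Longrightarrow> two_chains 0 (length l) i j \<Longrightarrow> c ! i < c ! j"
    by (auto simp: conf_def)
  have "take (length l) c \<in> conf (length l) (<)" "drop (length l) c \<in> conf (length r) (<)"
    using c by (auto simp: conf_def two_chains_def)
  then show ?thesis
    by (intro bexI[of _ "(take (length l) c, drop (length l) c)"])
       (auto simp: prod_gset_def tuples_gset_def increasing_tuples_conf)
qed

lemma entry_left_support:
  assumes "E * K = K" "entry K c x \<noteq> 0"
  shows "\<exists>y. entry E c y \<noteq> 0"
proof (rule ccontr)
  assume "\<not> ?thesis"
  then have "entry (E * K) c x = 0" by (simp add: entry_times full_int_def)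
  then show False using assms by simp
qed

lemma base_M: "base (M w) = tuples_gset (length w)"
  by (simp add: M_def Let_def)

theorem theorem5p18:
  fixes lam mu :: weight
  shows "(M lam \<otimes>\<^sub>K M mu :: (real list \<times> real list, 'k::field) kobj) \<cong>\<^sub>K
    kdirect_sum (marked_ruffles' lam mu) (\<lambda>\<rho>. M (ruffle_weight lam mu \<rho>))"
proof -
  let ?I = "marked_ruffles' lam mu" and ?w = "ruffle_weight lam mu"
  define e :: "'k kern" where "e = chain_idem [] (map Some lam) (map Some mu)"
  define E :: "ruffle \<Rightarrow> 'k kern" where "E \<rho> = chain_idem (map Some (?w \<rho>)) [] []" for \<rho>
  \<comment> \<open>The recursion starts with an empty merged chain.\<close>
  have "decomposes e (codes lam mu) (\<lambda>c. chain_idem (map Some ([] @ code_word lam mu c)) [] [])"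
    using decomposes_codes[of "[]" lam mu] by (simp add: e_def)
  then have "decomposes e ?I E"
  proof (rule decomposes_reindex[OF _ ruffle_code_bij])
    fix \<rho> assume \<rho>: "\<rho> \<in> ?I"
    then have "\<rho> \<in> marked_ruffles lam mu" by (simp add: marked_ruffles'_def)
    from ruffle_weight_code[OF this \<rho>]
    show "E \<rho> = chain_idem (map Some ([] @ code_word lam mu (ruffle_code lam mu \<rho>))) [] []" by (simp add: E_def)
  qed
  then obtain u v where fin: "finite ?I"
    and u: "\<forall>i\<in>?I. e * u i = u i" "\<forall>i\<in>?I. u i * E i = u i"
    and v: "\<forall>i\<in>?I. E i * v i = v i" "\<forall>i\<in>?I. v i * e = v i"
    and vu: "\<forall>i\<in>?I. \<forall>j\<in>?I. v i * u j = (if i = j then E i else 0)"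
    and uv: "(\<Sum>i\<in>?I. u i * v i) = e" by (rule decomposesE)
  have ee: "e * e = e" and EE: "E i * E i = E i" for i by (simp_all add: e_def E_def chain_idem_idem)
  define X where "X = prod_gset (tuples_gset (length lam)) (tuples_gset (length mu))"
  define Y where "Y = coprod_gset ?I (\<lambda>\<rho>. tuples_gset (length (?w \<rho>)))"
  let ?cx = "\<lambda>(x, y). x @ y :: real list"
  have X: "coded_gset X (\<lambda>_. ()) ?cx {()} (\<lambda>_. length lam + length mu)" unfolding X_def by (rule coded_prod)
  have Y: "coded_gset Y fst snd ?I (\<lambda>\<rho>. length (?w \<rho>))" unfolding Y_def by (rule coded_coprod[OF fin])
  let ?P = "M lam \<otimes>\<^sub>K M mu :: (real list \<times> real list, 'k) kobj"
  let ?Q = "kdirect_sum ?I (\<lambda>\<rho>. M (?w \<rho>)) :: (ruffle \<times> real list, 'k) kobj"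
  have baseP: "base ?P = X" by (simp add: ktensor_def base_M X_def Let_def)
  have baseQ: "base ?Q = Y" by (simp add: kdirect_sum_def base_M Y_def Let_def)
  \<comment> \<open>The diagonal matrix of the idempotents of the summands.\<close>
  let ?D = "\<lambda>j i. if j = i then E i else 0"
  have idemP: "idem ?P = kernel_mor X (\<lambda>_. ()) ?cx X (\<lambda>_. ()) ?cx (\<lambda>_ _. e)"
  proof -
    have "(\<lambda>((y, y'), x, x')\<in>points X \<times> points X. idem (M lam) (y, x) * idem (M mu) (y', x') :: 'k) =
      (\<lambda>(y, x)\<in>points X \<times> points X. entry e (?cx y) (?cx x))"
    proof (rule restrict_ext, clarify)
      fix y y' x x' assume "(y, y') \<in> points X" "(x, x') \<in> points X"
      then have "y \<in> increasing_tuples UNIV (length lam)" "x \<in> increasing_tuples UNIV (length lam)"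
        "y' \<in> increasing_tuples UNIV (length mu)" "x' \<in> increasing_tuples UNIV (length mu)"
        by (auto simp: X_def prod_gset_def tuples_gset_def)
      moreover from this have "length y = length lam" "length x = length lam" by (auto simp: increasing_tuples_def)
      ultimately show "(idem (M lam) (y, x) * idem (M mu) (y', x') :: 'k) = entry e (y @ y') (x @ x')"
        by (simp add: M_def Let_def tuples_gset_def e_def entry_two_chains)
    qed
    then show ?thesis by (simp add: ktensor_def Let_def kernel_mor_def X_def M_def)
  qed
  have idemQ: "idem ?Q = kernel_mor Y fst snd Y fst snd ?D"
  proof -
    have "(\<lambda>((i, y), j, x)\<in>points Y \<times> points Y. if i = j then idem (M (?w i)) (y, x) else 0 :: 'k) =
      (\<lambda>(y, x)\<in>points Y \<times> points Y. entry (?D (fst y) (fst x)) (snd y) (snd x))"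
    proof (rule restrict_ext, clarify)
      fix i y j x assume "(i, y) \<in> points Y" "(j, x) \<in> points Y"
      then show "(if i = j then idem (M (?w i)) (y, x) else 0 :: 'k) =
          entry (?D (fst (i, y)) (fst (j, x))) (snd (i, y)) (snd (j, x))"
        by (auto simp: Y_def coprod_gset_def tuples_gset_def M_def Let_def E_def entry_chain zero_kern.rep_eq)
    qed
    then show ?thesis by (simp add: kdirect_sum_def Let_def kernel_mor_def Y_def base_M)
  qed
  have suppX: "\<exists>p\<in>points X. () = i \<and> ?cx p = c" if "e * K = K" "entry K c x \<noteq> 0" for K c x i
    using entry_left_support[OF that] two_chains_support[of lam mu c, where 'k = 'k] unfolding X_def e_def by auto
  have suppE: "\<exists>p\<in>points Y. fst p = i \<and> snd p = c" if i: "i \<in> ?I" and K: "E i * K = K" "entry K c x \<noteq> 0" for K c x i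
  proof -
    obtain y where "entry (E i) c y \<noteq> 0" using entry_left_support[OF K] by blast
    then have "c \<in> increasing_tuples UNIV (length (?w i))" by (auto simp: E_def entry_chain of_bool_def split: if_splits)
    then have "(i, c) \<in> points Y" using i by (simp add: Y_def coprod_gset_def tuples_gset_def)
    then show ?thesis by force
  qed
  \<comment> \<open>A column and a row of kernels: \<open>vu\<close> says that \<open>A\<close>
    after \<open>B\<close> is the identity of the direct sum, and \<open>uv\<close> that
    \<open>B\<close> after \<open>A\<close> is that of the tensor product.\<close>
  define A where "A = kernel_mor X (\<lambda>_. ()) ?cx Y fst snd (\<lambda>i _. v i)"
  define B where "B = kernel_mor Y fst snd X (\<lambda>_. ()) ?cx (\<lambda>_ i. u i)"
  have suppD: "\<exists>p\<in>points Y. fst p = j \<and> snd p = c" if "j \<in> ?I" "entry (?D j i) c x \<noteq> 0" for j i c x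
    using that suppE[OF that(1) EE, of c x] by (auto simp: zero_kern.rep_eq split: if_splits)
  have suppv: "\<exists>p\<in>points Y. fst p = j \<and> snd p = c" if "j \<in> ?I" "entry (v j) c x \<noteq> 0" for j c x
    using suppE[OF that(1) _ that(2)] v that(1) by blast
  have suppu: "\<exists>p\<in>points X. () = i \<and> ?cx p = c" if "j \<in> ?I" "entry (u j) c x \<noteq> 0" for i j c x
    using suppX[OF _ that(2)] u that(1) by blast
  have sumD: "(\<Sum>j\<in>?I. ?D h j * F j) = E h * F h" "(\<Sum>j\<in>?I. F j * ?D j h) = F h * E h" if "h \<in> ?I" for F h
    using fin that by (simp_all add: if_distrib[of "\<lambda>a. a * _"] if_distrib[of "\<lambda>a. _ * a"] cong: if_cong)
  have PP: "comp_mor X X X (idem ?P) (idem ?P) = idem ?P"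
    unfolding idemP by (rule kernel_mor_comp[OF X X X], rule suppX[OF ee], assumption, simp add: ee)
  have QQ: "comp_mor Y Y Y (idem ?Q) (idem ?Q) = idem ?Q"
    unfolding idemQ by (rule kernel_mor_comp[OF Y Y Y], rule suppD, assumption+, subst sumD, assumption, simp add: EE)
  have AP: "comp_mor X X Y A (idem ?P) = A"
    unfolding idemP A_def by (rule kernel_mor_comp[OF X X Y], rule suppX[OF ee], assumption, simp add: v)
  have QA: "comp_mor X Y Y (idem ?Q) A = A"
    unfolding idemQ A_def by (rule kernel_mor_comp[OF X Y Y], rule suppv, assumption+, subst sumD, assumption, simp add: v)
  have BQ: "comp_mor Y Y X B (idem ?Q) = B"
    unfolding idemQ B_def by (rule kernel_mor_comp[OF Y Y X], rule suppD, assumption+, subst sumD, assumption, simp add: u)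
  have PB: "comp_mor Y X X (idem ?P) B = B"
    unfolding idemP B_def by (rule kernel_mor_comp[OF Y X X], rule suppu, assumption+, simp add: u)
  have BA: "comp_mor X Y X B A = idem ?P"
    unfolding idemP A_def B_def by (rule kernel_mor_comp[OF X Y X], rule suppv, assumption+, simp add: uv)
  have AB: "comp_mor Y X Y A B = idem ?Q"
    unfolding idemQ A_def B_def by (rule kernel_mor_comp[OF Y X Y], rule suppu, assumption+, simp add: vu)
  have Pm: "idem ?P \<in> mors X X" unfolding idemP by (rule kernel_mor_mors[OF X X])
  have Qm: "idem ?Q \<in> mors Y Y" unfolding idemQ by (rule kernel_mor_mors[OF Y Y])
  have Am: "A \<in> mors X Y" unfolding A_def by (rule kernel_mor_mors[OF X Y])
  have Bm: "B \<in> mors Y X" unfolding B_def by (rule kernel_mor_mors[OF Y X])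
  have "is_kobj ?P" unfolding is_kobj_def baseP using coded_gset.is_gset[OF X] Pm PP by blast
  moreover have "is_kobj ?Q" unfolding is_kobj_def baseQ using coded_gset.is_gset[OF Y] Qm QQ by blast
  moreover have "A \<in> khom ?P ?Q" unfolding khom_def baseP baseQ using Am AP QA by blast
  moreover have "B \<in> khom ?Q ?P" unfolding khom_def baseP baseQ using Bm BQ PB by blast
  ultimately show ?thesis unfolding kiso_def baseP baseQ using BA AB by blast
qed

end
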